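(* For every sentence $\phi$ of the logic $\mathsf{C}^2$, there exists a Presburger formula $\textsf{PREB}(x)$ with one free variable such that $\{n\in\mathbb{N} \mid \textsf{PREB}(n) \text{ holds}\} = \textsc{Spec}(\phi)$. Moreover, the formula $\textsf{PREB}(x)$ can be constructed effectively from $\phi$.
   Context: $\mathsf{C}^2$ (two-variable logic with counting) is the set of first-order formulas over a vocabulary of unary predicate symbols and binary predicate symbols, built from atoms $z=z$, $R(z,z)$, $P(z)$ (with $z$ ranging over the two variables $x,y$, $R$ binary, $P$ unary) using $\neg$, $\wedge$ and counting quantifiers $\exists^k z\,\phi$ ($k\ge 1$), where $\exists^k z\,\phi$ means "there are at least $k$ elements $z$ such that $\phi$ holds"; $\exists^0 z\,\phi$ always holds. The spectrum $\textsc{Spec}(\phi)$ of a sentence $\phi$ is the set of natural numbers $n$ such that $\phi$ has a finite model with exactly $n$ elements. A Presburger formula is a first-order formula in the language with $+$, $\le$, $0$, $1$, interpreted over $\mathbb{N}=\{0,1,2,\dots\}$ in the natural way. *)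

theory Defs
  imports Main "HOL-Library.Nat_Bijection"
begin

section \<open>Two-variable logic with counting\<close>

datatype var = VX | VY

text \<open>Predicate symbols are indexed by natural numbers; a formula mentions finitely many of them.
  The formula \<open>CEx k z \<phi>\<close> is the counting quantification ``at least \<open>k\<close> elements \<open>z\<close> satisfy \<open>\<phi>\<close>''.\<close>

datatype c2 =
    CEq var var
  | CBin nat var var
  | CUn nat var
  | CNot c2
  | CAnd c2 c2
  | CEx nat var c2

fun c2_fv :: "c2 \<Rightarrow> var set" where
  "c2_fv (CEq u v) = {u, v}"
| "c2_fv (CBin R u v) = {u, v}"
| "c2_fv (CUn P u) = {u}"
| "c2_fv (CNot \<phi>) = c2_fv \<phi>"
| "c2_fv (CAnd \<phi> \<psi>) = c2_fv \<phi> \<union> c2_fv \<psi>"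
| "c2_fv (CEx k z \<phi>) = c2_fv \<phi> - {z}"

definition c2_sentence :: "c2 \<Rightarrow> bool" where
  "c2_sentence \<phi> \<longleftrightarrow> c2_fv \<phi> = {}"

record 'u struct =
  Dom :: "'u set"
  Unary :: "nat \<Rightarrow> 'u \<Rightarrow> bool"
  Binary :: "nat \<Rightarrow> 'u \<Rightarrow> 'u \<Rightarrow> bool"

fun c2_sat :: "'u struct \<Rightarrow> (var \<Rightarrow> 'u) \<Rightarrow> c2 \<Rightarrow> bool" where
  "c2_sat M \<sigma> (CEq u v) \<longleftrightarrow> \<sigma> u = \<sigma> v"
| "c2_sat M \<sigma> (CBin R u v) \<longleftrightarrow> Binary M R (\<sigma> u) (\<sigma> v)"
| "c2_sat M \<sigma> (CUn P u) \<longleftrightarrow> Unary M P (\<sigma> u)"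
| "c2_sat M \<sigma> (CNot \<phi>) \<longleftrightarrow> \<not> c2_sat M \<sigma> \<phi>"
| "c2_sat M \<sigma> (CAnd \<phi> \<psi>) \<longleftrightarrow> c2_sat M \<sigma> \<phi> \<and> c2_sat M \<sigma> \<psi>"
| "c2_sat M \<sigma> (CEx k z \<phi>) \<longleftrightarrow>
     (\<exists>S \<subseteq> Dom M. finite S \<and> card S = k \<and> (\<forall>a\<in>S. c2_sat M (\<sigma>(z := a)) \<phi>))"

definition c2_model :: "'u struct \<Rightarrow> c2 \<Rightarrow> bool" where
  "c2_model M \<phi> \<longleftrightarrow> Dom M \<noteq> {} \<and> (\<forall>\<sigma>. range \<sigma> \<subseteq> Dom M \<longrightarrow> c2_sat M \<sigma> \<phi>)"

text \<open>Restricting the universes to sets of natural numbers is no loss of generality: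
  see \<open>Spec_any_type\<close> below.\<close>

definition Spec :: "c2 \<Rightarrow> nat set" where
  "Spec \<phi> = {n. \<exists>M :: nat struct. finite (Dom M) \<and> card (Dom M) = n \<and> c2_model M \<phi>}"

lemma c2_sat_iso:
  fixes M :: "'u struct" and N :: "'v struct"
  assumes h: "bij_betw h (Dom M) (Dom N)"
    and U: "\<And>P a. a \<in> Dom M \<Longrightarrow> Unary N P (h a) = Unary M P a"
    and B: "\<And>R a b. a \<in> Dom M \<Longrightarrow> b \<in> Dom M \<Longrightarrow> Binary N R (h a) (h b) = Binary M R a b"
    and \<sigma>: "range \<sigma> \<subseteq> Dom M"
  shows "c2_sat N (h \<circ> \<sigma>) \<phi> = c2_sat M \<sigma> \<phi>"
  using \<sigma>
proof (induction \<phi> arbitrary: \<sigma>)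
  case (CEq u v)
  then have "\<sigma> u \<in> Dom M" "\<sigma> v \<in> Dom M" by auto
  then show ?case using h by (auto simp: bij_betw_def dest: inj_onD)
next
  case (CBin R u v)
  then have "\<sigma> u \<in> Dom M" "\<sigma> v \<in> Dom M" by auto
  then show ?case using B by simp
next
  case (CUn P u)
  then have "\<sigma> u \<in> Dom M" by auto
  then show ?case using U by simp
next
  case (CEx k z \<phi>)
  have upd: "c2_sat N ((h \<circ> \<sigma>)(z := h a)) \<phi> = c2_sat M (\<sigma>(z := a)) \<phi>" if "a \<in> Dom M" for a
  proof -
    have "range (\<sigma>(z := a)) \<subseteq> Dom M" using that CEx.prems by auto
    moreover have "h \<circ> \<sigma>(z := a) = (h \<circ> \<sigma>)(z := h a)" by auto
    ultimately show ?thesis using CEx.IH[of "\<sigma>(z := a)"] by metis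
  qed
  have inj: "inj_on h (Dom M)" and im: "h ` Dom M = Dom N"
    using h by (auto simp: bij_betw_def)
  show ?case
  proof
    assume "c2_sat N (h \<circ> \<sigma>) (CEx k z \<phi>)"
    then obtain S where S: "S \<subseteq> h ` Dom M" "finite S" "card S = k"
      "\<forall>a\<in>S. c2_sat N ((h \<circ> \<sigma>)(z := a)) \<phi>" using im by auto
    from S(1) obtain T where T: "T \<subseteq> Dom M" "S = h ` T" by (auto simp: subset_image_iff)
    have "inj_on h T" using inj T(1) by (rule inj_on_subset)
    then have "finite T" "card T = k" using S T by (auto simp: finite_image_iff card_image)
    moreover have "\<forall>a\<in>T. c2_sat M (\<sigma>(z := a)) \<phi>" using S(4) T upd by blast
    ultimately show "c2_sat M \<sigma> (CEx k z \<phi>)" using T(1) by auto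
  next
    assume "c2_sat M \<sigma> (CEx k z \<phi>)"
    then obtain T where T: "T \<subseteq> Dom M" "finite T" "card T = k"
      "\<forall>a\<in>T. c2_sat M (\<sigma>(z := a)) \<phi>" by auto
    have "inj_on h T" using inj T(1) by (rule inj_on_subset)
    then have "card (h ` T) = k" using T by (simp add: card_image)
    moreover have "h ` T \<subseteq> Dom N" using T(1) im by blast
    moreover have "\<forall>a\<in>h ` T. c2_sat N ((h \<circ> \<sigma>)(z := a)) \<phi>" using T upd by blast
    ultimately show "c2_sat N (h \<circ> \<sigma>) (CEx k z \<phi>)"
      using T(2) by (auto intro!: exI[of _ "h ` T"])
  qed
qed simp_all

lemma Spec_any_type:
  fixes M :: "'u struct"
  assumes fin: "finite (Dom M)" and M: "c2_model M \<phi>"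
  shows "card (Dom M) \<in> Spec \<phi>"
proof -
  obtain g where g: "bij_betw g {0..<card (Dom M)} (Dom M)"
    using ex_bij_betw_nat_finite[OF fin] by blast
  define N :: "nat struct" where
    "N = \<lparr>Dom = {0..<card (Dom M)}, Unary = \<lambda>P a. Unary M P (g a), Binary = \<lambda>R a b. Binary M R (g a) (g b)\<rparr>"
  have g': "bij_betw g (Dom N) (Dom M)" using g by (simp add: N_def)
  have "c2_sat N \<sigma> \<phi>" if "range \<sigma> \<subseteq> Dom N" for \<sigma>
  proof -
    have "c2_sat M (g \<circ> \<sigma>) \<phi> = c2_sat N \<sigma> \<phi>"
      by (rule c2_sat_iso[OF g' _ _ that]) (simp_all add: N_def)
    moreover have "range (g \<circ> \<sigma>) \<subseteq> Dom M" using that g' by (auto simp: bij_betw_def)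
    ultimately show ?thesis using M by (auto simp: c2_model_def)
  qed
  moreover have "Dom N \<noteq> {}" using M g' by (auto simp: c2_model_def bij_betw_def)
  ultimately have "c2_model N \<phi>" by (simp add: c2_model_def)
  then show ?thesis unfolding Spec_def by (auto intro!: exI[of _ N] simp: N_def)
qed


section \<open>Presburger formulas\<close>

datatype pterm = PVar nat | PZero | POne | PAdd pterm pterm

datatype presb =
    PLe pterm pterm
  | PEq pterm pterm
  | PNot presb
  | PAnd presb presb
  | PEx nat presb

fun pterm_vars :: "pterm \<Rightarrow> nat set" where
  "pterm_vars (PVar i) = {i}"
| "pterm_vars PZero = {}"
| "pterm_vars POne = {}"
| "pterm_vars (PAdd s t) = pterm_vars s \<union> pterm_vars t"

fun presb_fv :: "presb \<Rightarrow> nat set" where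
  "presb_fv (PLe s t) = pterm_vars s \<union> pterm_vars t"
| "presb_fv (PEq s t) = pterm_vars s \<union> pterm_vars t"
| "presb_fv (PNot \<psi>) = presb_fv \<psi>"
| "presb_fv (PAnd \<psi> \<chi>) = presb_fv \<psi> \<union> presb_fv \<chi>"
| "presb_fv (PEx i \<psi>) = presb_fv \<psi> - {i}"

fun pterm_val :: "(nat \<Rightarrow> nat) \<Rightarrow> pterm \<Rightarrow> nat" where
  "pterm_val e (PVar i) = e i"
| "pterm_val e PZero = 0"
| "pterm_val e POne = 1"
| "pterm_val e (PAdd s t) = pterm_val e s + pterm_val e t"

fun presb_sat :: "(nat \<Rightarrow> nat) \<Rightarrow> presb \<Rightarrow> bool" where
  "presb_sat e (PLe s t) \<longleftrightarrow> pterm_val e s \<le> pterm_val e t"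
| "presb_sat e (PEq s t) \<longleftrightarrow> pterm_val e s = pterm_val e t"
| "presb_sat e (PNot \<psi>) \<longleftrightarrow> \<not> presb_sat e \<psi>"
| "presb_sat e (PAnd \<psi> \<chi>) \<longleftrightarrow> presb_sat e \<psi> \<and> presb_sat e \<chi>"
| "presb_sat e (PEx i \<psi>) \<longleftrightarrow> (\<exists>m. presb_sat (e(i := m)) \<psi>)"

text \<open>Truth of \<open>\<psi>(n)\<close> for a formula whose only free variable is variable \<open>0\<close>;
  the values of the other variables are then irrelevant.\<close>

definition presb_holds :: "presb \<Rightarrow> nat \<Rightarrow> bool" where
  "presb_holds \<psi> n \<longleftrightarrow> presb_sat ((\<lambda>_. 0)(0 := n)) \<psi>"


section \<open>Effectiveness\<close>

text \<open>Kleene's general recursive functions: \<open>recursive n f\<close> says that \<open>f\<close>, restricted to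
  argument lists of length \<open>n\<close>, is an \<open>n\<close>-ary recursive function. Minimisation is applied to
  regular functions only, which yields exactly the total computable functions. The values of \<open>f\<close>
  on lists of any other length are meaningless and never used.\<close>

inductive recursive :: "nat \<Rightarrow> (nat list \<Rightarrow> nat) \<Rightarrow> bool" where
  zero: "recursive n (\<lambda>xs. 0)"
| succ: "recursive 1 (\<lambda>xs. Suc (xs ! 0))"
| proj: "i < n \<Longrightarrow> recursive n (\<lambda>xs. xs ! i)"
| comp: "recursive (length gs) f \<Longrightarrow> (\<forall>g\<in>set gs. recursive n g) \<Longrightarrow>
    recursive n (\<lambda>xs. f (map (\<lambda>g. g xs) gs))"
| prec: "recursive n f \<Longrightarrow> recursive (Suc (Suc n)) g \<Longrightarrow>
    recursive (Suc n) (\<lambda>xs. rec_nat (f (tl xs)) (\<lambda>k r. g (k # r # tl xs)) (hd xs))"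
| mini: "recursive (Suc n) f \<Longrightarrow> (\<forall>xs. length xs = n \<longrightarrow> (\<exists>k. f (k # xs) = 0)) \<Longrightarrow>
    recursive n (\<lambda>xs. LEAST k. f (k # xs) = 0)"

fun var_code :: "var \<Rightarrow> nat" where
  "var_code VX = 0"
| "var_code VY = 1"

fun c2_code :: "c2 \<Rightarrow> nat" where
  "c2_code (CEq u v) = prod_encode (0, prod_encode (var_code u, var_code v))"
| "c2_code (CBin R u v) = prod_encode (1, prod_encode (R, prod_encode (var_code u, var_code v)))"
| "c2_code (CUn P u) = prod_encode (2, prod_encode (P, var_code u))"
| "c2_code (CNot \<phi>) = prod_encode (3, c2_code \<phi>)"
| "c2_code (CAnd \<phi> \<psi>) = prod_encode (4, prod_encode (c2_code \<phi>, c2_code \<psi>))"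
| "c2_code (CEx k z \<phi>) = prod_encode (5, prod_encode (k, prod_encode (var_code z, c2_code \<phi>)))"

fun pterm_code :: "pterm \<Rightarrow> nat" where
  "pterm_code (PVar i) = prod_encode (0, i)"
| "pterm_code PZero = prod_encode (1, 0)"
| "pterm_code POne = prod_encode (2, 0)"
| "pterm_code (PAdd s t) = prod_encode (3, prod_encode (pterm_code s, pterm_code t))"

fun presb_code :: "presb \<Rightarrow> nat" where
  "presb_code (PLe s t) = prod_encode (0, prod_encode (pterm_code s, pterm_code t))"
| "presb_code (PEq s t) = prod_encode (1, prod_encode (pterm_code s, pterm_code t))"
| "presb_code (PNot \<psi>) = prod_encode (2, presb_code \<psi>)"
| "presb_code (PAnd \<psi> \<chi>) = prod_encode (3, prod_encode (presb_code \<psi>, presb_code \<chi>))"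
| "presb_code (PEx i \<psi>) = prod_encode (4, prod_encode (i, presb_code \<psi>))"

lemma var_code_inject [simp]: "var_code u = var_code v \<longleftrightarrow> u = v"
  by (cases u; cases v) auto

lemma c2_code_inject [simp]: "c2_code \<phi> = c2_code \<psi> \<longleftrightarrow> \<phi> = \<psi>"
  by (induction \<phi> arbitrary: \<psi>) (case_tac \<psi>; simp)+

lemma pterm_code_inject [simp]: "pterm_code s = pterm_code t \<longleftrightarrow> s = t"
  by (induction s arbitrary: t) (case_tac t; simp)+

lemma presb_code_inject [simp]: "presb_code \<phi> = presb_code \<psi> \<longleftrightarrow> \<phi> = \<psi>"
  by (induction \<phi> arbitrary: \<psi>) (case_tac \<psi>; simp)+

text \<open>A map from sentences to Presburger formulas is effective if a recursive function computes
  the code of its value from the code of its argument.\<close>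

definition effective :: "(c2 \<Rightarrow> presb) \<Rightarrow> bool" where
  "effective F \<longleftrightarrow>
     (\<exists>f. recursive 1 f \<and> (\<forall>\<phi>. c2_sentence \<phi> \<longrightarrow> f [c2_code \<phi>] = presb_code (F \<phi>)))"

end

theory Submission
  imports Defs "HOL-Library.FuncSet"
begin

text \<open>Let \<open>c\<close> be the code of the sentence \<open>\<phi>\<close>. A finite model is viewed as a complete graph whose edges are
  labelled by binary atomic types and whose vertices are coloured by the formulas of code at most
  \<open>c\<close> they satisfy; truth of \<open>\<phi>\<close> is preserved as long as every vertex keeps, for each colour and
  label, its number of neighbours truncated at \<open>c\<close>. Each vertex selects boundedly many essential
  neighbours witnessing these truncated numbers. Essential edges that matter to one end only can be
  redistributed freely among sufficiently large classes of vertices, and non-essential edges can be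
  given a default label; only edges essential for both ends impose a balance condition, which is
  linear in the number of vertices of each sort. Hence a large model splits into balanced blocks of bounded
  size, and \<open>p = L!\<close> vertices, forming a union of such blocks, can be removed or duplicated, the
  mutually essential edges being repaired by switching. So the spectrum is periodic with period \<open>p\<close>
  beyond a threshold, where \<open>p\<close> and the threshold are recursive in \<open>c\<close>, and membership below the
  threshold is decided by exhaustive search.\<close>

section \<open>Zero-sum partitions\<close>

text \<open>An edge essential for one end only is harmless for the other end, whose supply of such
  neighbours is already saturated; this is why it can be redirected. An edge essential for both ends
  has kind \<open>k\<close> seen from one end and \<open>iv k\<close> from the other, so the degree
  sums of \<open>k\<close> and \<open>iv k\<close> must agree. Each vertex contributes a bounded
  difference to each of these equations, so the bound \<open>L\<close> on zero-sum blocks does not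
  depend on the size of the model. The sizes of the blocks are not under control, but one size
  \<open>h\<close> occurs often, and since \<open>h\<close> divides \<open>L!\<close>, exactly
  \<open>L! / h\<close> blocks of that size give \<open>L!\<close> vertices. One and the same set
  serves for removal and for duplication, which yields both directions of periodicity. The set has
  to avoid what cannot be rebuilt: vertices of types with few members, their essential neighbours,
  and the ends of edges of rare kinds; every other kind keeps enough edges for switching. Two
  variables are what makes the argument local: a pair is described by two colours and a label, and
  quantifying one variable leaves a single vertex described by its colour.\<close>

lemma zero_sum_prefixes:
  fixes w :: "'a \<Rightarrow> int"
  assumes fin: "finite X" and bd: "\<And>x. x \<in> X \<Longrightarrow> \<bar>w x\<bar> \<le> int m" and zero: "sum w X = 0"
    and "k \<le> card X"
  shows "\<exists>xs. distinct xs \<and> set xs \<subseteq> X \<and> length xs = k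
    \<and> (\<forall>i\<le>k. \<bar>sum_list (map w (take i xs))\<bar> \<le> int m)"
  using \<open>k \<le> card X\<close>
proof (induction k)
  case 0
  then show ?case by (intro exI[of _ "[]"]) auto
next
  case (Suc k)
  then obtain xs where xs: "distinct xs" "set xs \<subseteq> X" "length xs = k"
    "\<And>i. i \<le> k \<Longrightarrow> \<bar>sum_list (map w (take i xs))\<bar> \<le> int m" by auto
  define s where "s = sum_list (map w xs)"
  have s: "s = sum w (set xs)" using xs(1) by (simp add: s_def sum_list_distinct_conv_sum_set)
  have sm: "\<bar>s\<bar> \<le> int m" using xs(4)[of k] xs(3) by (simp add: s_def)
  define Y where "Y = X - set xs"
  have "card (set xs) = k" using xs by (simp add: distinct_card)
  then have "X \<noteq> set xs" using Suc.prems by auto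
  then have Y: "Y \<noteq> {}" "finite Y" using xs(2) fin by (auto simp: Y_def)
  have sY: "sum w Y = - s" unfolding Y_def using sum_diff[OF fin xs(2), of w] zero s by simp
  \<comment> \<open>The weights outside \<open>xs\<close> sum to \<open>- s\<close>, so one of them
    is nonnegative if \<open>s \<le> 0\<close>, and one is nonpositive otherwise; adding it keeps
    the running sum within \<open>m\<close>. This is the greedy argument behind the Steinitz lemma
    in dimension one.\<close>
  have "\<exists>r\<in>Y. \<bar>s + w r\<bar> \<le> int m"
  proof (cases "s \<le> 0")
    case True
    have "\<exists>r\<in>Y. w r \<ge> 0"
    proof (rule ccontr)
      assume "\<not> (\<exists>r\<in>Y. w r \<ge> 0)"
      then have "sum w Y < (\<Sum>r\<in>Y. 0)" using Y by (intro sum_strict_mono) auto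
      then show False using True sY by simp
    qed
    then obtain r where "r \<in> Y" "w r \<ge> 0" by auto
    then show ?thesis using True bd[of r] sm by (intro bexI[of _ r]) (auto simp: Y_def)
  next
    case False
    have "\<exists>r\<in>Y. w r \<le> 0"
    proof (rule ccontr)
      assume "\<not> (\<exists>r\<in>Y. w r \<le> 0)"
      then have "(\<Sum>r\<in>Y. 0) < sum w Y" using Y by (intro sum_strict_mono) auto
      then show False using False sY by simp
    qed
    then obtain r where "r \<in> Y" "w r \<le> 0" by auto
    then show ?thesis using False bd[of r] sm by (intro bexI[of _ r]) (auto simp: Y_def)
  qed
  then obtain r where r: "r \<in> Y" "\<bar>s + w r\<bar> \<le> int m" by auto
  show ?case
  proof (intro exI[of _ "xs @ [r]"] conjI allI impI)
    fix i assume i: "i \<le> Suc k"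
    show "\<bar>sum_list (map w (take i (xs @ [r])))\<bar> \<le> int m"
    proof (cases "i = Suc k")
      case True
      then show ?thesis using r(2) xs(3) by (simp add: s_def)
    next
      case False
      then show ?thesis using i xs(3) xs(4)[of i] by simp
    qed
  qed (use xs r in \<open>auto simp: Y_def\<close>)
qed

text \<open>Pigeonhole: \<open>2 * m + 2\<close> prefix sums lie among \<open>2 * m + 1\<close>
  integers, and the segment between two equal prefix sums has weight zero.\<close>

lemma zero_sum_block:
  fixes w :: "'a \<Rightarrow> int"
  assumes fin: "finite X" and bd: "\<And>x. x \<in> X \<Longrightarrow> \<bar>w x\<bar> \<le> int m" and zero: "sum w X = 0"
    and ne: "X \<noteq> {}"
  shows "\<exists>Y\<subseteq>X. Y \<noteq> {} \<and> card Y \<le> 2 * m + 1 \<and> sum w Y = 0"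
proof (cases "card X \<le> 2 * m + 1")
  case True
  then show ?thesis using zero ne by blast
next
  case False
  define k where "k = 2 * m + 1"
  obtain xs where xs: "distinct xs" "set xs \<subseteq> X" "length xs = k"
    "\<And>i. i \<le> k \<Longrightarrow> \<bar>sum_list (map w (take i xs))\<bar> \<le> int m"
    using zero_sum_prefixes[OF fin bd zero, of k] False by (auto simp: k_def)
  define g where "g i = sum_list (map w (take i xs))" for i
  have "g ` {..k} \<subseteq> {- int m..int m}" using xs(4) by (force simp: g_def abs_le_iff)
  then have "card (g ` {..k}) \<le> card {- int m..int m}" by (intro card_mono) auto
  then have "card (g ` {..k}) < card {..k}" by (simp add: k_def)
  then have "\<not> inj_on g {..k}" using card_image[of g "{..k}"] by auto
  then obtain i j where ij: "i < j" "j \<le> k" "g i = g j"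
    unfolding inj_on_def by (metis atMost_iff nat_neq_iff)
  define ys where "ys = drop i (take j xs)"
  have "take j xs = take i xs @ ys" using ij(1)
    by (metis append_take_drop_id less_imp_le min.absorb1 take_take ys_def)
  then have "sum_list (map w ys) = 0" using ij(3) by (simp add: g_def)
  moreover have dy: "distinct ys" using xs(1) by (simp add: ys_def)
  ultimately have "sum w (set ys) = 0" by (simp add: sum_list_distinct_conv_sum_set)
  moreover have "set ys \<subseteq> X" using xs(2) by (auto simp: ys_def dest!: in_set_dropD in_set_takeD)
  moreover have len: "length ys = j - i" using ij xs(3) by (simp add: ys_def)
  then have "set ys \<noteq> {}" using ij by auto
  moreover have "card (set ys) \<le> 2 * m + 1" using dy len ij by (simp add: distinct_card k_def)
  ultimately show ?thesis by blast
qed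

definition zero_sum_partition ::
    "('a \<Rightarrow> 'k \<Rightarrow> int) \<Rightarrow> 'k set \<Rightarrow> nat \<Rightarrow> 'a set \<Rightarrow> 'a set set \<Rightarrow> bool" where
  "zero_sum_partition w I L X P \<longleftrightarrow> \<Union>P = X \<and> pairwise disjnt P
     \<and> (\<forall>Y\<in>P. Y \<noteq> {} \<and> card Y \<le> L \<and> (\<forall>k\<in>I. (\<Sum>x\<in>Y. w x k) = 0))"

text \<open>Zero-sum blocks are peeled off until nothing is left. The index set \<open>{()}\<close>
  makes the one-dimensional problem an instance of \<open>zero_sum_partition\<close>.\<close>

lemma zero_sum_partition_single:
  fixes w :: "'a \<Rightarrow> int"
  assumes "finite X" and "\<And>x. x \<in> X \<Longrightarrow> \<bar>w x\<bar> \<le> int m" and "sum w X = 0"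
  shows "\<exists>P. zero_sum_partition (\<lambda>x _. w x) {()} (2 * m + 1) X P"
  using assms
proof (induction "card X" arbitrary: X rule: less_induct)
  case less
  show ?case
  proof (cases "X = {}")
    case True
    then show ?thesis by (intro exI[of _ "{}"]) (simp add: zero_sum_partition_def)
  next
    case False
    obtain Y where Y: "Y \<subseteq> X" "Y \<noteq> {}" "card Y \<le> 2 * m + 1" "sum w Y = 0"
      using zero_sum_block[OF less.prems False] by blast
    have "card (X - Y) < card X" using Y less.prems(1) by (metis Diff_subset double_diff
      psubsetI psubset_card_mono Diff_cancel subset_refl)
    moreover have "sum w (X - Y) = 0" using sum_diff[OF less.prems(1) Y(1), of w] Y less.prems by simp
    ultimately obtain P where P: "zero_sum_partition (\<lambda>x _. w x) {()} (2 * m + 1) (X - Y) P"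
      using less.hyps[of "X - Y"] less.prems by (auto intro: finite_subset)
    have "zero_sum_partition (\<lambda>x _. w x) {()} (2 * m + 1) X (insert Y P)"
      using P Y unfolding zero_sum_partition_def
      by (auto simp: pairwise_insert disjnt_def)
    then show ?thesis by blast
  qed
qed

text \<open>A block of size \<open>L\<close> has weight at most \<open>\<Delta> * L\<close> in the
  next coordinate, so up to \<open>2 * (\<Delta> * L) + 1\<close> blocks are merged into
  one.\<close>

fun block_bound :: "nat \<Rightarrow> nat \<Rightarrow> nat" where
  "block_bound \<Delta> 0 = 1"
| "block_bound \<Delta> (Suc i) = block_bound \<Delta> i * (2 * (\<Delta> * block_bound \<Delta> i) + 1)"

text \<open>The kinds are treated one at a time: the blocks found so far become the weighted elements
  of the next one-dimensional problem.\<close>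

lemma zero_sum_partition_exists:
  fixes w :: "'a \<Rightarrow> 'k \<Rightarrow> int"
  assumes fin: "finite X" and I: "finite I" and bd: "\<And>x k. x \<in> X \<Longrightarrow> \<bar>w x k\<bar> \<le> int \<Delta>"
    and zero: "\<And>k. k \<in> I \<Longrightarrow> (\<Sum>x\<in>X. w x k) = 0"
  shows "\<exists>P. zero_sum_partition w I (block_bound \<Delta> (card I)) X P"
  using I zero
proof (induction I)
  case empty
  show ?case by (intro exI[of _ "(\<lambda>x. {x}) ` X"])
      (auto simp: zero_sum_partition_def pairwise_def disjnt_def)
next
  case (insert k I)
  define L where "L = block_bound \<Delta> (card I)"
  define m where "m = \<Delta> * L"
  obtain P where P: "zero_sum_partition w I L X P" using insert by (auto simp: L_def)
  have PX: "\<Union>P = X" and dP: "pairwise disjnt P" and finP: "finite P"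
    and finY: "\<And>Y. Y \<in> P \<Longrightarrow> finite Y" and cY: "\<And>Y. Y \<in> P \<Longrightarrow> card Y \<le> L \<and> Y \<noteq> {}"
    and zY: "\<And>Y i. Y \<in> P \<Longrightarrow> i \<in> I \<Longrightarrow> (\<Sum>x\<in>Y. w x i) = 0"
    using P fin by (auto simp: zero_sum_partition_def finite_UnionD intro: finite_subset)
  define v where "v Y = (\<Sum>x\<in>Y. w x k)" for Y
  have sumU: "(\<Sum>x\<in>\<Union>R. w x i) = (\<Sum>Y\<in>R. \<Sum>x\<in>Y. w x i)" if "R \<subseteq> P" for R i
    using dP finY that by (subst sum.Union_disjoint) (auto simp: pairwise_def disjnt_def)
  have "\<bar>v Y\<bar> \<le> int m" if "Y \<in> P" for Y
  proof -
    have "\<bar>v Y\<bar> \<le> (\<Sum>x\<in>Y. \<bar>w x k\<bar>)" unfolding v_def by (rule sum_abs)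
    also have "\<dots> \<le> (\<Sum>x\<in>Y. int \<Delta>)" using bd PX that by (intro sum_mono) auto
    also have "\<dots> = int (\<Delta> * card Y)" by simp
    also have "\<dots> \<le> int m" using cY[OF that] unfolding m_def by (intro of_nat_mono mult_le_mono) auto
    finally show ?thesis .
  qed
  moreover have "sum v P = 0" using sumU[of P k] insert.prems[of k] PX by (simp add: v_def)
  ultimately obtain Q where Q: "zero_sum_partition (\<lambda>x _. v x) {()} (2 * m + 1) P Q"
    using zero_sum_partition_single[OF finP, of v m] by blast
  have QP: "\<Union>Q = P" and dQ: "pairwise disjnt Q"
    and cR: "\<And>R. R \<in> Q \<Longrightarrow> R \<noteq> {} \<and> card R \<le> 2 * m + 1 \<and> sum v R = 0"
    using Q by (auto simp: zero_sum_partition_def)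
  have "zero_sum_partition w (insert k I) (L * (2 * m + 1)) X (Union ` Q)"
    unfolding zero_sum_partition_def
  proof (intro conjI ballI)
    show "\<Union> (Union ` Q) = X" using QP PX by blast
    show "pairwise disjnt (Union ` Q)"
    proof (rule pairwiseI)
      fix U1 U2 assume "U1 \<in> Union ` Q" "U2 \<in> Union ` Q" "U1 \<noteq> U2"
      then obtain R1 R2 where R: "R1 \<in> Q" "R2 \<in> Q" "U1 = \<Union>R1" "U2 = \<Union>R2" "R1 \<noteq> R2" by auto
      then have "disjnt R1 R2" using dQ by (simp add: pairwise_def)
      then have "disjnt Y1 Y2" if "Y1 \<in> R1" "Y2 \<in> R2" for Y1 Y2
        using that R(1,2) QP dP by (metis UnionI disjnt_iff pairwise_def)
      then show "disjnt U1 U2" using R by (auto simp: disjnt_def)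
    qed
    fix U assume "U \<in> Union ` Q"
    then obtain R where R: "R \<in> Q" "U = \<Union>R" by auto
    have RP: "R \<subseteq> P" using R QP by auto
    show "U \<noteq> {}" using R cR[OF R(1)] cY RP by blast
    have "card U \<le> (\<Sum>Y\<in>R. card Y)" unfolding R(2)
      by (rule card_Union_le_sum_card)
    also have "\<dots> \<le> (\<Sum>Y\<in>R. L)" using cY RP by (intro sum_mono) auto
    also have "\<dots> = L * card R" by simp
    also have "\<dots> \<le> L * (2 * m + 1)" using cR[OF R(1)] by (intro mult_le_mono2) auto
    finally show "card U \<le> L * (2 * m + 1)" .
    fix i assume i: "i \<in> insert k I"
    show "(\<Sum>x\<in>U. w x i) = 0"
    proof (cases "i = k")
      case True
      then show ?thesis using sumU[OF RP, of k] cR[OF R(1)] R(2) by (simp add: v_def)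
    next
      case False
      then have "(\<Sum>Y\<in>R. \<Sum>x\<in>Y. w x i) = 0" using i zY RP by (intro sum.neutral) auto
      then show ?thesis using sumU[OF RP, of i] R(2) by simp
    qed
  qed
  then show ?case using insert.hyps by (auto simp: L_def m_def)
qed

lemma block_bound_pos: "block_bound \<Delta> i > 0"
  by (induction i) auto

text \<open>Blocks are disjoint, so at most \<open>Z\<close> of them meet \<open>Bad\<close>, and at
  least \<open>L * p\<close> remain. Some size \<open>h\<close> between 1 and \<open>L\<close> then
  occurs at least \<open>p\<close> times, and \<open>p div h\<close> blocks of this size have
  \<open>p\<close> elements together.\<close>

lemma zero_sum_subset:
  fixes w :: "'a \<Rightarrow> 'k \<Rightarrow> int"
  assumes fin: "finite X" and I: "finite I" and bd: "\<And>x k. x \<in> X \<Longrightarrow> \<bar>w x k\<bar> \<le> int \<Delta>"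
    and zero: "\<And>k. k \<in> I \<Longrightarrow> (\<Sum>x\<in>X. w x k) = 0"
    and L: "L = block_bound \<Delta> (card I)" and p: "p = fact L"
    and bad: "card Bad \<le> Z" "finite Bad" and big: "L * (Z + L * p) \<le> card X"
  shows "\<exists>W\<subseteq>X. W \<inter> Bad = {} \<and> card W = p \<and> (\<forall>k\<in>I. (\<Sum>x\<in>W. w x k) = 0)"
proof -
  obtain P where P: "zero_sum_partition w I L X P"
    using zero_sum_partition_exists[of X I w \<Delta>] fin I bd zero unfolding L by blast
  have PX: "\<Union>P = X" and dP: "pairwise disjnt P" and finP: "finite P"
    and finY: "\<And>Y. Y \<in> P \<Longrightarrow> finite Y" and cY: "\<And>Y. Y \<in> P \<Longrightarrow> card Y \<le> L \<and> Y \<noteq> {}"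
    and zY: "\<And>Y i. Y \<in> P \<Longrightarrow> i \<in> I \<Longrightarrow> (\<Sum>x\<in>Y. w x i) = 0"
    using P fin by (auto simp: zero_sum_partition_def finite_UnionD intro: finite_subset)
  have Lpos: "L > 0" using L block_bound_pos by simp
  have ppos: "p > 0" using p by simp
  have "card X \<le> (\<Sum>Y\<in>P. card Y)" using PX card_Union_le_sum_card[of P] by auto
  also have "\<dots> \<le> (\<Sum>Y\<in>P. L)" using cY by (intro sum_mono) auto
  finally have "card X \<le> L * card P" by (simp add: mult.commute)
  then have "L * (Z + L * p) \<le> L * card P" using big by linarith
  then have cP: "Z + L * p \<le> card P" using Lpos by simp
  define G where "G = {Y \<in> P. Y \<inter> Bad = {}}"
  have "\<exists>f. \<forall>Y\<in>P-G. f Y \<in> Y \<inter> Bad" by (rule bchoice) (auto simp: G_def)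
  then obtain f where f: "\<And>Y. Y \<in> P - G \<Longrightarrow> f Y \<in> Y \<inter> Bad" by blast
  have "inj_on f (P - G)"
  proof (rule inj_onI)
    fix Y1 Y2 assume *: "Y1 \<in> P - G" "Y2 \<in> P - G" "f Y1 = f Y2"
    then have "\<not> disjnt Y1 Y2" using f[of Y1] f[of Y2] by (auto simp: disjnt_def)
    then show "Y1 = Y2" using dP * by (auto simp: pairwise_def)
  qed
  then have "card (P - G) \<le> card Bad" using f bad(2) by (intro card_inj_on_le[of f]) auto
  moreover have "card P = card G + card (P - G)" using finP
    by (metis (no_types, lifting) G_def card_Diff_subset card_mono finite_subset le_add_diff_inverse mem_Collect_eq subsetI)
  ultimately have cG: "L * p \<le> card G" using cP bad(1) by simp
  have finG: "finite G" using finP by (simp add: G_def)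
  have "\<exists>h\<in>{1..L}. p \<le> card {Y\<in>G. card Y = h}"
  proof (rule ccontr)
    assume "\<not> ?thesis"
    then have lt: "\<And>h. h \<in> {1..L} \<Longrightarrow> card {Y\<in>G. card Y = h} \<le> p - 1" by force
    have "G = (\<Union>h\<in>{1..L}. {Y\<in>G. card Y = h})"
    proof -
      have "1 \<le> card Y \<and> card Y \<le> L" if "Y \<in> G" for Y
      proof -
        have "Y \<in> P" using that by (simp add: G_def)
        then show ?thesis using cY[of Y] finY[of Y] by (simp add: Suc_le_eq card_gt_0_iff)
      qed
      then show ?thesis by auto
    qed
    then have "card G \<le> (\<Sum>h\<in>{1..L}. card {Y\<in>G. card Y = h})" by (metis card_UN_le finite_atLeastAtMost)
    also have "\<dots> \<le> (\<Sum>h\<in>{1..L}. p - 1)" by (intro sum_mono lt)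
    also have "\<dots> = L * (p - 1)" by simp
    also have "\<dots> < L * p" using Lpos ppos by simp
    finally show False using cG by simp
  qed
  then obtain h where h: "h \<in> {1..L}" "p \<le> card {Y\<in>G. card Y = h}" by auto
  have "h dvd p" using h(1) p by (simp add: dvd_fact)
  then obtain r where r: "p = h * r" by auto
  have "1 * r \<le> h * r" using h(1) by (intro mult_le_mono1) auto
  then have "r \<le> card {Y\<in>G. card Y = h}" using h(2) r by linarith
  then obtain R where R: "R \<subseteq> {Y\<in>G. card Y = h}" "card R = r"
    by (meson obtain_subset_with_card_n)
  have RP: "R \<subseteq> P" using R by (auto simp: G_def)
  have "card (\<Union>R) = (\<Sum>Y\<in>R. card Y)"
    using dP RP finY by (intro card_Union_disjoint) (auto intro: pairwise_subset)
  also have "\<dots> = (\<Sum>Y\<in>R. h)" using R(1) by (intro sum.cong) auto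
  finally have "card (\<Union>R) = p" using r R(2) by simp
  moreover have "\<Union>R \<inter> Bad = {}" using R(1) by (auto simp: G_def)
  moreover have "(\<Sum>x\<in>\<Union>R. w x k) = 0" if "k \<in> I" for k
    using dP finY RP zY that
    by (subst sum.Union_disjoint) (auto simp: pairwise_def disjnt_def subset_iff)
  ultimately show ?thesis using PX RP by (intro exI[of _ "\<Union>R"]) auto
qed

section \<open>Prescribing the degrees of a graph with edge kinds\<close>

definition kdeg :: "'v set \<Rightarrow> ('v \<Rightarrow> 'v \<Rightarrow> 'k option) \<Rightarrow> 'v \<Rightarrow> 'k \<Rightarrow> nat" where
  "kdeg V h u k = card {v \<in> V. h u v = Some k}"

text \<open>An edge bears one kind for each of its ends; \<open>iv\<close> translates between the
  two views.\<close>

definition kgraph :: "'v set \<Rightarrow> ('k \<Rightarrow> 'k) \<Rightarrow> 'k set \<Rightarrow> ('v \<Rightarrow> 'v \<Rightarrow> 'k option) \<Rightarrow> bool" where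
  "kgraph V iv I h \<longleftrightarrow> (\<forall>u v. h v u = map_option iv (h u v)) \<and> (\<forall>u. h u u = None)
     \<and> (\<forall>u v k. h u v = Some k \<longrightarrow> u \<in> V \<and> v \<in> V \<and> k \<in> I)"

lemma kgraph_sym: "kgraph V iv I h \<Longrightarrow> h u v = Some k \<Longrightarrow> h v u = Some (iv k)"
  by (metis kgraph_def option.simps(9))

lemma kgraph_mem: "kgraph V iv I h \<Longrightarrow> h u v = Some k \<Longrightarrow> u \<in> V \<and> v \<in> V \<and> k \<in> I \<and> u \<noteq> v"
  by (metis kgraph_def option.distinct(1))

lemma kgraph_sym_None: "kgraph V iv I h \<Longrightarrow> h u v = None \<Longrightarrow> h v u = None"
  by (metis kgraph_def option.simps(8))

lemma kdeg_pos: "finite V \<Longrightarrow> v \<in> V \<Longrightarrow> h u v = Some k \<Longrightarrow> 0 < kdeg V h u k"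
  by (auto simp: kdeg_def card_gt_0_iff)

lemma kdeg_posD: "0 < kdeg V h u k \<Longrightarrow> \<exists>v\<in>V. h u v = Some k"
  by (auto simp: kdeg_def card_gt_0_iff)

lemma sum_kdeg:
  assumes "finite V"
  shows "(\<Sum>u\<in>V. kdeg V h u k) = card {(u, v). u \<in> V \<and> v \<in> V \<and> h u v = Some k}"
proof -
  have "{(u, v). u \<in> V \<and> v \<in> V \<and> h u v = Some k} = (SIGMA u:V. {v \<in> V. h u v = Some k})" by auto
  then show ?thesis using assms by (simp add: kdeg_def)
qed

text \<open>Reversing the ordered pairs exchanges \<open>k\<close>-edges with
  \<open>iv k\<close>-edges. This is the balance condition that prescribed degrees have to
  meet.\<close>

lemma sum_kdeg_inv:
  assumes "finite V" and h: "kgraph V iv I h" and inv: "\<And>k. iv (iv k) = k"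
  shows "(\<Sum>u\<in>V. kdeg V h u (iv k)) = (\<Sum>u\<in>V. kdeg V h u k)"
proof -
  have "{(u, v). u \<in> V \<and> v \<in> V \<and> h u v = Some (iv k)}
      = prod.swap ` {(u, v). u \<in> V \<and> v \<in> V \<and> h u v = Some k}"
    (is "?A = prod.swap ` ?B")
  proof (intro equalityI subsetI)
    fix z assume "z \<in> ?A"
    then have "prod.swap z \<in> ?B" using kgraph_sym[OF h, of _ _ "iv k"] inv by auto
    then have "prod.swap (prod.swap z) \<in> prod.swap ` ?B" by (rule imageI)
    then show "z \<in> prod.swap ` ?B" by simp
  next
    fix z assume "z \<in> prod.swap ` ?B"
    then show "z \<in> ?A" using kgraph_sym[OF h, of _ _ k] by auto
  qed
  then show ?thesis using assms(1) by (simp add: sum_kdeg card_image)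
qed

lemma card_nbrs_eq_sum_kdeg:
  assumes "finite V" "finite I" and h: "kgraph V iv I h"
  shows "card {v \<in> V. h u v \<noteq> None} = (\<Sum>k\<in>I. kdeg V h u k)"
proof -
  have "{v \<in> V. h u v \<noteq> None} = (\<Union>k\<in>I. {v \<in> V. h u v = Some k})"
    using kgraph_mem[OF h] by auto
  then show ?thesis using assms(1,2) unfolding kdeg_def
    by (simp only:) (rule card_UN_disjoint, auto)
qed

text \<open>The switch that serves a free \<open>k\<close>-stub at \<open>a\<close> and a free \<open>iv k\<close>-stub at \<open>b\<close>: a remote
  \<open>k\<close>-edge \<open>x y\<close> is replaced by \<open>a y\<close> and \<open>x b\<close>. It also works for \<open>a = b\<close>.\<close>

definition switch :: "('k \<Rightarrow> 'k) \<Rightarrow> ('v \<Rightarrow> 'v \<Rightarrow> 'k option) \<Rightarrow> 'k \<Rightarrow> 'v \<Rightarrow> 'v \<Rightarrow> 'v \<Rightarrow> 'v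
    \<Rightarrow> 'v \<Rightarrow> 'v \<Rightarrow> 'k option" where
  "switch iv h k a b x y u v =
     (if u = x \<and> v = y \<or> u = y \<and> v = x then None
      else if u = a \<and> v = y \<or> u = x \<and> v = b then Some k
      else if u = y \<and> v = a \<or> u = b \<and> v = x then Some (iv k)
      else h u v)"

lemma switch_kgraph:
  assumes h: "kgraph V iv I h" and inv: "\<And>k. iv (iv k) = k" and ivI: "\<And>k. k \<in> I \<Longrightarrow> iv k \<in> I"
    and V: "a \<in> V" "b \<in> V" and xy: "h x y = Some k"
    and far: "x \<noteq> a" "x \<noteq> b" "y \<noteq> a" "y \<noteq> b"
  shows "kgraph V iv I (switch iv h k a b x y)"
proof -
  have *: "x \<in> V" "y \<in> V" "k \<in> I" "iv k \<in> I" "x \<noteq> y" using kgraph_mem[OF h xy] ivI by auto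
  have s: "h v u = map_option iv (h u v)" "h u u = None" for u v
    using h unfolding kgraph_def by blast+
  show ?thesis unfolding kgraph_def
  proof (intro conjI allI impI)
    fix u v
    show "switch iv h k a b x y v u = map_option iv (switch iv h k a b x y u v)"
      using * far inv by (auto simp: switch_def s(1)[symmetric])
    show "switch iv h k a b x y u u = None" using * far s(2) by (auto simp: switch_def)
    fix k' assume "switch iv h k a b x y u v = Some k'"
    then show "u \<in> V" "v \<in> V" "k' \<in> I"
      using * V kgraph_mem[OF h, of u v k'] by (auto simp: switch_def split: if_splits)
  qed
qed

text \<open>\<open>x\<close> exchanges its neighbour \<open>y\<close> for \<open>b\<close>, and
  \<open>y\<close> exchanges \<open>x\<close> for \<open>a\<close>, each in the same kind, so only
  \<open>a\<close> and \<open>b\<close> gain. As neither of them is adjacent to \<open>x\<close> or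
  \<open>y\<close>, no other edge is overwritten.\<close>

lemma switch_kdeg:
  assumes "finite V" and h: "kgraph V iv I h" and nofix: "iv k \<noteq> k"
    and V: "a \<in> V" "b \<in> V" and xy: "h x y = Some k"
    and far: "x \<noteq> a" "x \<noteq> b" "y \<noteq> a" "y \<noteq> b" "h a x = None" "h b x = None" "h a y = None" "h b y = None"
  shows "kdeg V (switch iv h k a b x y) u k' =
    kdeg V h u k' + (if u = a \<and> k' = k then 1 else 0) + (if u = b \<and> k' = iv k then 1 else 0)"
proof -
  have *: "x \<in> V" "y \<in> V" "x \<noteq> y" using kgraph_mem[OF h xy] by auto
  have yx: "h y x = Some (iv k)" using kgraph_sym[OF h xy] .
  have fb: "h x a = None" "h x b = None" "h y a = None" "h y b = None"
    using far kgraph_sym_None[OF h] by blast+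
  let ?h = "switch iv h k a b x y"
  let ?S = "{v \<in> V. h u v = Some k'}" and ?T = "{v \<in> V. ?h u v = Some k'}"
  have fin: "finite ?S" using assms(1) by simp
  consider (x) "u = x" "k' = k" | (y) "u = y" "k' = iv k" | (a) "u = a" | (b) "u = b" "u \<noteq> a"
    | (o) "u \<noteq> a" "u \<noteq> b" "u = x \<longrightarrow> k' \<noteq> k" "u = y \<longrightarrow> k' \<noteq> iv k" by blast
  then show ?thesis
  proof cases
    case x
    then have "?T = insert b (?S - {y})" using * far V by (auto simp: switch_def)
    moreover have "y \<in> ?S" "b \<notin> ?S" using x xy * fb by auto
    ultimately show ?thesis using fin x far * nofix card_Suc_Diff1[OF fin, of y]
      by (simp add: kdeg_def)
  next
    case y
    then have "?T = insert a (?S - {x})" using * far V by (auto simp: switch_def)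
    moreover have "x \<in> ?S" "a \<notin> ?S" using y yx * fb by auto
    ultimately show ?thesis using fin y far * nofix card_Suc_Diff1[OF fin, of x]
      by (simp add: kdeg_def)
  next
    case a
    have n: "y \<notin> ?S" "x \<notin> ?S" using a far by auto
    consider "k' = k" | "a = b" "k' = iv k" "k' \<noteq> k" | "k' \<noteq> k" "a = b \<longrightarrow> k' \<noteq> iv k" by blast
    then show ?thesis
    proof cases
      case 1
      then have "?T = insert y ?S" using a * far V nofix by (auto simp: switch_def split: if_splits)
      then have "card ?T = Suc (card ?S)" using fin n by (metis card_insert_disjoint)
      then show ?thesis using 1 a nofix by (simp add: kdeg_def)
    next
      case 2
      then have "?T = insert x ?S" using a * far V nofix by (auto simp: switch_def split: if_splits)
      then have "card ?T = Suc (card ?S)" using fin n by (metis card_insert_disjoint)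
      then show ?thesis using 2 a nofix by (simp add: kdeg_def)
    next
      case 3
      then have "?T = ?S" using a * far V nofix by (auto simp: switch_def split: if_splits)
      then have "card ?T = card ?S" by (rule arg_cong)
      then show ?thesis using 3 a nofix by (simp add: kdeg_def)
    qed
  next
    case b
    have n: "x \<notin> ?S" using b far by auto
    show ?thesis
    proof (cases "k' = iv k")
      case True
      then have "?T = insert x ?S" using b * far V nofix by (auto simp: switch_def split: if_splits)
      then have "card ?T = Suc (card ?S)" using fin n by (metis card_insert_disjoint)
      then show ?thesis using True b by (simp add: kdeg_def)
    next
      case False
      then have "?T = ?S" using b * far V nofix by (auto simp: switch_def split: if_splits)
      then have "card ?T = card ?S" by (rule arg_cong)
      then show ?thesis using False b by (simp add: kdeg_def)
    qed
  next
    case o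
    have "?T = ?S" using o * far V nofix xy yx fb by (auto simp: switch_def split: if_splits)
    then have "card ?T = card ?S" by (rule arg_cong)
    then show ?thesis using o by (simp add: kdeg_def)
  qed
qed

text \<open>Induction on the total deficit, which every switch lowers. Since switches decrease no
  degree, a complete kind stays complete and a kind with many edges keeps many; hence the dichotomy
  in the last hypothesis survives the induction.\<close>

lemma complete_kgraph:
  assumes finV: "finite V" and finI: "finite I" and inv: "\<And>k. iv (iv k) = k"
    and nofix: "\<And>k. iv k \<noteq> k" and ivI: "\<And>k. k \<in> I \<Longrightarrow> iv k \<in> I"
    and bal: "\<And>k. k \<in> I \<Longrightarrow> (\<Sum>u\<in>V. D u (iv k)) = (\<Sum>u\<in>V. D u k)"
    and deg: "\<And>u. u \<in> V \<Longrightarrow> (\<Sum>k\<in>I. D u k) \<le> \<Delta>"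
    and "kgraph V iv I h" "\<And>u k. u \<in> V \<Longrightarrow> k \<in> I \<Longrightarrow> kdeg V h u k \<le> D u k"
    and "\<And>k. k \<in> I \<Longrightarrow> (\<forall>u\<in>V. kdeg V h u k = D u k) \<or> 4 * (\<Delta> + 1) * (\<Delta> + 1) \<le> (\<Sum>u\<in>V. kdeg V h u k)"
  shows "\<exists>h'. kgraph V iv I h' \<and> (\<forall>u\<in>V. \<forall>k\<in>I. kdeg V h' u k = D u k)"
  using assms(8-10)
proof (induction "\<Sum>u\<in>V. \<Sum>k\<in>I. D u k - kdeg V h u k" arbitrary: h rule: less_induct)
  case less
  note h = less.prems(1) and le = less.prems(2) and big = less.prems(3)
  show ?case
  proof (cases "\<forall>u\<in>V. \<forall>k\<in>I. kdeg V h u k = D u k")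
    case True
    then show ?thesis using h by blast
  next
    case False
    then obtain a k where a: "a \<in> V" "k \<in> I" "kdeg V h a k < D a k"
      using le by (meson nat_less_le)
    \<comment> \<open>Both degree functions are balanced, so a shortage of \<open>k\<close> at
      \<open>a\<close> forces a shortage of \<open>iv k\<close> at some \<open>b\<close>, possibly
      \<open>a\<close> itself.\<close>
    have "(\<Sum>u\<in>V. kdeg V h u k) < (\<Sum>u\<in>V. D u k)"
      using a le finV by (intro sum_strict_mono_ex1) auto
    then have "(\<Sum>u\<in>V. kdeg V h u (iv k)) < (\<Sum>u\<in>V. D u (iv k))"
      using sum_kdeg_inv[OF finV h inv] bal[OF a(2)] by simp
    then obtain b where b: "b \<in> V" "kdeg V h b (iv k) < D b (iv k)"
      by (meson not_le sum_mono)
    define N where "N u = {v \<in> V. h u v \<noteq> None}" for u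
    have cN: "card (N u) \<le> \<Delta>" if "u \<in> V" for u
    proof -
      have "card (N u) = (\<Sum>k\<in>I. kdeg V h u k)"
        unfolding N_def by (rule card_nbrs_eq_sum_kdeg[OF finV finI h])
      also have "\<dots> \<le> (\<Sum>k\<in>I. D u k)" using le that by (intro sum_mono) auto
      finally show ?thesis using deg[OF that] by simp
    qed
    define Z where "Z = insert a (N a) \<union> insert b (N b)"
    have finZ: "finite Z" using finV by (simp add: Z_def N_def)
    have ZV: "Z \<subseteq> V" using a b by (auto simp: Z_def N_def)
    have cZ: "card Z \<le> 2 * (\<Delta> + 1)"
    proof -
      have "card Z \<le> card (insert a (N a)) + card (insert b (N b))"
        unfolding Z_def by (rule card_Un_le)
      also have "\<dots> \<le> (card (N a) + 1) + (card (N b) + 1)"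
        by (intro add_mono card_insert_le_m1[THEN le_trans]) (auto simp: card_insert_le_m1)
      also have "\<dots> \<le> 2 * (\<Delta> + 1)" using cN[OF a(1)] cN[OF b(1)] by simp
      finally show ?thesis .
    qed
    define P where "P = {(u, v). u \<in> V \<and> v \<in> V \<and> h u v = Some k}"
    have finP: "finite P" by (rule finite_subset[of _ "V \<times> V"]) (use finV in \<open>auto simp: P_def\<close>)
    have cP: "4 * (\<Delta> + 1) * (\<Delta> + 1) \<le> card P"
      using big[OF a(2)] a sum_kdeg[OF finV, of h k] by (auto simp: P_def)
    have cS: "card (SIGMA u:Z. N u) \<le> 2 * (\<Delta> + 1) * \<Delta>"
    proof -
      have "card (SIGMA u:Z. N u) = (\<Sum>u\<in>Z. card (N u))"
        using finZ finV by (intro card_SigmaI) (auto simp: N_def)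
      also have "\<dots> \<le> (\<Sum>u\<in>Z. \<Delta>)" using cN ZV by (intro sum_mono) auto
      also have "\<dots> \<le> 2 * (\<Delta> + 1) * \<Delta>" using mult_le_mono1[OF cZ, of \<Delta>] by simp
      finally show ?thesis .
    qed
    have finS: "finite (SIGMA u:Z. N u)" using finZ finV by (auto simp: N_def)
    \<comment> \<open>At most \<open>2 * (\<Delta> + 1)\<close> vertices are \<open>a\<close>,
      \<open>b\<close> or adjacent to them; each lies on at most \<open>\<Delta>\<close> edges, and
      every edge counts in two orientations. This is the origin of the bound
      \<open>4 * (\<Delta> + 1) * (\<Delta> + 1)\<close>.\<close>
    have "\<exists>(x, y)\<in>P. x \<notin> Z \<and> y \<notin> Z"
    proof (rule ccontr)
      assume "\<not> ?thesis"
      then have "P \<subseteq> (SIGMA u:Z. N u) \<union> prod.swap ` (SIGMA u:Z. N u)"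
        using kgraph_sym[OF h] by (force simp: P_def N_def image_iff)
      then have "card P \<le> card ((SIGMA u:Z. N u) \<union> prod.swap ` (SIGMA u:Z. N u))"
        using finS by (intro card_mono) auto
      also have "\<dots> \<le> card (SIGMA u:Z. N u) + card (prod.swap ` (SIGMA u:Z. N u))" by (rule card_Un_le)
      also have "\<dots> \<le> 2 * (\<Delta> + 1) * \<Delta> + 2 * (\<Delta> + 1) * \<Delta>"
        using cS by (simp add: card_image)
      also have "\<dots> < 4 * (\<Delta> + 1) * (\<Delta> + 1)" by (simp add: algebra_simps)
      finally show False using cP by simp
    qed
    then obtain x y where xy: "x \<in> V" "y \<in> V" "h x y = Some k" "x \<notin> Z" "y \<notin> Z"
      by (auto simp: P_def)
    have far: "x \<noteq> a" "x \<noteq> b" "y \<noteq> a" "y \<noteq> b" "h a x = None" "h b x = None" "h a y = None" "h b y = None"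
      using xy by (auto simp: Z_def N_def)
    define h' where "h' = switch iv h k a b x y"
    have h': "kgraph V iv I h'" unfolding h'_def
      using switch_kgraph[OF h inv ivI a(1) b(1) xy(3) far(1-4)] by blast
    have kd: "kdeg V h' u k' = kdeg V h u k' + (if u = a \<and> k' = k then 1 else 0)
        + (if u = b \<and> k' = iv k then 1 else 0)" for u k'
      unfolding h'_def using switch_kdeg[OF finV h nofix a(1) b(1) xy(3) far] by blast
    have mono: "kdeg V h u k' \<le> kdeg V h' u k'" for u k' by (simp add: kd)
    have le': "kdeg V h' u k' \<le> D u k'" if "u \<in> V" "k' \<in> I" for u k'
      using le[OF that] a(3) b(2) nofix[of k] by (auto simp: kd)
    have big': "(\<forall>u\<in>V. kdeg V h' u k' = D u k') \<or> 4 * (\<Delta> + 1) * (\<Delta> + 1) \<le> (\<Sum>u\<in>V. kdeg V h' u k')"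
      if "k' \<in> I" for k'
    proof (cases "\<forall>u\<in>V. kdeg V h u k' = D u k'")
      case True
      then show ?thesis using mono[of _ k'] le'[OF _ that] by (metis le_antisym)
    next
      case False
      then have "4 * (\<Delta> + 1) * (\<Delta> + 1) \<le> (\<Sum>u\<in>V. kdeg V h u k')" using big[OF that] by blast
      also have "\<dots> \<le> (\<Sum>u\<in>V. kdeg V h' u k')" using mono by (intro sum_mono)
      finally show ?thesis by blast
    qed
    have "(\<Sum>u\<in>V. \<Sum>k\<in>I. D u k - kdeg V h' u k) < (\<Sum>u\<in>V. \<Sum>k\<in>I. D u k - kdeg V h u k)"
    proof (rule sum_strict_mono_ex1[OF finV])
      show "\<forall>u\<in>V. (\<Sum>k\<in>I. D u k - kdeg V h' u k) \<le> (\<Sum>k\<in>I. D u k - kdeg V h u k)"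
        using mono by (intro ballI sum_mono diff_le_mono2)
      have "(\<Sum>k\<in>I. D a k - kdeg V h' a k) < (\<Sum>k\<in>I. D a k - kdeg V h a k)"
      proof (rule sum_strict_mono_ex1[OF finI])
        show "\<forall>k'\<in>I. D a k' - kdeg V h' a k' \<le> D a k' - kdeg V h a k'"
          using mono by (intro ballI diff_le_mono2)
        show "\<exists>k'\<in>I. D a k' - kdeg V h' a k' < D a k' - kdeg V h a k'"
          using a nofix[of k] by (intro bexI[of _ k]) (auto simp: kd)
      qed
      then show "\<exists>u\<in>V. (\<Sum>k\<in>I. D u k - kdeg V h' u k) < (\<Sum>k\<in>I. D u k - kdeg V h u k)"
        using a(1) by blast
    qed
    from less.hyps[OF this h' le' big'] show ?thesis .
  qed
qed

section \<open>Labelled complete graphs with truncated degrees\<close>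

lemma matching_bij:
  assumes "finite X" "finite Y" and c: "\<And>k. card {x\<in>X. \<kappa> x = k} = card {y\<in>Y. \<kappa>' y = k}"
  shows "\<exists>g. bij_betw g X Y \<and> (\<forall>x\<in>X. \<kappa>' (g x) = \<kappa> x)"
proof -
  have "\<forall>k. \<exists>g. bij_betw g {x\<in>X. \<kappa> x = k} {y\<in>Y. \<kappa>' y = k}"
    using assms by (intro allI finite_same_card_bij) auto
  then obtain g where g: "\<And>k. bij_betw (g k) {x\<in>X. \<kappa> x = k} {y\<in>Y. \<kappa>' y = k}" by metis
  define G where "G x = g (\<kappa> x) x" for x
  have G: "G x \<in> Y" "\<kappa>' (G x) = \<kappa> x" if "x \<in> X" for x
    using bij_betwE[OF g[of "\<kappa> x"]] that by (auto simp: G_def)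
  have "inj_on G X"
  proof (rule inj_onI)
    fix x y assume xy: "x \<in> X" "y \<in> X" "G x = G y"
    then have k: "\<kappa> x = \<kappa> y" using G by metis
    then have "g (\<kappa> x) x = g (\<kappa> x) y" using xy by (simp add: G_def)
    then show "x = y" using g[of "\<kappa> x"] xy k by (auto simp: bij_betw_def dest: inj_onD)
  qed
  moreover have "y \<in> G ` X" if "y \<in> Y" for y
  proof -
    have "y \<in> g (\<kappa>' y) ` {x\<in>X. \<kappa> x = \<kappa>' y}" using g[of "\<kappa>' y"] that by (auto simp: bij_betw_def)
    then obtain x where "x \<in> X" "y = G x" by (auto simp: G_def)
    then show ?thesis by blast
  qed
  ultimately show ?thesis using G by (auto simp: bij_betw_def intro!: exI[of _ G])
qed

text \<open>The easy case of Hall's theorem: no candidate set is smaller than the number of demands,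
  so a greedy choice never gets stuck.\<close>

lemma distinct_representatives:
  assumes "finite Q" "\<And>b. b \<in> Q \<Longrightarrow> card Q \<le> card (R b)"
  shows "\<exists>q. inj_on q Q \<and> (\<forall>b\<in>Q. q b \<in> R b)"
  using assms
proof (induction Q)
  case empty
  then show ?case by simp
next
  case (insert b Q)
  then obtain q where q: "inj_on q Q" "\<And>c. c \<in> Q \<Longrightarrow> q c \<in> R c"
    by (metis card_insert_le insertCI le_trans)
  have "card (q ` Q) < card (R b)" using insert.hyps insert.prems[of b] card_image_le[of Q q] by simp
  then obtain r where r: "r \<in> R b" "r \<notin> q ` Q"
    by (metis card_mono finite_imageI insert.hyps(1) leD subsetI)
  have "inj_on (q(b := r)) (insert b Q)" using q(1) r(2) insert.hyps(2)
    by (auto simp: inj_on_def)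
  moreover have "\<forall>c\<in>insert b Q. (q(b := r)) c \<in> R c" using q(2) r(1) insert.hyps(2) by auto
  ultimately show ?case by blast
qed

lemma three_parts:
  assumes "finite X" "3 * m \<le> card X"
  shows "\<exists>g. \<forall>r<3::nat. m \<le> card {x\<in>X. g x = r}"
proof -
  obtain Y0 where Y0: "Y0 \<subseteq> X" "card Y0 = m" using obtain_subset_with_card_n[of m X] assms by auto
  have "card (X - Y0) = card X - m" using Y0 assms(1) by (simp add: card_Diff_subset finite_subset)
  then have "m \<le> card (X - Y0)" using assms(2) by simp
  then obtain Y1 where Y1: "Y1 \<subseteq> X - Y0" "card Y1 = m" using obtain_subset_with_card_n[of m "X - Y0"] by auto
  define g where "g x = (if x \<in> Y0 then 0 else if x \<in> Y1 then 1 else 2 :: nat)" for x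
  have "{x\<in>X. g x = 0} = Y0" "{x\<in>X. g x = 1} = Y1" using Y0 Y1 by (auto simp: g_def)
  moreover have "{x\<in>X. g x = 2} = X - (Y0 \<union> Y1)" by (auto simp: g_def)
  moreover have "card (X - (Y0 \<union> Y1)) = card X - card (Y0 \<union> Y1)"
    using Y0 Y1 assms(1) by (intro card_Diff_subset) (auto intro: finite_subset)
  moreover have "card (Y0 \<union> Y1) \<le> 2 * m" using card_Un_le[of Y0 Y1] Y0 Y1 by simp
  ultimately have "m \<le> card {x\<in>X. g x = 0}" "m \<le> card {x\<in>X. g x = 1}" "m \<le> card {x\<in>X. g x = 2}"
    using Y0 Y1 assms(2) by auto
  then have "\<forall>r<3. m \<le> card {x\<in>X. g x = r}" by (auto simp: numeral_3_eq_3 less_Suc_eq numeral_2_eq_2)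
  then show ?thesis by blast
qed

text \<open>The labels \<open>e\<close> matter off the diagonal only; whatever concerns a single
  vertex belongs to its colour. \<open>K\<close> is the level of truncation, and \<open>B\<close> is
  the size from which a type counts as large.\<close>

locale labelled_graph =
  fixes V :: "nat set" and e :: "nat \<Rightarrow> nat \<Rightarrow> 'l" and rv :: "'l \<Rightarrow> 'l" and col :: "nat \<Rightarrow> 'c"
    and K :: nat and C :: "'c set" and Lb :: "'l set" and B :: nat
  assumes finV: "finite V" and finC: "finite C" and finLb: "finite Lb"
    and colC: "a \<in> V \<Longrightarrow> col a \<in> C"
    and eLb: "a \<in> V \<Longrightarrow> b \<in> V \<Longrightarrow> a \<noteq> b \<Longrightarrow> e a b \<in> Lb"
    and esym: "a \<in> V \<Longrightarrow> b \<in> V \<Longrightarrow> a \<noteq> b \<Longrightarrow> e b a = rv (e a b)"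
    and rv_rv: "rv (rv l) = l" and rvLb: "l \<in> Lb \<Longrightarrow> rv l \<in> Lb"
begin

definition nb :: "nat \<Rightarrow> 'c \<Rightarrow> 'l \<Rightarrow> nat set" where
  "nb a d l = {b \<in> V. b \<noteq> a \<and> col b = d \<and> e a b = l}"

text \<open>For each colour \<open>d\<close> and label \<open>l\<close>, all or exactly \<open>K\<close> of the \<open>l\<close>-neighbours of \<open>a\<close> of
  colour \<open>d\<close> are declared essential for \<open>a\<close>.\<close>

definition sel :: "nat \<Rightarrow> 'c \<Rightarrow> 'l \<Rightarrow> nat set" where
  "sel a d l = (SOME Y. Y \<subseteq> nb a d l \<and> card Y = min K (card (nb a d l)))"

definition Ess :: "nat \<Rightarrow> nat set" where
  "Ess a = {b \<in> V. b \<noteq> a \<and> b \<in> sel a (col b) (e a b)}"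

definition \<Delta> :: nat where "\<Delta> = K * card C * card Lb"

text \<open>\<open>restrict\<close> makes the counting function extensional, so that all types lie
  in a finite set of known cardinality.\<close>

definition ty :: "nat \<Rightarrow> 'c \<times> ('c \<times> 'l \<Rightarrow> nat)" where
  "ty a = (col a, restrict (\<lambda>(d, l). min K (card (nb a d l))) (C \<times> Lb))"

definition Ty :: "('c \<times> ('c \<times> 'l \<Rightarrow> nat)) set" where
  "Ty = C \<times> ((C \<times> Lb) \<rightarrow>\<^sub>E {..K})"

definition S :: "nat set" where
  "S = {a \<in> V. card {b \<in> V. ty b = ty a} < B}"

text \<open>Edges at a vertex of \<open>S\<close> keep their labels, so its essential neighbours
  must neither vanish nor be duplicated: \<open>S_ext\<close> has to survive in exactly one
  copy.\<close>

definition S_ext :: "nat set" where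
  "S_ext = S \<union> (\<Union>x\<in>S. Ess x)"

text \<open>With the types of both ends in the kind, any new edge of that kind has the right label
  and the right colour across, no matter which vertices of these types it joins.\<close>

definition kinds :: "(('c \<times> ('c \<times> 'l \<Rightarrow> nat)) \<times> ('c \<times> ('c \<times> 'l \<Rightarrow> nat)) \<times> 'l \<times> bool) set" where
  "kinds = Ty \<times> Ty \<times> Lb \<times> UNIV"

definition iv where
  "iv = (\<lambda>(t, s, l, d). (s, t, rv l, \<not> d))"

text \<open>The Boolean component of a kind makes \<open>iv\<close> free of fixed points, which avoids
  parity conditions.\<close>

definition h where
  "h a b = (if a \<in> V - S \<and> b \<in> V - S \<and> a \<noteq> b \<and> b \<in> Ess a \<and> a \<in> Ess b
     then Some (ty a, ty b, e a b, a < b) else None)"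

section \<open>Essential neighbours, types and kinds\<close>

lemma sel: "sel a d l \<subseteq> nb a d l" "card (sel a d l) = min K (card (nb a d l))"
proof -
  have "\<exists>Y. Y \<subseteq> nb a d l \<and> card Y = min K (card (nb a d l))"
    by (metis min.cobounded2 obtain_subset_with_card_n)
  then have "sel a d l \<subseteq> nb a d l \<and> card (sel a d l) = min K (card (nb a d l))"
    unfolding sel_def by (rule someI_ex)
  then show "sel a d l \<subseteq> nb a d l" "card (sel a d l) = min K (card (nb a d l))" by auto
qed

lemma finite_nb: "finite (nb a d l)"
  using finV by (simp add: nb_def)

lemma Ess_nb: "Ess a \<inter> nb a d l = sel a d l"
  using sel(1)[of a d l] by (auto simp: Ess_def nb_def)

lemma Ess_V: "b \<in> Ess a \<Longrightarrow> b \<in> V \<and> b \<noteq> a"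
  by (simp add: Ess_def)

lemma finite_Ess: "finite (Ess a)"
  using finV by (simp add: Ess_def)

lemma card_Ess: assumes "a \<in> V" shows "card (Ess a) \<le> \<Delta>"
proof -
  have "Ess a \<subseteq> (\<Union>(d, l)\<in>C \<times> Lb. sel a d l)"
    using colC eLb assms by (force simp: Ess_def)
  then have "card (Ess a) \<le> card (\<Union>(d, l)\<in>C \<times> Lb. sel a d l)"
    using finC finLb finite_subset[OF sel(1) finite_nb] by (intro card_mono) auto
  also have "\<dots> \<le> (\<Sum>(d, l)\<in>C \<times> Lb. card (sel a d l))"
    using card_UN_le[of "C \<times> Lb" "\<lambda>(d, l). sel a d l"] finC finLb by (simp add: case_prod_unfold)
  also have "\<dots> \<le> (\<Sum>(d, l)\<in>C \<times> Lb. K)"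
    by (intro sum_mono) (auto simp: sel(2))
  also have "\<dots> = \<Delta>" by (simp add: \<Delta>_def card_cartesian_product)
  finally show ?thesis .
qed

text \<open>A class with fewer than \<open>K\<close> members is selected entirely, so a neighbour
  left out witnesses a saturated class.\<close>

lemma not_Ess_big:
  assumes "b \<in> V" "a \<noteq> b" "b \<notin> Ess a"
  shows "K \<le> card (nb a (col b) (e a b))"
proof (rule ccontr)
  let ?N = "nb a (col b) (e a b)"
  assume "\<not> K \<le> card ?N"
  then have "card (sel a (col b) (e a b)) = card ?N" using sel(2) by simp
  then have "sel a (col b) (e a b) = ?N" using sel(1) finite_nb by (metis card_subset_eq)
  moreover have "b \<in> ?N" using assms by (simp add: nb_def)
  ultimately show False using assms by (simp add: Ess_def)
qed

lemma ty_col: "ty a = ty b \<Longrightarrow> col a = col b"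
  by (simp add: ty_def)

lemma ty_big:
  assumes "ty a = ty b" "a \<in> V" "K \<le> card (nb a d l)"
  shows "K \<le> card (nb b d l)"
\<comment> \<open>For \<open>K > 0\<close> the class is inhabited, which puts \<open>d\<close> and
  \<open>l\<close> into the range on which types record counts.\<close>
proof (cases "K = 0")
  case False
  then have "nb a d l \<noteq> {}" using assms(3) by auto
  then have "d \<in> C" "l \<in> Lb" using assms(2) colC eLb by (auto simp: nb_def)
  moreover have "restrict (\<lambda>(d, l). min K (card (nb a d l))) (C \<times> Lb) (d, l)
      = restrict (\<lambda>(d, l). min K (card (nb b d l))) (C \<times> Lb) (d, l)"
    using assms(1) by (simp add: ty_def)
  ultimately show ?thesis using assms(3) by simp
qed simp

lemma ty_Ty: "a \<in> V \<Longrightarrow> ty a \<in> Ty"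
  using colC by (auto simp: ty_def Ty_def PiE_def)

lemma finite_Ty: "finite Ty"
  using finC finLb by (auto simp: Ty_def intro!: finite_PiE)

lemma card_Ty: "card Ty = card C * (K + 1) ^ (card C * card Lb)"
  using finC finLb by (simp add: Ty_def card_cartesian_product card_PiE)

lemma finite_kinds: "finite kinds"
  using finite_Ty finLb by (simp add: kinds_def)

lemma card_kinds: "card kinds = card Ty * (card Ty * (card Lb * 2))"
  by (simp add: kinds_def card_cartesian_product)

lemma iv_iv: "iv (iv k) = k"
  by (cases k) (simp add: iv_def rv_rv)

lemma iv_neq: "iv k \<noteq> k"
  by (cases k) (simp add: iv_def)

lemma iv_kinds: "k \<in> kinds \<Longrightarrow> iv k \<in> kinds"
  using rvLb by (auto simp: iv_def kinds_def)

lemma kgraph_h: "kgraph V iv kinds h"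
  unfolding kgraph_def
proof (intro conjI allI impI)
  show "h v u = map_option iv (h u v)" for u v
    using esym[of u v] by (auto simp: h_def iv_def)
  show "h u u = None" for u by (simp add: h_def)
  fix u v k assume "h u v = Some k"
  then show "u \<in> V" "v \<in> V" "k \<in> kinds" using ty_Ty eLb by (auto simp: h_def kinds_def split: if_splits)
qed

lemma S_ty: "a \<in> V - S \<Longrightarrow> b \<in> V \<Longrightarrow> ty b = ty a \<Longrightarrow> b \<in> V - S"
  by (simp add: S_def)

lemma nbrs_h: "{b \<in> V. h a b \<noteq> None} \<subseteq> Ess a"
  by (auto simp: h_def split: if_splits)

lemma sum_kdeg_h: "a \<in> V \<Longrightarrow> (\<Sum>k\<in>kinds. kdeg V h a k) \<le> \<Delta>"
  using card_nbrs_eq_sum_kdeg[OF finV finite_kinds kgraph_h, of a]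
    card_mono[OF finite_Ess nbrs_h, of a] card_Ess[of a] by simp

text \<open>Here \<open>f u\<close> is the old vertex that \<open>u\<close> imitates, and
  \<open>\<beta>\<close> places the essential neighbours of \<open>f u\<close> around
  \<open>u\<close>. The selected ones give the truncated count from below; any further vertex falls
  into a saturated class, where more members do no harm.\<close>

lemma truncated_counts_preserved:
  assumes finV': "finite V'" and u: "u \<in> V'" "f u \<in> V"
    and inj: "inj_on \<beta> (Ess (f u))"
    and \<beta>: "\<And>b. b \<in> Ess (f u) \<Longrightarrow> \<beta> b \<in> V' \<and> \<beta> b \<noteq> u \<and> col (f (\<beta> b)) = col b \<and> e' u (\<beta> b) = e (f u) b"
    and rest: "\<And>v. v \<in> V' \<Longrightarrow> v \<noteq> u \<Longrightarrow> v \<notin> \<beta> ` Ess (f u) \<Longrightarrow> K \<le> card (nb (f u) (col (f v)) (e' u v))"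
  shows "min K (card {v \<in> V'. v \<noteq> u \<and> col (f v) = d \<and> e' u v = l}) = min K (card (nb (f u) d l))"
proof -
  let ?X = "nb (f u) d l" and ?Y = "{v \<in> V'. v \<noteq> u \<and> col (f v) = d \<and> e' u v = l}"
  have selE: "sel (f u) d l \<subseteq> Ess (f u)" using Ess_nb[of "f u" d l] by blast
  have sub: "\<beta> ` sel (f u) d l \<subseteq> ?Y"
  proof
    fix v assume "v \<in> \<beta> ` sel (f u) d l"
    then obtain b where b: "b \<in> sel (f u) d l" "v = \<beta> b" by blast
    then have "col b = d" "e (f u) b = l" using sel(1)[of "f u" d l] by (auto simp: nb_def)
    then show "v \<in> ?Y" using \<beta>[of b] b selE by auto
  qed
  have cs: "card (\<beta> ` sel (f u) d l) = min K (card ?X)"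
    using inj selE by (simp add: card_image inj_on_subset sel(2))
  have le: "min K (card ?X) \<le> card ?Y" using card_mono[OF _ sub] finV' cs by simp
  show ?thesis
  proof (cases "K \<le> card ?X")
    case True
    then show ?thesis using le by simp
  next
    case False
    have "?Y \<subseteq> \<beta> ` sel (f u) d l"
    proof
      fix v assume v: "v \<in> ?Y"
      then have "v \<in> \<beta> ` Ess (f u)" using rest[of v] False by auto
      then obtain b where b: "b \<in> Ess (f u)" "v = \<beta> b" by auto
      then have "b \<in> ?X" using v \<beta>[OF b(1)] Ess_V[OF b(1)] by (simp add: nb_def)
      then show "v \<in> \<beta> ` sel (f u) d l" using b Ess_nb[of "f u" d l] by blast
    qed
    then have "?Y = \<beta> ` sel (f u) d l" using sub by blast
    then show ?thesis using cs by simp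
  qed
qed

text \<open>By counting, not every pair between two large types is essential for one of its ends.
  The label of a pair essential for neither end is saturated at both, and saturation depends on the
  type only.\<close>

lemma default_label:
  assumes a: "a \<in> V - S" and b: "b \<in> V - S" and B: "4 * \<Delta> + 2 \<le> B"
  shows "\<exists>l. (\<forall>a'\<in>V. ty a' = ty a \<longrightarrow> K \<le> card (nb a' (col b) l))
           \<and> (\<forall>b'\<in>V. ty b' = ty b \<longrightarrow> K \<le> card (nb b' (col a) (rv l)))"
proof -
  \<comment> \<open>With \<open>m\<close> vertices on each side the count needs
    \<open>m * (2 * \<Delta>) < m * m\<close>. Having \<open>2 * m\<close> vertices per type leaves
    room for disjoint \<open>X\<close> and \<open>Y\<close> even if the two types coincide.\<close>
  define m where "m = 2 * \<Delta> + 1"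
  have big: "2 * m \<le> card {x \<in> V. ty x = ty a}" "2 * m \<le> card {x \<in> V. ty x = ty b}"
    using a b B by (auto simp: S_def m_def)
  obtain X where X: "X \<subseteq> {x \<in> V. ty x = ty a}" "card X = m"
    using obtain_subset_with_card_n[of m "{x \<in> V. ty x = ty a}"] big(1) by auto
  have finX: "finite X" using finite_subset[OF X(1)] finV by simp
  have "m \<le> card ({x \<in> V. ty x = ty b} - X)"
    using diff_card_le_card_Diff[OF finX, of "{x \<in> V. ty x = ty b}"] big X(2) by simp
  then obtain Y where Y: "Y \<subseteq> {x \<in> V. ty x = ty b} - X" "card Y = m"
    using obtain_subset_with_card_n[of m "{x \<in> V. ty x = ty b} - X"] by auto
  have finY: "finite Y" using finite_subset[OF Y(1)] finV by simp
  have "\<exists>x\<in>X. \<exists>y\<in>Y. y \<notin> Ess x \<and> x \<notin> Ess y"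
  proof (rule ccontr)
    assume "\<not> ?thesis"
    then have *: "y \<in> Ess x \<or> x \<in> Ess y" if "x \<in> X" "y \<in> Y" for x y using that by blast
    have "X \<times> Y \<subseteq> (SIGMA x:X. Ess x) \<union> prod.swap ` (SIGMA y:Y. Ess y)"
    proof
      fix z assume "z \<in> X \<times> Y"
      then obtain x y where z: "z = (x, y)" "x \<in> X" "y \<in> Y" by blast
      show "z \<in> (SIGMA x:X. Ess x) \<union> prod.swap ` (SIGMA y:Y. Ess y)"
      proof (cases "y \<in> Ess x")
        case True
        then show ?thesis using z by simp
      next
        case False
        then have "(y, x) \<in> (SIGMA y:Y. Ess y)" using *[OF z(2,3)] z by simp
        then have "prod.swap (y, x) \<in> prod.swap ` (SIGMA y:Y. Ess y)" by (rule imageI)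
        then show ?thesis using z by simp
      qed
    qed
    then have "card (X \<times> Y) \<le> card ((SIGMA x:X. Ess x) \<union> prod.swap ` (SIGMA y:Y. Ess y))"
      using finX finY finite_Ess by (intro card_mono) auto
    also have "\<dots> \<le> card (SIGMA x:X. Ess x) + card (SIGMA y:Y. Ess y)"
      by (rule order.trans[OF card_Un_le]) (simp add: card_image)
    also have "card (SIGMA x:X. Ess x) = (\<Sum>x\<in>X. card (Ess x))" using finX finite_Ess by simp
    also have "card (SIGMA x:Y. Ess x) = (\<Sum>x\<in>Y. card (Ess x))" using finY finite_Ess by simp
    also have "(\<Sum>x\<in>X. card (Ess x)) + (\<Sum>x\<in>Y. card (Ess x)) \<le> (\<Sum>x\<in>X. \<Delta>) + (\<Sum>x\<in>Y. \<Delta>)"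
      using X Y card_Ess by (intro add_mono sum_mono) auto
    also have "\<dots> = m * (2 * \<Delta>)" using X Y by simp
    also have "\<dots> < m * m" by (simp add: m_def)
    finally show False using X Y by (simp add: card_cartesian_product)
  qed
  then obtain x y where xy: "x \<in> X" "y \<in> Y" "y \<notin> Ess x" "x \<notin> Ess y" by blast
  then have *: "x \<in> V" "y \<in> V" "x \<noteq> y" "ty x = ty a" "ty y = ty b" using X Y by auto
  have "K \<le> card (nb x (col y) (e x y))" "K \<le> card (nb y (col x) (e y x))"
    using not_Ess_big xy * by auto
  then have K: "K \<le> card (nb x (col b) (e x y))" "K \<le> card (nb y (col a) (rv (e x y)))"
    using *(3) esym[OF *(1,2,3)] ty_col[OF *(4)] ty_col[OF *(5)] by auto
  show ?thesis
  proof (intro exI[of _ "e x y"] conjI ballI impI)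
    fix z assume "z \<in> V" "ty z = ty a"
    then show "K \<le> card (nb z (col b) (e x y))" using ty_big[OF _ *(1) K(1), of z] *(4) by simp
  next
    fix z assume "z \<in> V" "ty z = ty b"
    then show "K \<le> card (nb z (col a) (rv (e x y)))" using ty_big[OF _ *(2) K(2), of z] *(5) by simp
  qed
qed

text \<open>Labels come from four sources: the old graph for edges at \<open>S\<close>, the graph
  \<open>h'\<close> for edges essential on both sides, the choice of one end for edges essential to
  it alone, and a saturated default label elsewhere.\<close>

lemma exists_relabelling:
  fixes V' :: "nat set"
  assumes finV': "finite V'" and fV: "\<And>u. u \<in> V' \<Longrightarrow> f u \<in> V"
    and core: "\<And>x. x \<in> S_ext \<Longrightarrow> \<iota> x \<in> V' \<and> f (\<iota> x) = x"
    and uniq: "\<And>u. u \<in> V' \<Longrightarrow> f u \<in> S_ext \<Longrightarrow> u = \<iota> (f u)"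
    and h': "kgraph V' iv kinds h'"
    and deg: "\<And>u k. u \<in> V' \<Longrightarrow> k \<in> kinds \<Longrightarrow> kdeg V' h' u k = kdeg V h (f u) k"
    and large: "\<And>a. a \<in> V - S \<Longrightarrow> 3 * (\<Delta> + 1) \<le> card {u \<in> V'. ty (f u) = ty a}"
    and B: "4 * \<Delta> + 2 \<le> B"
  shows "\<exists>e'. (\<forall>u\<in>V'. \<forall>v\<in>V'. u \<noteq> v \<longrightarrow> e' v u = rv (e' u v))
    \<and> (\<forall>u\<in>V'. \<forall>d l. min K (card {v \<in> V'. v \<noteq> u \<and> col (f v) = d \<and> e' u v = l}) = min K (card (nb (f u) d l)))"
proof -
  \<comment> \<open>The degrees of \<open>u\<close> in \<open>h'\<close> are those of
    \<open>f u\<close> in \<open>h\<close>, so only kinds that begin with the type of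
    \<open>f u\<close> occur at \<open>u\<close>.\<close>
  have h'1: "f u \<in> V - S \<and> fst k = ty (f u)" if k: "h' u v = Some k" for u v k
  proof -
    have *: "u \<in> V'" "v \<in> V'" "k \<in> kinds" using kgraph_mem[OF h' k] by auto
    have "0 < kdeg V h (f u) k" using kdeg_pos[of V' v h' u k] finV' k * deg by simp
    then obtain b where "h (f u) b = Some k" using kdeg_posD[of V h "f u" k] by blast
    then show ?thesis by (auto simp: h_def split: if_splits)
  qed
  have h'2: "f v \<in> V - S \<and> fst (snd k) = ty (f v)" if k: "h' u v = Some k" for u v k
    using h'1[OF kgraph_sym[OF h' k]] by (cases k) (simp add: iv_def)
  have "\<forall>t. \<exists>g. (\<exists>a\<in>V-S. ty a = t) \<longrightarrow> (\<forall>r<3::nat. \<Delta> + 1 \<le> card {v\<in>{u \<in> V'. ty (f u) = t}. g v = r})"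
    (is "\<forall>t. \<exists>g. ?P t g")
  proof
    fix t
    show "\<exists>g. ?P t g"
    proof (cases "\<exists>a\<in>V-S. ty a = t")
      case True
      then have "3 * (\<Delta> + 1) \<le> card {u \<in> V'. ty (f u) = t}" using large by blast
      then show ?thesis using three_parts[of "{u \<in> V'. ty (f u) = t}" "\<Delta> + 1"] finV' by simp
    next
      case False
      then show ?thesis by blast
    qed
  qed
  then obtain G where G: "\<forall>t. (\<exists>a\<in>V-S. ty a = t) \<longrightarrow>
      (\<forall>r<3::nat. \<Delta> + 1 \<le> card {v\<in>{u \<in> V'. ty (f u) = t}. G t v = r})"
    by (rule choice[THEN exE])
  define part where "part v = G (ty (f v)) v" for v
  have part: "\<Delta> + 1 \<le> card {v\<in>V'. ty (f v) = ty a \<and> part v = r}" if "a \<in> V - S" "r < 3" for a r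
  proof -
    have "{v\<in>{u \<in> V'. ty (f u) = ty a}. G (ty a) v = r} = {v\<in>V'. ty (f v) = ty a \<and> part v = r}"
      by (auto simp: part_def)
    then show ?thesis using G[rule_format, of "ty a" r] that by auto
  qed
  define SS where "SS a = {b \<in> V. h a b \<noteq> None}" for a
  define Q where "Q a = {b \<in> V - S. b \<in> Ess a \<and> a \<notin> Ess b}" for a
  have EssD: "Ess a = (Ess a \<inter> S) \<union> SS a \<union> Q a" "SS a \<inter> Q a = {}" if "a \<in> V - S" for a
    using that Ess_V[of _ a] by (auto simp: SS_def Q_def h_def split: if_splits)
  have SSV: "SS a \<subseteq> V - S" "Q a \<subseteq> V - S" for a
    by (auto simp: SS_def Q_def h_def split: if_splits)
  have finSQ: "finite (SS a)" "finite (Q a)" for a using finV by (auto simp: SS_def Q_def)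
  have cSQ: "card (SS a) + card (Q a) \<le> \<Delta>" if "a \<in> V - S" for a
  proof -
    have "card (SS a) + card (Q a) = card (SS a \<union> Q a)"
      using EssD(2)[OF that] finSQ by (simp add: card_Un_disjoint)
    also have "\<dots> \<le> card (Ess a)" using EssD(1)[OF that] by (intro card_mono finite_Ess) blast
    also have "\<dots> \<le> \<Delta>" using card_Ess that by simp
    finally show ?thesis .
  qed
  have cN: "card {v \<in> V'. h' u v \<noteq> None} = card (SS (f u))" if "u \<in> V'" for u
    using card_nbrs_eq_sum_kdeg[OF finV' finite_kinds h', of u]
      card_nbrs_eq_sum_kdeg[OF finV finite_kinds kgraph_h, of "f u"] deg[OF that] by (simp add: SS_def)
  txt \<open>A vertex takes the targets of its one-sided essential edges from the next of three parts, so
    that no pair is chosen from both ends.\<close>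
  define Cand where "Cand u b = {v\<in>V'. ty (f v) = ty b \<and> part v = (part u + 1) mod 3 \<and> h' u v = None}" for u b
  have "\<forall>u. \<exists>q. u \<in> V' \<and> f u \<in> V - S \<longrightarrow> inj_on q (Q (f u)) \<and> (\<forall>b\<in>Q (f u). q b \<in> Cand u b)"
  proof
    fix u
    show "\<exists>q. u \<in> V' \<and> f u \<in> V - S \<longrightarrow> inj_on q (Q (f u)) \<and> (\<forall>b\<in>Q (f u). q b \<in> Cand u b)"
    proof (cases "u \<in> V' \<and> f u \<in> V - S")
      case True
      have "card (Q (f u)) \<le> card (Cand u b)" if b: "b \<in> Q (f u)" for b
      proof -
        let ?P = "{v\<in>V'. ty (f v) = ty b \<and> part v = (part u + 1) mod 3}"
        have "b \<in> V - S" using b SSV by blast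
        \<comment> \<open>Discarding the neighbours in \<open>h'\<close> costs
          \<open>card (SS (f u))\<close> candidates; together with the demand
          \<open>card (Q (f u))\<close> this is at most \<open>\<Delta>\<close>.\<close>
        then have "\<Delta> + 1 \<le> card ?P" using part by simp
        moreover have "card ?P - card {v \<in> V'. h' u v \<noteq> None} \<le> card (?P - {v \<in> V'. h' u v \<noteq> None})"
          using finV' by (intro diff_card_le_card_Diff) auto
        moreover have "?P - {v \<in> V'. h' u v \<noteq> None} = Cand u b"
          by (auto simp: Cand_def simp del: split_paired_All split_paired_Ex)
        ultimately show ?thesis using cSQ[of "f u"] cN[of u] True by simp
      qed
      then show ?thesis using distinct_representatives[OF finSQ(2), of "f u" "Cand u"] by blast
    qed blast
  qed
  then obtain q where q0: "\<forall>u. u \<in> V' \<and> f u \<in> V - S \<longrightarrow>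
      inj_on (q u) (Q (f u)) \<and> (\<forall>b\<in>Q (f u). q u b \<in> Cand u b)"
    by (rule choice[THEN exE])
  have q: "u \<in> V' \<Longrightarrow> f u \<in> V - S \<Longrightarrow> inj_on (q u) (Q (f u))"
      "u \<in> V' \<Longrightarrow> f u \<in> V - S \<Longrightarrow> b \<in> Q (f u) \<Longrightarrow> q u b \<in> Cand u b" for u b
    using q0[rule_format, of u] by blast+
  have q_asym: "u \<notin> q v ` Q (f v)"
    if "u \<in> V'" "f u \<in> V - S" "v \<in> V'" "f v \<in> V - S" "v \<in> q u ` Q (f u)" for u v
  proof
    assume "u \<in> q v ` Q (f v)"
    then have "part u = (part v + 1) mod 3" using q(2)[OF that(3,4)] by (auto simp: Cand_def)
    moreover have "part v = (part u + 1) mod 3" using that(5) q(2)[OF that(1,2)] by (auto simp: Cand_def)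
    \<comment> \<open>Two parts would not do: the two equations contradict each other modulo 3 but
      not modulo 2.\<close>
    ultimately show False by presburger
  qed
  \<comment> \<open>The mutual neighbours of \<open>f u\<close> are matched with those of
    \<open>u\<close> kind by kind, which is possible because all degrees agree.\<close>
  have "\<forall>u. \<exists>g. u \<in> V' \<longrightarrow> bij_betw g (SS (f u)) {v \<in> V'. h' u v \<noteq> None}
      \<and> (\<forall>b\<in>SS (f u). h' u (g b) = h (f u) b)"
  proof
    fix u
    show "\<exists>g. u \<in> V' \<longrightarrow> bij_betw g (SS (f u)) {v \<in> V'. h' u v \<noteq> None}
      \<and> (\<forall>b\<in>SS (f u). h' u (g b) = h (f u) b)"
    proof (cases "u \<in> V'")
      case True
      have c: "card {x \<in> SS (f u). h (f u) x = k} = card {y \<in> {v \<in> V'. h' u v \<noteq> None}. h' u y = k}" for k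
      proof (cases k)
        case None
        then have "{x \<in> SS (f u). h (f u) x = k} = {}" "{y \<in> {v \<in> V'. h' u v \<noteq> None}. h' u y = k} = {}"
          by (auto simp: SS_def simp del: split_paired_All split_paired_Ex)
        then show ?thesis by (simp only: card.empty)
      next
        case (Some k')
        have eq: "{x \<in> SS (f u). h (f u) x = k} = {x \<in> V. h (f u) x = Some k'}"
           "{y \<in> {v \<in> V'. h' u v \<noteq> None}. h' u y = k} = {y \<in> V'. h' u y = Some k'}"
          unfolding SS_def Some by (auto simp del: split_paired_All split_paired_Ex)
        show ?thesis
        proof (cases "k' \<in> kinds")
          case True
          then show ?thesis unfolding eq using deg[OF \<open>u \<in> V'\<close> True] by (simp add: kdeg_def)
        next
          case False
          then have "{x \<in> V. h (f u) x = Some k'} = {}" "{y \<in> V'. h' u y = Some k'} = {}"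
            using kgraph_mem[OF kgraph_h] kgraph_mem[OF h'] by blast+
          then show ?thesis unfolding eq by (simp only: card.empty)
        qed
      qed
      have "finite {v \<in> V'. h' u v \<noteq> None}" using finV' by simp
      from matching_bij[OF finSQ(1) this c] show ?thesis by blast
    qed blast
  qed
  then obtain g where g0: "\<forall>u. u \<in> V' \<longrightarrow> bij_betw (g u) (SS (f u)) {v \<in> V'. h' u v \<noteq> None}
      \<and> (\<forall>b\<in>SS (f u). h' u (g u b) = h (f u) b)"
    by (rule choice[THEN exE])
  have g: "u \<in> V' \<Longrightarrow> bij_betw (g u) (SS (f u)) {v \<in> V'. h' u v \<noteq> None}"
    "u \<in> V' \<Longrightarrow> b \<in> SS (f u) \<Longrightarrow> h' u (g u b) = h (f u) b" for u b
    using g0[rule_format, of u] by blast+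
  define dl where "dl t s = (SOME l. (\<forall>a'\<in>V. ty a' = t \<longrightarrow> K \<le> card (nb a' (fst s) l))
     \<and> (\<forall>b'\<in>V. ty b' = s \<longrightarrow> K \<le> card (nb b' (fst t) (rv l))))" for t s
  have dl: "K \<le> card (nb a (col b) (dl (ty a) (ty b)))" "K \<le> card (nb b (col a) (rv (dl (ty a) (ty b))))"
    if ab: "a \<in> V - S" "b \<in> V - S" for a b
  proof -
    have c: "fst (ty x) = col x" for x by (simp add: ty_def)
    have "(\<forall>a'\<in>V. ty a' = ty a \<longrightarrow> K \<le> card (nb a' (fst (ty b)) (dl (ty a) (ty b))))
     \<and> (\<forall>b'\<in>V. ty b' = ty b \<longrightarrow> K \<le> card (nb b' (fst (ty a)) (rv (dl (ty a) (ty b)))))"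
      unfolding dl_def c by (rule someI_ex[OF default_label[OF ab B]])
    then show "K \<le> card (nb a (col b) (dl (ty a) (ty b)))" "K \<le> card (nb b (col a) (rv (dl (ty a) (ty b))))"
      using ab unfolding c by blast+
  qed
  \<comment> \<open>The order of the vertices decides which end reads the default label forwards; so
    reversal symmetry holds even inside one type.\<close>
  define dflt where "dflt u v = (if u < v then dl (ty (f u)) (ty (f v)) else rv (dl (ty (f v)) (ty (f u))))"
    for u v :: nat
  define e' where "e' u v =
    (if f u \<in> S \<or> f v \<in> S then e (f u) (f v)
     else case h' u v of Some k \<Rightarrow> fst (snd (snd k))
       | None \<Rightarrow> if v \<in> q u ` Q (f u) then e (f u) (inv_into (Q (f u)) (q u) v)
           else if u \<in> q v ` Q (f v) then rv (e (f v) (inv_into (Q (f v)) (q v) u))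
           else dflt u v)" for u v
  have SE: "S \<subseteq> S_ext" by (auto simp: S_ext_def)
  \<comment> \<open>The label \<open>e (f u) (f v)\<close> is meaningful for distinct arguments
    only, hence vertices over \<open>S\<close> have to be unique.\<close>
  have inj_S: "f u \<noteq> f v" if "u \<in> V'" "v \<in> V'" "u \<noteq> v" "f u \<in> S \<or> f v \<in> S" for u v
    using that uniq[of u] uniq[of v] SE by (metis subsetD)
  have sym: "e' v u = rv (e' u v)" if uv: "u \<in> V'" "v \<in> V'" "u \<noteq> v" for u v
  proof (cases "f u \<in> S \<or> f v \<in> S")
    case True
    then show ?thesis using esym[of "f u" "f v"] inj_S[OF uv] fV uv by (auto simp: e'_def)
  next
    case False
    then have fu: "f u \<in> V - S" "f v \<in> V - S" using fV uv by auto
    show ?thesis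
    proof (cases "h' u v")
      case None
      then have "h' v u = None" using kgraph_sym_None[OF h'] by blast
      then show ?thesis using None False q_asym[OF uv(1) fu(1) uv(2) fu(2)]
          q_asym[OF uv(2) fu(2) uv(1) fu(1)] uv(3) by (auto simp: e'_def dflt_def rv_rv)
    next
      case (Some k)
      then show ?thesis using False kgraph_sym[OF h' Some]
        by (cases k) (simp add: e'_def iv_def)
    qed
  qed
  have cnt: "min K (card {v \<in> V'. v \<noteq> u \<and> col (f v) = d \<and> e' u v = l}) = min K (card (nb (f u) d l))"
    if u: "u \<in> V'" for u d l
  proof (cases "f u \<in> S")
    case True
    have E: "Ess (f u) \<subseteq> S_ext" using True by (auto simp: S_ext_def)
    show ?thesis
    proof (rule truncated_counts_preserved[where f = f and e' = e' and \<beta> = \<iota>, OF finV' u fV[OF u]])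
      show "inj_on \<iota> (Ess (f u))" using core E by (metis inj_on_inverseI subsetD)
    next
      fix b assume b: "b \<in> Ess (f u)"
      then have "\<iota> b \<in> V' \<and> f (\<iota> b) = b" using E core by blast
      then show "\<iota> b \<in> V' \<and> \<iota> b \<noteq> u \<and> col (f (\<iota> b)) = col b \<and> e' u (\<iota> b) = e (f u) b"
        using Ess_V[OF b] True by (auto simp: e'_def)
    next
      fix v assume v: "v \<in> V'" "v \<noteq> u" "v \<notin> \<iota> ` Ess (f u)"
      have "f u \<noteq> f v" using inj_S[OF u v(1)] True v(2) by auto
      moreover have "f v \<notin> Ess (f u)" using uniq[OF v(1)] E v(3) by blast
      ultimately have "K \<le> card (nb (f u) (col (f v)) (e (f u) (f v)))" using not_Ess_big fV v by blast
      then show "K \<le> card (nb (f u) (col (f v)) (e' u v))" using True by (simp add: e'_def)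
    qed
  next
    case False
    then have fu: "f u \<in> V - S" using fV u by auto
    define \<beta> where "\<beta> b = (if b \<in> S then \<iota> b else if b \<in> SS (f u) then g u b else q u b)" for b
    have \<beta>S: "\<beta> b \<in> V' \<and> f (\<beta> b) = b" if "b \<in> S" for b
      using that SE core by (auto simp: \<beta>_def)
    have \<beta>SS: "\<beta> b = g u b" "h' u (\<beta> b) = h (f u) b" "h' u (\<beta> b) \<noteq> None" "\<beta> b \<in> V'" if "b \<in> SS (f u)" for b
    proof -
      have bS: "b \<notin> S" using that SSV by blast
      then show "\<beta> b = g u b" "h' u (\<beta> b) = h (f u) b" using that g(2)[OF u] by (auto simp: \<beta>_def)
      show "h' u (\<beta> b) \<noteq> None" "\<beta> b \<in> V'" using that bS bij_betwE[OF g(1)[OF u]] by (auto simp: \<beta>_def)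
    qed
    have \<beta>Q: "\<beta> b = q u b" "\<beta> b \<in> V'" "ty (f (\<beta> b)) = ty b" "part (\<beta> b) = (part u + 1) mod 3" "h' u (\<beta> b) = None"
       "f (\<beta> b) \<in> V - S"
      if b: "b \<in> Q (f u)" for b
    proof -
      have bS: "b \<notin> S" "b \<notin> SS (f u)" using b SSV EssD(2)[OF fu] by blast+
      then show eq: "\<beta> b = q u b" by (simp add: \<beta>_def)
      have "\<beta> b \<in> Cand u b" using eq q(2)[OF u fu b] by simp
      then show *: "\<beta> b \<in> V'" "ty (f (\<beta> b)) = ty b" "part (\<beta> b) = (part u + 1) mod 3" "h' u (\<beta> b) = None"
        by (auto simp: Cand_def)
      show "f (\<beta> b) \<in> V - S" using S_ty[of b "f (\<beta> b)"] * fV b SSV by blast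
    qed
    have E: "b \<in> S \<or> b \<in> SS (f u) \<or> b \<in> Q (f u)" if "b \<in> Ess (f u)" for b
      using EssD(1)[OF fu] that by blast
    show ?thesis
    proof (rule truncated_counts_preserved[where f = f and e' = e' and \<beta> = \<beta>, OF finV' u fV[OF u]])
      show "inj_on \<beta> (Ess (f u))"
      proof (rule inj_onI)
        fix b c assume bc: "b \<in> Ess (f u)" "c \<in> Ess (f u)" "\<beta> b = \<beta> c"
        have fSS: "f (\<beta> b) \<notin> S" if b: "b \<in> SS (f u)" for b
        proof -
          obtain k where "h' u (\<beta> b) = Some k" using \<beta>SS(3)[OF b] by blast
          then show ?thesis using h'2 by blast
        qed
        from E[OF bc(1)] E[OF bc(2)] consider (1) "b \<in> S" "c \<in> S" | (2) "b \<in> SS (f u)" "c \<in> SS (f u)"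
          | (3) "b \<in> Q (f u)" "c \<in> Q (f u)" | (4) "b \<in> S \<and> c \<notin> S \<or> c \<in> S \<and> b \<notin> S"
          | (5) "b \<in> SS (f u) \<and> c \<in> Q (f u) \<or> c \<in> SS (f u) \<and> b \<in> Q (f u)" by blast
        then show "b = c"
        proof cases
          case 1
          then show ?thesis using \<beta>S bc(3) by metis
        next
          case 2
          then have "g u b = g u c" using \<beta>SS(1) bc(3) by simp
          then show ?thesis using g(1)[OF u] 2 by (auto simp: bij_betw_def dest: inj_onD)
        next
          case 3
          then have "q u b = q u c" using \<beta>Q(1) bc(3) by simp
          then show ?thesis using q(1)[OF u fu] 3 by (auto dest: inj_onD)
        next
          case 4
          then show ?thesis using \<beta>S fSS \<beta>Q(6) E bc by (metis DiffD2)
        next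
          case 5
          then show ?thesis using \<beta>SS(3) \<beta>Q(5) bc(3) by metis
        qed
      qed
    next
      fix b assume b: "b \<in> Ess (f u)"
      from E[OF b] show "\<beta> b \<in> V' \<and> \<beta> b \<noteq> u \<and> col (f (\<beta> b)) = col b \<and> e' u (\<beta> b) = e (f u) b"
      proof (elim disjE)
        assume "b \<in> S"
        then show ?thesis using \<beta>S[of b] False by (auto simp: e'_def)
      next
        assume bs: "b \<in> SS (f u)"
        then have hb: "h (f u) b = Some (ty (f u), ty b, e (f u) b, f u < b)"
          by (auto simp: SS_def h_def split: if_splits)
        then have hb': "h' u (\<beta> b) = Some (ty (f u), ty b, e (f u) b, f u < b)" using \<beta>SS(2)[OF bs] by simp
        then have "f (\<beta> b) \<in> V - S" "ty (f (\<beta> b)) = ty b" using h'2[OF hb'] by auto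
        moreover have "\<beta> b \<noteq> u" using kgraph_mem[OF h' hb'] by blast
        ultimately show ?thesis using hb' False \<beta>SS(4)[OF bs] ty_col[of "f (\<beta> b)" b] by (simp add: e'_def)
      next
        assume bq: "b \<in> Q (f u)"
        have "part (\<beta> b) \<noteq> part u" using \<beta>Q(4)[OF bq] by presburger
        then have "\<beta> b \<noteq> u" by blast
        moreover have "e' u (\<beta> b) = e (f u) (inv_into (Q (f u)) (q u) (q u b))"
          using \<beta>Q[OF bq] False bq by (auto simp: e'_def)
        moreover have "inv_into (Q (f u)) (q u) (q u b) = b" using q(1)[OF u fu] bq by simp
        ultimately show ?thesis using \<beta>Q(2)[OF bq] ty_col[OF \<beta>Q(3)[OF bq]] by simp
      qed
    next
      fix v assume v: "v \<in> V'" "v \<noteq> u" "v \<notin> \<beta> ` Ess (f u)"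
      show "K \<le> card (nb (f u) (col (f v)) (e' u v))"
      proof (cases "f v \<in> S")
        case True
        have "f v \<notin> Ess (f u)"
        proof
          assume "f v \<in> Ess (f u)"
          then have "\<beta> (f v) \<in> \<beta> ` Ess (f u)" by (rule imageI)
          moreover have "\<iota> (f v) = v" using uniq[OF v(1)] True SE by (metis subsetD)
          then have "\<beta> (f v) = v" using True by (simp add: \<beta>_def)
          ultimately show False using v(3) by simp
        qed
        moreover have "f u \<noteq> f v" using True False by metis
        ultimately show ?thesis using not_Ess_big[of "f v" "f u"] fV[OF v(1)] True by (simp add: e'_def)
      next
        case fvS: False
        then have fv: "f v \<in> V - S" using fV v by auto
        have "h' u v = None"
        proof (rule ccontr)
          assume "h' u v \<noteq> None"
          then have "v \<in> g u ` SS (f u)" using g(1)[OF u] v(1) unfolding bij_betw_def by blast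
          then obtain b where b: "b \<in> SS (f u)" "v = g u b" by blast
          then have "v = \<beta> b" using \<beta>SS(1)[OF b(1)] by simp
          moreover have "b \<in> Ess (f u)" using b(1) EssD(1)[OF fu] by blast
          ultimately have "v \<in> \<beta> ` Ess (f u)" by blast
          then show False using v(3) by blast
        qed
        moreover have "v \<notin> q u ` Q (f u)"
        proof
          assume "v \<in> q u ` Q (f u)"
          then obtain b where b: "b \<in> Q (f u)" "v = q u b" by blast
          then have "v = \<beta> b" using \<beta>Q(1)[OF b(1)] by simp
          moreover have "b \<in> Ess (f u)" using b(1) by (simp add: Q_def)
          ultimately have "v \<in> \<beta> ` Ess (f u)" by blast
          then show False using v(3) by blast
        qed
        ultimately have e'uv: "e' u v = (if u \<in> q v ` Q (f v)
            then rv (e (f v) (inv_into (Q (f v)) (q v) u)) else dflt u v)"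
          using False fvS by (simp add: e'_def)
        show ?thesis
        proof (cases "u \<in> q v ` Q (f v)")
          case True
          \<comment> \<open>\<open>v\<close> has chosen \<open>u\<close> as a stand-in for
            \<open>b\<close>. As \<open>f v\<close> is inessential for \<open>b\<close>, the label
            is saturated at \<open>b\<close>, hence also at \<open>f u\<close>, which has the same
            type.\<close>
          define b where "b = inv_into (Q (f v)) (q v) u"
          have b: "b \<in> Q (f v)" "q v b = u" using True by (auto simp: b_def inv_into_into f_inv_into_f)
          have tb: "ty (f u) = ty b" using q(2)[OF v(1) fv b(1)] b(2) by (simp add: Cand_def)
          have *: "b \<in> V" "b \<noteq> f v" "f v \<notin> Ess b" using b(1) Ess_V[of b "f v"] by (auto simp: Q_def)
          have "K \<le> card (nb b (col (f v)) (e b (f v)))" using not_Ess_big * fV v(1) by blast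
          then have "K \<le> card (nb (f u) (col (f v)) (e b (f v)))"
            using ty_big[of b "f u"] * tb by simp
          moreover have "e b (f v) = rv (e (f v) b)" using esym[of "f v" b] * fv by blast
          ultimately show ?thesis using e'uv True by (simp add: b_def)
        next
          case False
          then show ?thesis using e'uv dl fu fv by (simp add: dflt_def)
        qed
      qed
    qed
  qed
  show ?thesis using sym cnt by (intro exI[of _ e']) blast
qed

end

section \<open>Removing and adding vertices\<close>

context labelled_graph
begin

lemma kdeg_h_le: assumes "a \<in> V" shows "kdeg V h a k \<le> \<Delta>"
proof -
  have "kdeg V h a k \<le> card (Ess a)" unfolding kdeg_def
    by (rule card_mono[OF finite_Ess]) (auto simp: h_def split: if_splits)
  then show ?thesis using card_Ess[OF assms] by simp
qed

lemma S_V: "S \<subseteq> V" by (auto simp: S_def)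

lemma S_ext_V: "S_ext \<subseteq> V" using S_V Ess_V by (auto simp: S_ext_def)

lemma card_S: "card S \<le> card Ty * B"
proof -
  have "S \<subseteq> (\<Union>t\<in>Ty. {a \<in> S. ty a = t})" using ty_Ty S_V by auto
  then have "card S \<le> card (\<Union>t\<in>Ty. {a \<in> S. ty a = t})"
    using finite_Ty finite_subset[OF S_V finV] by (intro card_mono) auto
  also have "\<dots> \<le> (\<Sum>t\<in>Ty. card {a \<in> S. ty a = t})" by (rule card_UN_le[OF finite_Ty])
  also have "\<dots> \<le> (\<Sum>t\<in>Ty. B)"
  proof (rule sum_mono)
    fix t assume "t \<in> Ty"
    show "card {a \<in> S. ty a = t} \<le> B"
    proof (cases "{a \<in> S. ty a = t} = {}")
      case True
      then show ?thesis by (simp only: card.empty)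
    next
      case False
      then obtain a where a: "a \<in> S" "ty a = t" by blast
      have "card {a \<in> S. ty a = t} \<le> card {b \<in> V. ty b = ty a}"
        using finV S_V a by (intro card_mono) auto
      then show ?thesis using a by (simp add: S_def)
    qed
  qed
  finally show ?thesis by simp
qed

lemma card_S_ext: "card S_ext \<le> card Ty * B + card Ty * B * \<Delta>"
proof -
  have finS: "finite S" using finite_subset[OF S_V finV] .
  have "card S_ext \<le> card S + card (\<Union>x\<in>S. Ess x)" unfolding S_ext_def by (rule card_Un_le)
  also have "card (\<Union>x\<in>S. Ess x) \<le> (\<Sum>x\<in>S. card (Ess x))" by (rule card_UN_le[OF finS])
  also have "\<dots> \<le> (\<Sum>x\<in>S. \<Delta>)" using S_V card_Ess by (intro sum_mono) auto
  also have "\<dots> = card S * \<Delta>" by simp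
  also have "card S + card S * \<Delta> \<le> card Ty * B + card Ty * B * \<Delta>"
    by (intro add_mono mult_le_mono card_S order_refl)
  finally show ?thesis by simp
qed

text \<open>A kind with few edges may offer no remote edge for a switch, so the vertices on its
  edges are left alone.\<close>

definition rare :: "nat \<Rightarrow> nat set" where
  "rare m = {a \<in> V. \<exists>k\<in>kinds. (\<Sum>u\<in>V. kdeg V h u k) < m \<and> 0 < kdeg V h a k}"

lemma card_rare: "card (rare m) \<le> card kinds * m"
proof -
  define A where "A k = {a \<in> V. (\<Sum>u\<in>V. kdeg V h u k) < m \<and> 0 < kdeg V h a k}" for k
  have "rare m = (\<Union>k\<in>kinds. A k)" by (auto simp: rare_def A_def)
  then have "card (rare m) \<le> (\<Sum>k\<in>kinds. card (A k))" using card_UN_le[OF finite_kinds] by simp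
  also have "\<dots> \<le> (\<Sum>k\<in>kinds. m)"
  proof (rule sum_mono)
    fix k
    show "card (A k) \<le> m"
    proof (cases "(\<Sum>u\<in>V. kdeg V h u k) < m")
      case True
      have "card (A k) = (\<Sum>a\<in>A k. 1)" by simp
      also have "\<dots> \<le> (\<Sum>a\<in>A k. kdeg V h a k)" by (intro sum_mono) (simp add: A_def)
      also have "\<dots> \<le> (\<Sum>a\<in>V. kdeg V h a k)" using finV by (intro sum_mono2) (auto simp: A_def)
      finally show ?thesis using True by simp
    next
      case False
      then have "A k = {}" by (simp add: A_def)
      then show ?thesis by simp
    qed
  qed
  finally show ?thesis by simp
qed

text \<open>Taking away \<open>p\<close> vertices destroys at most \<open>2 * p * \<Delta>\<close>
  oriented edges of a kind, after which the supply required by \<open>complete_kgraph\<close> is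
  still there.\<close>

definition thr :: "nat \<Rightarrow> nat" where
  "thr p = 4 * (\<Delta> + 1) * (\<Delta> + 1) + 2 * p * \<Delta>"

text \<open>\<open>V0\<close> is the set of retained vertices and \<open>W1\<close> the set of cloned ones; the retained copy of
  \<open>a\<close> is \<open>2 * a\<close>, the clone is \<open>2 * a + 1\<close>.\<close>

lemma exists_modified_graph:
  assumes B: "B = p + 4 * \<Delta> + 6"
    and W: "W \<subseteq> V" "card W = p" "W \<inter> (S_ext \<union> rare (thr p)) = {}"
    and V0: "V0 \<subseteq> V" "V - V0 \<subseteq> W" and W1: "W1 \<subseteq> W"
    and bal: "\<And>k. k \<in> kinds \<Longrightarrow> (\<Sum>a\<in>V0. kdeg V h a (iv k)) + (\<Sum>a\<in>W1. kdeg V h a (iv k))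
      = (\<Sum>a\<in>V0. kdeg V h a k) + (\<Sum>a\<in>W1. kdeg V h a k)"
  shows "\<exists>(V' :: nat set) f e'. finite V' \<and> card V' = card V0 + card W1 \<and> (\<forall>u\<in>V'. f u \<in> V)
    \<and> (\<forall>u\<in>V'. \<forall>v\<in>V'. u \<noteq> v \<longrightarrow> e' v u = rv (e' u v))
    \<and> (\<forall>u\<in>V'. \<forall>d l. min K (card {v \<in> V'. v \<noteq> u \<and> col (f v) = d \<and> e' u v = l}) = min K (card (nb (f u) d l)))"
proof -
  define \<iota> where "\<iota> a = 2 * a" for a :: nat
  define \<gamma> where "\<gamma> a = 2 * a + 1" for a :: nat
  define f where "f u = u div 2" for u :: nat
  define Co where "Co = \<iota> ` V0"
  define Cl where "Cl = \<gamma> ` W1"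
  define V' where "V' = Co \<union> Cl"
  have f\<iota>: "f (\<iota> a) = a" and f\<gamma>: "f (\<gamma> a) = a" for a by (simp_all add: f_def \<iota>_def \<gamma>_def)
  have inj: "inj_on \<iota> X" "inj_on \<gamma> X" for X by (auto simp: inj_on_def \<iota>_def \<gamma>_def)
  have disj: "Co \<inter> Cl = {}" by (auto simp: Co_def Cl_def \<iota>_def \<gamma>_def) presburger
  have finW: "finite W" and finV0: "finite V0" and finW1: "finite W1"
    using finite_subset[OF W(1) finV] finite_subset[OF V0(1) finV] W1 finite_subset by blast+
  have fin: "finite Co" "finite Cl" "finite V'" using finV0 finW1 by (simp_all add: Co_def Cl_def V'_def)
  have sumV': "(\<Sum>u\<in>V'. F (f u)) = (\<Sum>a\<in>V0. F a) + (\<Sum>a\<in>W1. F a)" for F :: "nat \<Rightarrow> nat"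
    unfolding V'_def sum.union_disjoint[OF fin(1,2) disj]
    by (simp add: Co_def Cl_def sum.reindex inj f\<iota> f\<gamma>)
  have cV': "card V' = card V0 + card W1" using sumV'[of "\<lambda>_. 1"] by simp
  have fCo: "u = \<iota> (f u) \<and> f u \<in> V0" if "u \<in> Co" for u using that f\<iota> by (auto simp: Co_def)
  have fCl: "f u \<in> W1" if "u \<in> Cl" for u using that f\<gamma> by (auto simp: Cl_def)
  have fV: "f u \<in> V" if "u \<in> V'" for u
    using that fCo[of u] fCl[of u] V0(1) W1 W(1) by (auto simp: V'_def)
  \<comment> \<open>The mutual edges between retained vertices are the starting point; clones have
    none yet, and all that is missing is left to \<open>complete_kgraph\<close>.\<close>
  define h0 where "h0 u v = (if u \<in> Co \<and> v \<in> Co then h (f u) (f v) else None)" for u v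
  have kh0: "kgraph V' iv kinds h0"
    unfolding kgraph_def
  proof (intro conjI allI impI)
    show "h0 v u = map_option iv (h0 u v)" for u v
    proof -
      have "h (f v) (f u) = map_option iv (h (f u) (f v))" using kgraph_h unfolding kgraph_def by blast
      then show ?thesis by (simp add: h0_def)
    qed
    show "h0 u u = None" for u by (simp add: h0_def h_def)
    fix u v k assume "h0 u v = Some k"
    then have "u \<in> Co" "v \<in> Co" "h (f u) (f v) = Some k" by (auto simp: h0_def split: if_splits)
    then show "u \<in> V'" "v \<in> V'" "k \<in> kinds" using kgraph_mem[OF kgraph_h] by (auto simp: V'_def)
  qed
  have kd_Cl: "kdeg V' h0 u k = 0" if "u \<notin> Co" for u k using that by (simp add: kdeg_def h0_def)
  have kd_Co: "kdeg V' h0 u k = card {b \<in> V0. h (f u) b = Some k}" if u: "u \<in> Co" for u k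
  proof -
    have "{v \<in> V'. h0 u v = Some k} = \<iota> ` {b \<in> V0. h (f u) b = Some k}"
    proof (intro equalityI subsetI)
      fix v assume "v \<in> {v \<in> V'. h0 u v = Some k}"
      then have "v \<in> Co" "h (f u) (f v) = Some k" by (auto simp: h0_def split: if_splits)
      then show "v \<in> \<iota> ` {b \<in> V0. h (f u) b = Some k}" using fCo[of v] by blast
    next
      fix v assume "v \<in> \<iota> ` {b \<in> V0. h (f u) b = Some k}"
      then obtain b where "b \<in> V0" "h (f u) b = Some k" "v = \<iota> b" by blast
      then show "v \<in> {v \<in> V'. h0 u v = Some k}" using u f\<iota> by (auto simp: h0_def V'_def Co_def)
    qed
    then show ?thesis using card_image[OF inj(1)] by (simp add: kdeg_def)
  qed
  have kd_le: "kdeg V' h0 u k \<le> kdeg V h (f u) k" if "u \<in> V'" for u k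
  proof (cases "u \<in> Co")
    case True
    have "card {b \<in> V0. h (f u) b = Some k} \<le> card {b \<in> V. h (f u) b = Some k}"
      using V0(1) finV by (intro card_mono) auto
    then show ?thesis using kd_Co[OF True] by (simp add: kdeg_def)
  qed (simp add: kd_Cl)
  \<comment> \<open>For a rare kind no vertex of \<open>W\<close> lies on an edge of that kind, so
    nothing is lost and clones demand nothing. Any other kind loses at most
    \<open>2 * p * \<Delta>\<close> oriented edges.\<close>
  have dich: "(\<forall>u\<in>V'. kdeg V' h0 u k = kdeg V h (f u) k) \<or> 4 * (\<Delta> + 1) * (\<Delta> + 1) \<le> (\<Sum>u\<in>V'. kdeg V' h0 u k)"
    if k: "k \<in> kinds" for k
  proof (cases "(\<Sum>u\<in>V. kdeg V h u k) < thr p")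
    case True
    \<comment> \<open>\<open>iv k\<close> is as rare as \<open>k\<close>; this is needed to exclude
      edges that lead into \<open>W\<close>.\<close>
    then have True': "(\<Sum>u\<in>V. kdeg V h u (iv k)) < thr p"
      using sum_kdeg_inv[OF finV kgraph_h iv_iv] by simp
    have W0: "kdeg V h a k = 0" "kdeg V h a (iv k) = 0" if "a \<in> W" for a
      using that W(1,3) True True' k iv_kinds[OF k] by (auto simp: rare_def)
    have "kdeg V' h0 u k = kdeg V h (f u) k" if u: "u \<in> V'" for u
    proof (cases "u \<in> Co")
      case True
      have "b \<in> V0" if b: "b \<in> V" "h (f u) b = Some k" for b
      proof (rule ccontr)
        assume "b \<notin> V0"
        then have "b \<in> W" using V0(2) b by blast
        moreover have "0 < kdeg V h b (iv k)"
          by (rule kdeg_pos[where h = h, OF finV fV[OF u] kgraph_sym[OF kgraph_h b(2)]])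
        ultimately show False using W0 by simp
      qed
      then have "{b \<in> V0. h (f u) b = Some k} = {b \<in> V. h (f u) b = Some k}" using V0(1) by blast
      then show ?thesis using kd_Co[OF True] by (simp add: kdeg_def)
    next
      case False
      then have "f u \<in> W" using u fCl W1 by (auto simp: V'_def)
      then show ?thesis using W0 kd_le[OF u, of k] by simp
    qed
    then show ?thesis by blast
  next
    case False
    define P where "P = {(u, v). u \<in> V \<and> v \<in> V \<and> h u v = Some k}"
    define P0 where "P0 = (SIGMA a:V0. {b \<in> V0. h a b = Some k})"
    let ?S = "SIGMA a:W. Ess a"
    have cP: "thr p \<le> card P" using False sum_kdeg[OF finV, of h k] by (simp add: P_def)
    have finP0: "finite P0" using finV0 by (simp add: P0_def)
    have finS: "finite ?S" using finW finite_Ess by blast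
    have cS: "card ?S \<le> p * \<Delta>"
    proof -
      have "card ?S = (\<Sum>a\<in>W. card (Ess a))" using finW finite_Ess by simp
      also have "\<dots> \<le> (\<Sum>a\<in>W. \<Delta>)" using W(1) card_Ess by (intro sum_mono) auto
      finally show ?thesis using W(2) by simp
    qed
    have "P \<subseteq> P0 \<union> (?S \<union> prod.swap ` ?S)"
    proof
      fix z assume "z \<in> P"
      then obtain a b where z: "z = (a, b)" "a \<in> V" "b \<in> V" "h a b = Some k" by (auto simp: P_def)
      have E: "b \<in> Ess a" "a \<in> Ess b" using z(4) by (auto simp: h_def split: if_splits)
      consider "a \<in> V0" "b \<in> V0" | "a \<in> W" | "b \<in> W" using V0(2) z by blast
      then show "z \<in> P0 \<union> (?S \<union> prod.swap ` ?S)"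
      proof cases
        case 1
        then show ?thesis using z by (simp add: P0_def)
      next
        case 2
        then show ?thesis using z E by simp
      next
        case 3
        then have "prod.swap (b, a) \<in> prod.swap ` ?S" using E by (intro imageI) simp
        then show ?thesis using z by simp
      qed
    qed
    then have "card P \<le> card (P0 \<union> (?S \<union> prod.swap ` ?S))"
      using finP0 finS by (intro card_mono) auto
    also have "\<dots> \<le> card P0 + (card ?S + card (prod.swap ` ?S))"
      by (rule order.trans[OF card_Un_le]) (intro add_mono card_Un_le order_refl)
    also have "\<dots> \<le> card P0 + 2 * p * \<Delta>" using cS by (simp add: card_image)
    finally have "4 * (\<Delta> + 1) * (\<Delta> + 1) \<le> card P0" using cP by (simp add: thr_def)
    also have "card P0 = (\<Sum>a\<in>V0. card {b \<in> V0. h a b = Some k})" using finV0 by (simp add: P0_def)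
    also have "\<dots> = (\<Sum>u\<in>Co. kdeg V' h0 u k)"
      using kd_Co f\<iota> by (simp add: Co_def sum.reindex inj)
    also have "\<dots> \<le> (\<Sum>u\<in>V'. kdeg V' h0 u k)" using fin(3) by (intro sum_mono2) (auto simp: V'_def)
    finally show ?thesis by blast
  qed
  have "\<exists>h'. kgraph V' iv kinds h' \<and> (\<forall>u\<in>V'. \<forall>k\<in>kinds. kdeg V' h' u k = kdeg V h (f u) k)"
  proof (rule complete_kgraph[where D = "\<lambda>u. kdeg V h (f u)", OF fin(3) finite_kinds iv_iv iv_neq iv_kinds _ _ kh0 kd_le dich])
    show "(\<Sum>u\<in>V'. kdeg V h (f u) (iv k)) = (\<Sum>u\<in>V'. kdeg V h (f u) k)" if "k \<in> kinds" for k
      using sumV'[of "\<lambda>a. kdeg V h a (iv k)"] sumV'[of "\<lambda>a. kdeg V h a k"] bal[OF that] by simp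
    show "(\<Sum>k\<in>kinds. kdeg V h (f u) k) \<le> \<Delta>" if "u \<in> V'" for u
      using sum_kdeg_h[OF fV[OF that]] .
  qed
  then obtain h' where h': "kgraph V' iv kinds h'"
    "\<And>u k. u \<in> V' \<Longrightarrow> k \<in> kinds \<Longrightarrow> kdeg V' h' u k = kdeg V h (f u) k" by blast
  have "\<exists>e'. (\<forall>u\<in>V'. \<forall>v\<in>V'. u \<noteq> v \<longrightarrow> e' v u = rv (e' u v))
    \<and> (\<forall>u\<in>V'. \<forall>d l. min K (card {v \<in> V'. v \<noteq> u \<and> col (f v) = d \<and> e' u v = l}) = min K (card (nb (f u) d l)))"
  proof (rule exists_relabelling[where \<iota> = \<iota>, OF fin(3) fV _ _ h'])
    fix x assume x: "x \<in> S_ext"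
    then have "x \<in> V0" using S_ext_V W(3) V0(2) by blast
    then show "\<iota> x \<in> V' \<and> f (\<iota> x) = x" using f\<iota> by (simp add: V'_def Co_def)
  next
    fix u assume u: "u \<in> V'" "f u \<in> S_ext"
    then have "f u \<notin> W1" using W(3) W1 by blast
    then have "u \<in> Co" using u(1) fCl by (auto simp: V'_def)
    then show "u = \<iota> (f u)" using fCo by blast
  next
    fix a assume a: "a \<in> V - S"
    let ?T = "{b \<in> V. ty b = ty a}"
    \<comment> \<open>A large type has at least \<open>B = p + 4 * \<Delta> + 6\<close> vertices and
      loses at most \<open>p\<close> of them.\<close>
    have "B \<le> card ?T" using a by (auto simp: S_def)
    moreover have "card ?T - card W \<le> card (?T - W)" by (rule diff_card_le_card_Diff[OF finW])
    moreover have "card (?T - W) = card (\<iota> ` (?T - W))" by (rule card_image[OF inj(1), symmetric])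
    moreover have "\<iota> ` (?T - W) \<subseteq> {u \<in> V'. ty (f u) = ty a}"
      using V0(2) f\<iota> by (auto simp: V'_def Co_def)
    then have "card (\<iota> ` (?T - W)) \<le> card {u \<in> V'. ty (f u) = ty a}" using fin(3) by (intro card_mono) auto
    ultimately show "3 * (\<Delta> + 1) \<le> card {u \<in> V'. ty (f u) = ty a}" using W(2) B by simp
  qed (use B in auto)
  then obtain e' where e': "\<forall>u\<in>V'. \<forall>v\<in>V'. u \<noteq> v \<longrightarrow> e' v u = rv (e' u v)"
    "\<forall>u\<in>V'. \<forall>d l. min K (card {v \<in> V'. v \<noteq> u \<and> col (f v) = d \<and> e' u v = l}) = min K (card (nb (f u) d l))"
    by (elim exE conjE)
  have fV': "\<forall>u\<in>V'. f u \<in> V" using fV by blast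
  show ?thesis
    by (rule exI[of _ V'], rule exI[of _ f], rule exI[of _ e'], intro conjI,
        rule fin(3), rule cV', rule fV', rule e'(1), rule e'(2))
qed

text \<open>The weights compare the degrees in \<open>k\<close> and \<open>iv k\<close>. A zero-sum
  set \<open>W\<close> is balanced by itself, as is \<open>V\<close>; hence so are \<open>V\<close>
  without \<open>W\<close> and \<open>V\<close> with a second copy of \<open>W\<close>.\<close>

lemma exists_pumped_graph:
  assumes L: "L = block_bound \<Delta> (card kinds)" and p: "p = fact L" and B: "B = p + 4 * \<Delta> + 6"
    and big: "L * ((card Ty * B + card Ty * B * \<Delta>) + card kinds * thr p + L * p) \<le> card V"
    and n: "n = card V + p \<or> n + p = card V"
  shows "\<exists>(V' :: nat set) f e'. finite V' \<and> card V' = n \<and> (\<forall>u\<in>V'. f u \<in> V)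
    \<and> (\<forall>u\<in>V'. \<forall>v\<in>V'. u \<noteq> v \<longrightarrow> e' v u = rv (e' u v))
    \<and> (\<forall>u\<in>V'. \<forall>d l. min K (card {v \<in> V'. v \<noteq> u \<and> col (f v) = d \<and> e' u v = l}) = min K (card (nb (f u) d l)))"
proof -
  define w where "w a k = int (kdeg V h a k) - int (kdeg V h a (iv k))" for a k
  define Bad where "Bad = S_ext \<union> rare (thr p)"
  define Z where "Z = (card Ty * B + card Ty * B * \<Delta>) + card kinds * thr p"
  have sumV: "(\<Sum>a\<in>V. kdeg V h a (iv k)) = (\<Sum>a\<in>V. kdeg V h a k)" for k
    by (rule sum_kdeg_inv[OF finV kgraph_h iv_iv])
  have sumw: "(\<Sum>a\<in>X. w a k) = int (\<Sum>a\<in>X. kdeg V h a k) - int (\<Sum>a\<in>X. kdeg V h a (iv k))" for X k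
    by (simp add: w_def sum_subtractf)
  have "\<bar>w a k\<bar> \<le> int \<Delta>" if "a \<in> V" for a k
    using kdeg_h_le[OF that, of k] kdeg_h_le[OF that, of "iv k"] by (simp add: w_def)
  moreover have "(\<Sum>a\<in>V. w a k) = 0" for k using sumV by (simp add: sumw)
  moreover have "card Bad \<le> Z" unfolding Bad_def Z_def
    by (rule order.trans[OF card_Un_le add_mono[OF card_S_ext card_rare]])
  moreover have "finite Bad" using S_ext_V finV by (auto simp: Bad_def rare_def intro: finite_subset)
  moreover have "L * (Z + L * p) \<le> card V" using big by (simp add: Z_def)
  ultimately have "\<exists>W\<subseteq>V. W \<inter> Bad = {} \<and> card W = p \<and> (\<forall>k\<in>kinds. (\<Sum>x\<in>W. w x k) = 0)"
    by (intro zero_sum_subset[OF finV finite_kinds _ _ L p])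
  then obtain W where W: "W \<subseteq> V" "W \<inter> Bad = {}" "card W = p" "\<And>k. k \<in> kinds \<Longrightarrow> (\<Sum>x\<in>W. w x k) = 0"
    by blast
  have finW: "finite W" using finite_subset[OF W(1) finV] .
  have sumW: "(\<Sum>a\<in>W. kdeg V h a (iv k)) = (\<Sum>a\<in>W. kdeg V h a k)" if "k \<in> kinds" for k
  proof -
    have "int (\<Sum>a\<in>W. kdeg V h a (iv k)) = int (\<Sum>a\<in>W. kdeg V h a k)"
      using W(4)[OF that] unfolding sumw by linarith
    then show ?thesis by (simp only: of_nat_eq_iff)
  qed
  from n show ?thesis
  proof
    assume n: "n = card V + p"
    show ?thesis
      using exists_modified_graph[OF B W(1,3), of V W] W(2) sumV sumW n W(3) by (simp add: Bad_def)
  next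
    assume n: "n + p = card V"
    have split: "(\<Sum>a\<in>V. F a) = (\<Sum>a\<in>V - W. F a) + (\<Sum>a\<in>W. F a)" for F :: "nat \<Rightarrow> nat"
      by (rule sum.subset_diff[OF W(1) finV])
    have bal: "(\<Sum>a\<in>V - W. kdeg V h a (iv k)) = (\<Sum>a\<in>V - W. kdeg V h a k)" if "k \<in> kinds" for k
      using sumV[of k] sumW[OF that] split[of "\<lambda>a. kdeg V h a k"] split[of "\<lambda>a. kdeg V h a (iv k)"] by linarith
    have c: "card (V - W) = n" using n W(1,3) finW by (simp add: card_Diff_subset)
    have "V - (V - W) \<subseteq> W" by blast
    then show ?thesis using exists_modified_graph[OF B W(1,3), of "V - W" "{}"] W(2) bal c by (simp add: Bad_def)
  qed
qed

end

section \<open>Transfer of sentences\<close>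

lemma c2_sat_cong:
  assumes "\<And>v. v \<in> c2_fv \<phi> \<Longrightarrow> \<sigma> v = \<tau> v"
  shows "c2_sat M \<sigma> \<phi> = c2_sat M \<tau> \<phi>"
  using assms
proof (induction \<phi> arbitrary: \<sigma> \<tau>)
  case (CNot \<phi>)
  have "c2_sat M \<sigma> \<phi> = c2_sat M \<tau> \<phi>" by (rule CNot.IH) (use CNot.prems in simp)
  then show ?case by simp
next
  case (CAnd \<phi> \<psi>)
  have "c2_sat M \<sigma> \<phi> = c2_sat M \<tau> \<phi>" by (rule CAnd.IH(1)) (use CAnd.prems in simp)
  moreover have "c2_sat M \<sigma> \<psi> = c2_sat M \<tau> \<psi>" by (rule CAnd.IH(2)) (use CAnd.prems in simp)
  ultimately show ?case by simp
next
  case (CEx k z \<phi>)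
  have "c2_sat M (\<sigma>(z := a)) \<phi> = c2_sat M (\<tau>(z := a)) \<phi>" for a
    by (rule CEx.IH) (use CEx.prems in auto)
  then show ?case by simp
qed simp_all

lemma c2_sat_CEx_card:
  assumes "finite (Dom M)"
  shows "c2_sat M \<sigma> (CEx k z \<phi>) \<longleftrightarrow> k \<le> card {a \<in> Dom M. c2_sat M (\<sigma>(z := a)) \<phi>}"
proof
  assume "c2_sat M \<sigma> (CEx k z \<phi>)"
  then obtain S where S: "S \<subseteq> Dom M" "card S = k" "\<forall>a\<in>S. c2_sat M (\<sigma>(z := a)) \<phi>" by auto
  then have "S \<subseteq> {a \<in> Dom M. c2_sat M (\<sigma>(z := a)) \<phi>}" by blast
  then show "k \<le> card {a \<in> Dom M. c2_sat M (\<sigma>(z := a)) \<phi>}"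
    using card_mono[of "{a \<in> Dom M. c2_sat M (\<sigma>(z := a)) \<phi>}" S] assms S(2) by simp
next
  assume "k \<le> card {a \<in> Dom M. c2_sat M (\<sigma>(z := a)) \<phi>}"
  then obtain S where S: "S \<subseteq> {a \<in> Dom M. c2_sat M (\<sigma>(z := a)) \<phi>}" "card S = k" "finite S"
    by (rule obtain_subset_with_card_n)
  then show "c2_sat M \<sigma> (CEx k z \<phi>)" by (auto intro!: exI[of _ S])
qed

lemma min_sum_cong:
  fixes x y :: "'i \<Rightarrow> nat"
  assumes "\<And>i. i \<in> I \<Longrightarrow> min K (x i) = min K (y i)"
  shows "min K (sum x I) = min K (sum y I)"
  using assms
proof (induction I rule: infinite_finite_induct)
  case (insert i I)
  then have "min K (x i) = min K (y i)" "min K (sum x I) = min K (sum y I)" by auto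
  then show ?case using insert.hyps by (simp add: min_def split: if_splits)
qed simp_all

lemma card_eq_sum_fibres:
  assumes "finite X" "finite I" "g ` X \<subseteq> I"
  shows "card X = (\<Sum>i\<in>I. card {x \<in> X. g x = i})"
  using sum.group[OF assms, of "\<lambda>_. 1::nat"] by simp

text \<open>Both directions are recorded, so that reversing an edge amounts to
  \<open>prod.swap\<close>.\<close>

definition lab :: "nat \<Rightarrow> nat struct \<Rightarrow> nat \<Rightarrow> nat \<Rightarrow> nat set \<times> nat set" where
  "lab c M a b = ({R. R \<le> c \<and> Binary M R a b}, {R. R \<le> c \<and> Binary M R b a})"

text \<open>Both variables are sent to \<open>a\<close>, so the colour settles, up to code
  \<open>c\<close>, loops, unary predicates and all formulas with at most one free variable.\<close>

definition colour :: "nat \<Rightarrow> nat struct \<Rightarrow> nat \<Rightarrow> nat set" where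
  "colour c M a = {m. m \<le> c \<and> (\<exists>\<psi>. m = c2_code \<psi> \<and> c2_sat M (\<lambda>_. a) \<psi>)}"

lemma colour_iff: "c2_code \<psi> \<le> c \<Longrightarrow> c2_code \<psi> \<in> colour c M a \<longleftrightarrow> c2_sat M (\<lambda>_. a) \<psi>"
  by (auto simp: colour_def)

lemma colour_eqD:
  "colour c M a = colour c M b \<Longrightarrow> c2_code \<psi> \<le> c \<Longrightarrow> c2_sat M (\<lambda>_. a) \<psi> = c2_sat M (\<lambda>_. b) \<psi>"
  by (metis colour_iff)

definition relabel :: "nat struct \<Rightarrow> nat set \<Rightarrow> (nat \<Rightarrow> nat) \<Rightarrow> (nat \<Rightarrow> nat \<Rightarrow> nat set \<times> nat set) \<Rightarrow> nat struct" where
  "relabel M V' f e' = \<lparr>Dom = V', Unary = \<lambda>P u. Unary M P (f u),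
     Binary = \<lambda>R u v. if u = v then Binary M R (f u) (f u) else R \<in> fst (e' u v)\<rparr>"

text \<open>The induction is carried by pairs with the same colours, the same equality pattern and
  the same label. The partner of \<open>\<sigma>' z\<close> need not be
  \<open>f (\<sigma>' z)\<close>, only a vertex of the same colour; the counted witnesses need this
  freedom.\<close>

lemma relabel_sat:
  fixes M :: "nat struct" and V' :: "nat set"
  assumes fin: "finite (Dom M)" "finite V'" and fV: "\<And>u. u \<in> V' \<Longrightarrow> f u \<in> Dom M"
    and sym: "\<And>u v. u \<in> V' \<Longrightarrow> v \<in> V' \<Longrightarrow> u \<noteq> v \<Longrightarrow> e' v u = prod.swap (e' u v)"
    and cnt: "\<And>u d l. u \<in> V' \<Longrightarrow>
      min c (card {v \<in> V'. v \<noteq> u \<and> colour c M (f v) = d \<and> e' u v = l})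
      = min c (card {b \<in> Dom M. b \<noteq> f u \<and> colour c M b = d \<and> lab c M (f u) b = l})"
    and "c2_code \<psi> \<le> c" and "range \<sigma> \<subseteq> Dom M" and "range \<sigma>' \<subseteq> V'"
    and "\<And>z. colour c M (\<sigma> z) = colour c M (f (\<sigma>' z))"
    and "\<sigma> VX = \<sigma> VY \<longleftrightarrow> \<sigma>' VX = \<sigma>' VY"
    and "\<sigma>' VX \<noteq> \<sigma>' VY \<Longrightarrow> lab c M (\<sigma> VX) (\<sigma> VY) = e' (\<sigma>' VX) (\<sigma>' VY)"
  shows "c2_sat (relabel M V' f e') \<sigma>' \<psi> = c2_sat M \<sigma> \<psi>"
  using assms(6-)
proof (induction \<psi> arbitrary: \<sigma> \<sigma>')
  case (CEq u v)
  show ?case using CEq.prems(5) by (cases u; cases v) auto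
next
  case (CBin R u v)
  have R: "R \<le> c" using CBin.prems(1) le_prod_encode_2[of "prod_encode (R, prod_encode (var_code u, var_code v))" 1]
      le_prod_encode_1[of R "prod_encode (var_code u, var_code v)"] by simp
  show ?case
  proof (cases "\<sigma>' u = \<sigma>' v")
    case True
    then have "\<sigma> u = \<sigma> v" using CBin.prems(5) by (cases u; cases v) auto
    moreover have "Binary M R (\<sigma> u) (\<sigma> u) = Binary M R (f (\<sigma>' u)) (f (\<sigma>' u))"
      using colour_eqD[OF CBin.prems(4)[of u] CBin.prems(1)] by simp
    ultimately show ?thesis using True by (simp add: relabel_def)
  next
    case False
    then have ne: "\<sigma>' VX \<noteq> \<sigma>' VY" by (cases u; cases v) auto
    have "e' (\<sigma>' VY) (\<sigma>' VX) = prod.swap (e' (\<sigma>' VX) (\<sigma>' VY))"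
      using sym[of "\<sigma>' VX" "\<sigma>' VY"] ne CBin.prems(3) by auto
    then show ?thesis using False R CBin.prems(6)[OF ne, symmetric]
      by (cases u; cases v) (simp_all add: relabel_def lab_def)
  qed
next
  case (CUn P u)
  have "Unary M P (\<sigma> u) = Unary M P (f (\<sigma>' u))"
    using colour_eqD[OF CUn.prems(4)[of u] CUn.prems(1)] by simp
  then show ?case by (simp add: relabel_def)
next
  case (CNot \<psi>)
  have "c2_code \<psi> \<le> c" using CNot.prems(1) le_prod_encode_2[of "c2_code \<psi>" 3] by simp
  then show ?case using CNot.IH[OF _ CNot.prems(2-)] by simp
next
  case (CAnd \<psi> \<chi>)
  have "c2_code \<psi> \<le> c" "c2_code \<chi> \<le> c"
    using CAnd.prems(1) le_prod_encode_2[of "prod_encode (c2_code \<psi>, c2_code \<chi>)" 4]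
      le_prod_encode_1[of "c2_code \<psi>" "c2_code \<chi>"] le_prod_encode_2[of "c2_code \<chi>" "c2_code \<psi>"] by simp_all
  then show ?case using CAnd.IH(1)[OF _ CAnd.prems(2-)] CAnd.IH(2)[OF _ CAnd.prems(2-)] by simp
next
  case (CEx k z \<chi>)
  \<comment> \<open>A positive truncation level tells empty groups from nonempty ones; the
    constructor tag inside the code provides it.\<close>
  have "5 \<le> c" using CEx.prems(1) le_prod_encode_1[of 5 "prod_encode (k, prod_encode (var_code z, c2_code \<chi>))"] by simp
  then have c1: "0 < c" by simp
  have "prod_encode (k, prod_encode (var_code z, c2_code \<chi>)) \<le> c"
    using CEx.prems(1) le_prod_encode_2[of "prod_encode (k, prod_encode (var_code z, c2_code \<chi>))" 5] by simp
  then have kc: "k \<le> c" and "prod_encode (var_code z, c2_code \<chi>) \<le> c"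
    using le_prod_encode_1 le_prod_encode_2 le_trans by blast+
  then have \<chi>c: "c2_code \<chi> \<le> c" using le_prod_encode_2 le_trans by blast
  let ?M' = "relabel M V' f e'"
  have DM': "Dom ?M' = V'" by (simp add: relabel_def)
  \<comment> \<open>\<open>w\<close> is the variable that stays free under the quantifier; the value
    of \<open>z\<close> is overwritten.\<close>
  define w where "w = (if z = VX then VY else VX)"
  have upd: "\<tau>(z := b) = (\<lambda>_. \<tau> w)(z := b)" for \<tau> :: "var \<Rightarrow> nat" and b
    by (rule ext, rename_tac y, case_tac y) (auto simp: w_def, (cases z; simp)+)
  define a' where "a' = \<sigma>' w"
  define a where "a = f a'"
  have a': "a' \<in> V'" using CEx.prems(3) by (auto simp: a'_def)
  have a: "a \<in> Dom M" using fV[OF a'] by (simp add: a_def)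
  define s where "s b = c2_sat M ((\<lambda>_. a)(z := b)) \<chi>" for b
  define s' where "s' b = c2_sat ?M' ((\<lambda>_. a')(z := b)) \<chi>" for b
  \<comment> \<open>The witness \<open>a\<close> itself lies outside the neighbourhood counts and is
    handled on the diagonal.\<close>
  have sa: "s' a' = s a"
  proof -
    have "c2_sat ?M' (\<lambda>_. a') \<chi> = c2_sat M (\<lambda>_. a) \<chi>"
      by (rule CEx.IH) (use \<chi>c a a' in \<open>auto simp: a_def\<close>)
    moreover have "(\<lambda>_. a')(z := a') = (\<lambda>_. a')" "(\<lambda>_. a)(z := a) = (\<lambda>_. a)" by auto
    ultimately show ?thesis by (simp add: s_def s'_def)
  qed
  have sb: "s' b' = s b" if b: "b \<in> Dom M" "b \<noteq> a" "b' \<in> V'" "b' \<noteq> a'"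
    "colour c M b = colour c M (f b')" "lab c M a b = e' a' b'" for b b'
  proof -
    have "lab c M b a = e' b' a'" using b(6) sym[OF a' b(3)] b(4) by (auto simp: lab_def prod_eq_iff)
    then show ?thesis unfolding s_def s'_def
      by (intro CEx.IH) (use \<chi>c a a' b in \<open>cases z; auto simp: a_def\<close>)+
  qed
  have M': "c2_sat ?M' \<sigma>' (CEx k z \<chi>) \<longleftrightarrow> k \<le> card {b \<in> V'. s' b}"
    using c2_sat_CEx_card[of ?M' \<sigma>' k z \<chi>] fin(2) unfolding DM' upd[of \<sigma>'] s'_def a'_def by blast
  \<comment> \<open>The quantified formula depends on \<open>w\<close> only and has code at most
    \<open>c\<close>, so the colour permits replacing \<open>\<sigma> w\<close> by
    \<open>f (\<sigma>' w)\<close>, for which the counts are known.\<close>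
  have "c2_sat M \<sigma> (CEx k z \<chi>) \<longleftrightarrow> c2_sat M (\<lambda>_. \<sigma> w) (CEx k z \<chi>)"
    unfolding c2_sat_CEx_card[OF fin(1)] upd[of \<sigma>] by (rule refl)
  also have "\<dots> \<longleftrightarrow> c2_sat M (\<lambda>_. a) (CEx k z \<chi>)"
    unfolding a_def a'_def by (rule colour_eqD[OF CEx.prems(4) CEx.prems(1)])
  also have "\<dots> \<longleftrightarrow> k \<le> card {b \<in> Dom M. s b}"
    unfolding s_def by (rule c2_sat_CEx_card[OF fin(1)])
  finally have M: "c2_sat M \<sigma> (CEx k z \<chi>) \<longleftrightarrow> k \<le> card {b \<in> Dom M. s b}" .
  define X where "X = {b \<in> Dom M. b \<noteq> a \<and> s b}"
  define X' where "X' = {b \<in> V'. b \<noteq> a' \<and> s' b}"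
  define \<kappa> where "\<kappa> b = (colour c M b, lab c M a b)" for b
  define \<kappa>' where "\<kappa>' b = (colour c M (f b), e' a' b)" for b
  define I where "I = \<kappa> ` X \<union> \<kappa>' ` X'"
  have finX: "finite X" "finite X'" "finite I" using fin by (auto simp: X_def X'_def I_def)
  \<comment> \<open>By \<open>sb\<close> the truth of \<open>\<chi>\<close> is constant on a group
    of fixed colour and label, and the same on both sides, so a group counts entirely or not at
    all.\<close>
  have "min c (card {b \<in> X. \<kappa> b = i}) = min c (card {b \<in> X'. \<kappa>' b = i})" for i
  proof -
    obtain d l where i: "i = (d, l)" by (cases i)
    define Y where "Y = {b \<in> Dom M. b \<noteq> a \<and> colour c M b = d \<and> lab c M a b = l}"
    define Y' where "Y' = {v \<in> V'. v \<noteq> a' \<and> colour c M (f v) = d \<and> e' a' v = l}"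
    have YY: "min c (card Y') = min c (card Y)" using cnt[OF a'] by (simp add: Y_def Y'_def a_def)
    have finY: "finite Y" "finite Y'" using fin by (auto simp: Y_def Y'_def)
    have ss: "s' b' = s b" if "b \<in> Y" "b' \<in> Y'" for b b'
      using that by (intro sb) (auto simp: Y_def Y'_def)
    have XY: "{b \<in> X. \<kappa> b = i} = {b \<in> Y. s b}" "{b \<in> X'. \<kappa>' b = i} = {b \<in> Y'. s' b}"
      by (auto simp: X_def X'_def Y_def Y'_def \<kappa>_def \<kappa>'_def i)
    show ?thesis
    proof (cases "Y = {} \<or> Y' = {}")
      case True
      then have "card Y = 0 \<or> card Y' = 0" by auto
      then have "card Y = 0 \<and> card Y' = 0" using YY c1 by (auto simp: min_def split: if_splits)
      then have "Y = {}" "Y' = {}" using finY by auto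
      then show ?thesis unfolding XY by simp
    next
      case False
      then obtain b b' where b: "b \<in> Y" "b' \<in> Y'" by blast
      show ?thesis
      proof (cases "s b")
        case True
        then have "{b \<in> Y. s b} = Y" "{b \<in> Y'. s' b} = Y'" using ss b by blast+
        then show ?thesis unfolding XY using YY by simp
      next
        case False
        then have "{b \<in> Y. s b} = {}" "{b \<in> Y'. s' b} = {}" using ss b by blast+
        then show ?thesis unfolding XY by (simp only: card.empty)
      qed
    qed
  qed
  then have "min c (\<Sum>i\<in>I. card {b \<in> X. \<kappa> b = i}) = min c (\<Sum>i\<in>I. card {b \<in> X'. \<kappa>' b = i})"
    by (intro min_sum_cong)
  moreover have "card X = (\<Sum>i\<in>I. card {b \<in> X. \<kappa> b = i})" "card X' = (\<Sum>i\<in>I. card {b \<in> X'. \<kappa>' b = i})"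
    using finX by (auto intro!: card_eq_sum_fibres simp: I_def)
  ultimately have cX: "min c (card X) = min c (card X')" by simp
  have "{b \<in> Dom M. s b} = (if s a then insert a X else X)" "{b \<in> V'. s' b} = (if s' a' then insert a' X' else X')"
    using a a' by (auto simp: X_def X'_def)
  moreover have "a \<notin> X" "a' \<notin> X'" by (auto simp: X_def X'_def)
  ultimately have "card {b \<in> Dom M. s b} = card X + (if s a then 1 else 0)"
    "card {b \<in> V'. s' b} = card X' + (if s' a' then 1 else 0)" using finX by auto
  then have "k \<le> card {b \<in> Dom M. s b} \<longleftrightarrow> k \<le> card {b \<in> V'. s' b}"
    using cX kc sa by (auto simp: min_def split: if_splits)
  then show ?case using M M' by blast
qed

lemma relabel_model:
  fixes M :: "nat struct" and V' :: "nat set"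
  assumes fin: "finite (Dom M)" "finite V'" "V' \<noteq> {}" and fV: "\<And>u. u \<in> V' \<Longrightarrow> f u \<in> Dom M"
    and sym: "\<And>u v. u \<in> V' \<Longrightarrow> v \<in> V' \<Longrightarrow> u \<noteq> v \<Longrightarrow> e' v u = prod.swap (e' u v)"
    and cnt: "\<And>u d l. u \<in> V' \<Longrightarrow>
      min c (card {v \<in> V'. v \<noteq> u \<and> colour c M (f v) = d \<and> e' u v = l})
      = min c (card {b \<in> Dom M. b \<noteq> f u \<and> colour c M b = d \<and> lab c M (f u) b = l})"
    and \<phi>: "c2_sentence \<phi>" "c2_code \<phi> = c" and M: "c2_model M \<phi>"
  shows "card V' \<in> Spec \<phi>"
proof -
  let ?M' = "relabel M V' f e'"
  have DM': "Dom ?M' = V'" by (simp add: relabel_def)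
  have "c2_sat ?M' \<sigma> \<phi>" if "range \<sigma> \<subseteq> V'" for \<sigma>
  proof -
    have u: "\<sigma> VX \<in> V'" using that by auto
    have "c2_sat ?M' \<sigma> \<phi> = c2_sat ?M' (\<lambda>_. \<sigma> VX) \<phi>"
      by (rule c2_sat_cong) (use \<phi> in \<open>simp add: c2_sentence_def\<close>)
    also have "\<dots> = c2_sat M (\<lambda>_. f (\<sigma> VX)) \<phi>"
      using \<phi> u fV[OF u] by (intro relabel_sat[OF fin(1,2) fV sym cnt]) auto
    also have "\<dots>" using M fV[OF u] by (auto simp: c2_model_def)
    finally show ?thesis by blast
  qed
  then have "c2_model ?M' \<phi>" using fin(3) by (simp add: c2_model_def DM')
  then show ?thesis using Spec_any_type[of ?M' \<phi>] fin(2) DM' by simp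
qed

section \<open>Recursive functions\<close>

text \<open>\<open>recursive n f\<close> is sensitive to the values of \<open>f\<close> on lists of length other than \<open>n\<close>; the
  closure below is not.\<close>

definition computable :: "nat \<Rightarrow> (nat list \<Rightarrow> nat) \<Rightarrow> bool" where
  "computable n f \<longleftrightarrow> (\<exists>g. recursive n g \<and> (\<forall>xs. length xs = n \<longrightarrow> g xs = f xs))"

definition decidable :: "nat \<Rightarrow> (nat list \<Rightarrow> bool) \<Rightarrow> bool" where
  "decidable n P \<longleftrightarrow> computable n (\<lambda>xs. of_bool (P xs))"

lemma computable_cong: "computable n f \<Longrightarrow> (\<And>xs. length xs = n \<Longrightarrow> g xs = f xs) \<Longrightarrow> computable n g"
  unfolding computable_def by metis

lemma computable_comp:
  assumes "computable (length gs) f" and "\<forall>g\<in>set gs. computable n g"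
  shows "computable n (\<lambda>xs. f (map (\<lambda>g. g xs) gs))"
proof -
  obtain f' where f': "recursive (length gs) f'" "\<And>xs. length xs = length gs \<Longrightarrow> f' xs = f xs"
    using assms(1) unfolding computable_def by blast
  from assms(2) have "\<forall>g\<in>set gs. \<exists>g'. recursive n g' \<and> (\<forall>xs. length xs = n \<longrightarrow> g' xs = g xs)"
    unfolding computable_def .
  then obtain G where G: "\<forall>g\<in>set gs. recursive n (G g) \<and> (\<forall>xs. length xs = n \<longrightarrow> G g xs = g xs)"
    by (rule bchoice[THEN exE])
  have "recursive n (\<lambda>xs. f' (map (\<lambda>g. g xs) (map G gs)))"
    by (rule recursive.comp) (use f'(1) G in auto)
  moreover have "f' (map (\<lambda>g. g xs) (map G gs)) = f (map (\<lambda>g. g xs) gs)" if "length xs = n" for xs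
  proof -
    have eq: "map (\<lambda>g. g xs) (map G gs) = map (\<lambda>g. g xs) gs" using G that by simp
    show ?thesis unfolding eq by (rule f'(2)) simp
  qed
  ultimately show ?thesis unfolding computable_def by blast
qed

lemma computable_nth: "i < n \<Longrightarrow> computable n (\<lambda>xs. xs ! i)"
  unfolding computable_def using recursive.proj by blast

lemma computable_comp1:
  assumes "computable 1 (\<lambda>xs. f (xs ! 0))" "computable n a"
  shows "computable n (\<lambda>xs. f (a xs))"
  using computable_comp[of "[a]" "\<lambda>xs. f (xs ! 0)" n] assms by simp

lemma computable_comp2:
  assumes "computable 2 (\<lambda>xs. f (xs ! 0) (xs ! 1))" "computable n a" "computable n b"
  shows "computable n (\<lambda>xs. f (a xs) (b xs))"
  using computable_comp[of "[a, b]" "\<lambda>xs. f (xs ! 0) (xs ! 1)" n] assms by (simp add: numeral_2_eq_2)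

lemma computable_Suc: assumes "computable n a" shows "computable n (\<lambda>xs. Suc (a xs))"
proof (rule computable_comp1[OF _ assms])
  show "computable 1 (\<lambda>xs. Suc (xs ! 0))" unfolding computable_def using recursive.succ by blast
qed

lemma computable_const: "computable n (\<lambda>xs. k)"
proof (induction k)
  case 0
  then show ?case unfolding computable_def using recursive.zero by blast
next
  case (Suc k)
  then show ?case by (rule computable_Suc)
qed

lemma computable_rec:
  assumes f: "computable n f" and g: "computable (Suc (Suc n)) (\<lambda>ys. g (ys ! 0) (ys ! 1) (drop 2 ys))" and m: "computable n m"
  shows "computable n (\<lambda>xs. rec_nat (f xs) (\<lambda>k r. g k r xs) (m xs))"
proof -
  obtain f' where f': "recursive n f'" "\<And>xs. length xs = n \<Longrightarrow> f' xs = f xs"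
    using f unfolding computable_def by blast
  obtain g' where g': "recursive (Suc (Suc n)) g'"
    "\<And>xs. length xs = Suc (Suc n) \<Longrightarrow> g' xs = g (xs ! 0) (xs ! 1) (drop 2 xs)"
    using g unfolding computable_def by blast
  define R where "R ys = rec_nat (f (tl ys)) (\<lambda>k r. g k r (tl ys)) (hd ys)" for ys
  have "computable (Suc n) R" unfolding computable_def
  proof (intro exI conjI allI impI)
    show "recursive (Suc n) (\<lambda>xs. rec_nat (f' (tl xs)) (\<lambda>k r. g' (k # r # tl xs)) (hd xs))"
      by (rule recursive.prec[OF f'(1) g'(1)])
    fix xs :: "nat list" assume "length xs = Suc n"
    then have l: "length (tl xs) = n" by simp
    have "(\<lambda>k r. g' (k # r # tl xs)) = (\<lambda>k r. g k r (tl xs))"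
      using g'(2)[of "_ # _ # tl xs"] l by (simp add: drop_Suc)
    then show "rec_nat (f' (tl xs)) (\<lambda>k r. g' (k # r # tl xs)) (hd xs) = R xs"
      using f'(2)[OF l] by (simp add: R_def)
  qed
  \<comment> \<open>\<open>prec\<close> recurses on the first argument, so the computed bound is put
    in front of the argument list.\<close>
  let ?gs = "m # map (\<lambda>i (xs :: nat list). xs ! i) [0..<n]"
  have "computable n (\<lambda>xs. R (map (\<lambda>g. g xs) ?gs))"
    using \<open>computable (Suc n) R\<close> m computable_nth by (intro computable_comp) auto
  then show ?thesis
  proof (rule computable_cong)
    fix xs :: "nat list" assume "length xs = n"
    then have "map (\<lambda>g. g xs) ?gs = m xs # xs" by (auto intro: nth_equalityI)
    then show "rec_nat (f xs) (\<lambda>k r. g k r xs) (m xs) = R (map (\<lambda>g. g xs) ?gs)"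
      by (simp add: R_def)
  qed
qed

lemma computable_drop_nth: "2 + i < n \<Longrightarrow> computable n (\<lambda>ys. drop 2 ys ! i)"
  by (rule computable_cong[OF computable_nth[of "2 + i"]]) auto

text \<open>Bounded sums and quantifiers put their index in front of the arguments; an outer
  argument is then reached through one \<open>tl\<close> per binder.\<close>

lemma computable_tl_nth: "Suc i < n \<Longrightarrow> computable n (\<lambda>ys. tl ys ! i)"
  by (rule computable_cong[OF computable_nth[of "Suc i"]]) (auto simp: nth_tl)

lemma computable_tl2_nth: "Suc (Suc i) < n \<Longrightarrow> computable n (\<lambda>ys. tl (tl ys) ! i)"
  by (rule computable_cong[OF computable_nth[of "Suc (Suc i)"]]) (auto simp: nth_tl)

lemma computable_tl3_nth: "Suc (Suc (Suc i)) < n \<Longrightarrow> computable n (\<lambda>ys. tl (tl (tl ys)) ! i)"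
  by (rule computable_cong[OF computable_nth[of "Suc (Suc (Suc i))"]]) (auto simp: nth_tl)

lemma computable_tl4_nth: "Suc (Suc (Suc (Suc i))) < n \<Longrightarrow> computable n (\<lambda>ys. tl (tl (tl (tl ys))) ! i)"
  by (rule computable_cong[OF computable_nth[of "Suc (Suc (Suc (Suc i)))"]]) (auto simp: nth_tl)

lemmas computable_base = computable_nth computable_Suc computable_drop_nth computable_tl_nth computable_tl2_nth computable_tl3_nth computable_tl4_nth computable_const

lemma computable_add: assumes "computable n a" "computable n b" shows "computable n (\<lambda>xs. a xs + b xs)"
proof (rule computable_comp2[where f = "(+)", OF _ assms])
  have "rec_nat x (\<lambda>_. Suc) y = x + y" for x y by (induction y) auto
  moreover have "computable 2 (\<lambda>xs. rec_nat (xs ! 0) (\<lambda>k r. Suc r) (xs ! 1))"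
    by (intro computable_rec computable_base) auto
  ultimately show "computable 2 (\<lambda>xs. xs ! 0 + xs ! 1)" by simp
qed

lemma computable_mult: assumes "computable n a" "computable n b" shows "computable n (\<lambda>xs. a xs * b xs)"
proof (rule computable_comp2[where f = "(*)", OF _ assms])
  have "rec_nat 0 (\<lambda>_ r. r + x) y = x * y" for x y :: nat by (induction y) auto
  moreover have "computable 2 (\<lambda>xs. rec_nat 0 (\<lambda>k r. r + xs ! 0) (xs ! 1))"
    by (intro computable_rec computable_base computable_add) auto
  ultimately show "computable 2 (\<lambda>xs. xs ! 0 * xs ! 1)" by simp
qed

lemma computable_power: assumes "computable n a" "computable n b" shows "computable n (\<lambda>xs. a xs ^ b xs)"
proof (rule computable_comp2[where f = "(^)", OF _ assms])
  have "rec_nat 1 (\<lambda>_ r. r * x) y = x ^ y" for x y :: nat by (induction y) auto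
  moreover have "computable 2 (\<lambda>xs. rec_nat 1 (\<lambda>k r. r * xs ! 0) (xs ! 1))"
    by (intro computable_rec computable_base computable_mult) auto
  ultimately show "computable 2 (\<lambda>xs. xs ! 0 ^ xs ! 1)" by simp
qed

lemma computable_fact: assumes "computable n a" shows "computable n (\<lambda>xs. fact (a xs))"
proof (rule computable_comp1[where f = fact, OF _ assms])
  have "rec_nat 1 (\<lambda>k r. r * Suc k) y = fact y" for y :: nat by (induction y) auto
  moreover have "computable 1 (\<lambda>xs. rec_nat 1 (\<lambda>k r. r * Suc k) (xs ! 0))"
    by (intro computable_rec computable_base computable_mult) auto
  ultimately show "computable 1 (\<lambda>xs. fact (xs ! 0))" by simp
qed

lemma computable_diff: assumes "computable n a" "computable n b" shows "computable n (\<lambda>xs. a xs - b xs)"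
proof -
  have pred: "computable m (\<lambda>xs. c xs - 1)" if "computable m c" for m c
  proof (rule computable_comp1[where f = "\<lambda>x. x - 1", OF _ that])
    have "rec_nat 0 (\<lambda>k _. k) y = y - 1" for y :: nat by (induction y) auto
    moreover have "computable 1 (\<lambda>xs. rec_nat 0 (\<lambda>k r. k) (xs ! 0))" by (intro computable_rec computable_base) auto
    ultimately show "computable 1 (\<lambda>xs. xs ! 0 - 1)" by simp
  qed
  show ?thesis
  proof (rule computable_comp2[where f = "(-)", OF _ assms])
    have "rec_nat x (\<lambda>_ r. r - 1) y = x - y" for x y :: nat by (induction y) auto
    moreover have "computable 2 (\<lambda>xs. rec_nat (xs ! 0) (\<lambda>k r. r - 1) (xs ! 1))"
      by (intro computable_rec computable_base pred) auto
    ultimately show "computable 2 (\<lambda>xs. xs ! 0 - xs ! 1)" by simp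
  qed
qed

lemma computable_sum:
  assumes "computable n m" "computable (Suc n) (\<lambda>ys. F (ys ! 0) (tl ys))"
  shows "computable n (\<lambda>xs. \<Sum>i<m xs. F i xs)"
proof -
  have eq: "rec_nat 0 (\<lambda>k r. r + F k xs) y = (\<Sum>i<y. F i xs)" for y xs by (induction y) auto
  have "computable n (\<lambda>xs. rec_nat 0 (\<lambda>k r. r + F k xs) (m xs))"
  proof (intro computable_rec computable_add computable_base assms(1))
    let ?gs = "(\<lambda>xs. xs ! 0) # map (\<lambda>i (xs :: nat list). xs ! i) [2..<Suc (Suc n)]"
    have len: "length ?gs = Suc n" by (simp del: upt_Suc)
    have "computable (Suc (Suc n)) (\<lambda>xs. (\<lambda>ys. F (ys ! 0) (tl ys)) (map (\<lambda>g. g xs) ?gs))"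
    proof (rule computable_comp)
      show "computable (length ?gs) (\<lambda>ys. F (ys ! 0) (tl ys))" unfolding len by (rule assms(2))
      show "\<forall>g\<in>set ?gs. computable (Suc (Suc n)) g" using computable_nth by (auto simp del: upt_Suc)
    qed
    then show "computable (Suc (Suc n)) (\<lambda>ys. F (ys ! 0) (drop 2 ys))"
    proof (rule computable_cong)
      fix xs :: "nat list" assume "length xs = Suc (Suc n)"
      then have "map (\<lambda>g. g xs) ?gs = xs ! 0 # drop 2 xs" by (auto intro!: nth_equalityI simp del: upt_Suc)
      then show "F (xs ! 0) (drop 2 xs) = (\<lambda>ys. F (ys ! 0) (tl ys)) (map (\<lambda>g. g xs) ?gs)" by simp
    qed
  qed simp
  then show ?thesis by (simp add: eq)
qed

section \<open>Decidable predicates and bounded quantifiers\<close>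

lemma decidable_le: "computable n a \<Longrightarrow> computable n b \<Longrightarrow> decidable n (\<lambda>xs. a xs \<le> b xs)"
  unfolding decidable_def by (rule computable_cong[of n "\<lambda>xs. 1 - (a xs - b xs)"]) (auto intro!: computable_diff computable_const)

lemma decidable_not: "decidable n P \<Longrightarrow> decidable n (\<lambda>xs. \<not> P xs)"
  unfolding decidable_def by (rule computable_cong[of n "\<lambda>xs. 1 - of_bool (P xs)"]) (auto intro!: computable_diff computable_const)

lemma decidable_conj: "decidable n P \<Longrightarrow> decidable n Q \<Longrightarrow> decidable n (\<lambda>xs. P xs \<and> Q xs)"
  unfolding decidable_def by (rule computable_cong[of n "\<lambda>xs. of_bool (P xs) * of_bool (Q xs)"]) (auto intro!: computable_mult)

lemma decidable_less: "computable n a \<Longrightarrow> computable n b \<Longrightarrow> decidable n (\<lambda>xs. a xs < b xs)"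
  using decidable_not[OF decidable_le[of n b a]] by (simp add: not_le)

lemma decidable_eq: "computable n a \<Longrightarrow> computable n b \<Longrightarrow> decidable n (\<lambda>xs. a xs = b xs)"
  using decidable_conj[OF decidable_le[of n a b] decidable_le[of n b a]] by (simp add: eq_iff)

lemma decidable_imp: "decidable n P \<Longrightarrow> decidable n Q \<Longrightarrow> decidable n (\<lambda>xs. P xs \<longrightarrow> Q xs)"
  using decidable_not[OF decidable_conj[OF _ decidable_not[of n Q]], of P] by simp

lemma decidable_iff: "decidable n P \<Longrightarrow> decidable n Q \<Longrightarrow> decidable n (\<lambda>xs. P xs = Q xs)"
  using decidable_conj[OF decidable_imp[of n P Q] decidable_imp[of n Q P]] by (simp add: iff_conv_conj_imp)

lemma computable_if:
  assumes "decidable n P" "computable n a" "computable n b"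
  shows "computable n (\<lambda>xs. if P xs then a xs else b xs)"
  by (rule computable_cong[of n "\<lambda>xs. of_bool (P xs) * a xs + (1 - of_bool (P xs)) * b xs"])
    (use assms in \<open>auto intro!: computable_add computable_mult computable_diff computable_const simp: decidable_def\<close>)

lemma decidable_bex:
  assumes "computable n m" "decidable (Suc n) (\<lambda>ys. P (ys ! 0) (tl ys))"
  shows "decidable n (\<lambda>xs. \<exists>i<m xs. P i xs)"
proof -
  have "computable n (\<lambda>xs. \<Sum>i<m xs. of_bool (P i xs))"
    by (rule computable_sum) (use assms in \<open>simp_all add: decidable_def\<close>)
  then have "decidable n (\<lambda>xs. 0 < (\<Sum>i<m xs. of_bool (P i xs) :: nat))" by (intro decidable_less computable_const)
  moreover have "0 < (\<Sum>i<m xs. of_bool (P i xs) :: nat) \<longleftrightarrow> (\<exists>i<m xs. P i xs)" for xs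
    by (auto simp: neq0_conv[symmetric] simp del: neq0_conv)
  ultimately show ?thesis by simp
qed

lemma decidable_ball:
  assumes "computable n m" "decidable (Suc n) (\<lambda>ys. P (ys ! 0) (tl ys))"
  shows "decidable n (\<lambda>xs. \<forall>i<m xs. P i xs)"
  using decidable_not[OF decidable_bex[OF assms(1) decidable_not[OF assms(2)]]] by simp

lemma decidable_odd: assumes "computable n a" shows "decidable n (\<lambda>xs. odd (a xs))"
  unfolding decidable_def
proof (rule computable_comp1[where f = "\<lambda>x. of_bool (odd x)", OF _ assms])
  have "rec_nat 0 (\<lambda>_ r. 1 - r) y = (of_bool (odd y) :: nat)" for y by (induction y) auto
  moreover have "computable 1 (\<lambda>xs. rec_nat 0 (\<lambda>k r. 1 - r) (xs ! 0))"
    by (intro computable_rec computable_base computable_diff) auto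
  ultimately show "computable 1 (\<lambda>xs. of_bool (odd (xs ! 0)))" by simp
qed

lemma computable_half: assumes "computable n a" shows "computable n (\<lambda>xs. a xs div 2)"
proof (rule computable_comp1[where f = "\<lambda>x. x div 2", OF _ assms])
  have "rec_nat 0 (\<lambda>k r. r + of_bool (odd k)) y = y div 2" for y :: nat
    by (induction y) (auto simp: odd_Suc_div_two)
  moreover have "computable 1 (\<lambda>xs. rec_nat 0 (\<lambda>k r. r + of_bool (odd k)) (xs ! 0))"
    by (intro computable_rec computable_base computable_add decidable_odd[unfolded decidable_def]) auto
  ultimately show "computable 1 (\<lambda>xs. xs ! 0 div 2)" by simp
qed

lemma decidable_set_decode: assumes "computable n a" "computable n b" shows "decidable n (\<lambda>xs. a xs \<in> set_decode (b xs))"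
proof -
  have "computable n (\<lambda>xs. b xs div 2 ^ a xs)"
  proof (rule computable_comp2[where f = "\<lambda>x y. y div 2 ^ x", OF _ assms])
    have "rec_nat y (\<lambda>_ r. r div 2) x = y div 2 ^ x" for x y :: nat
      by (induction x) (simp_all add: div_mult2_eq[symmetric] mult.commute)
    moreover have "computable 2 (\<lambda>xs. rec_nat (xs ! 1) (\<lambda>k r. r div 2) (xs ! 0))"
      by (intro computable_rec computable_base computable_half) auto
    ultimately show "computable 2 (\<lambda>xs. xs ! 1 div 2 ^ (xs ! 0))" by simp
  qed
  then show ?thesis unfolding set_decode_def by (simp add: decidable_odd)
qed

section \<open>Recursiveness of the pairing function and its projections\<close>

lemma computable_prod_encode: assumes "computable n a" "computable n b" shows "computable n (\<lambda>xs. prod_encode (a xs, b xs))"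
proof (rule computable_comp2[where f = "\<lambda>x y. prod_encode (x, y)", OF _ assms])
  have "(\<Sum>i<Suc m. i) = triangle m" for m by (induction m) (auto simp: triangle_def)
  then have "prod_encode (x, y) = (\<Sum>i<Suc (x + y). i) + x" for x y by (simp add: prod_encode_def)
  moreover have "computable 2 (\<lambda>xs. (\<Sum>i<Suc (xs ! 0 + xs ! 1). i) + xs ! 0)"
    by (intro computable_add computable_sum computable_base) auto
  ultimately show "computable 2 (\<lambda>xs. prod_encode (xs ! 0, xs ! 1))" by simp
qed

text \<open>Both components are at most the code, so each projection is a bounded sum with at most
  one nonzero summand.\<close>

lemma prod_decode_as_sum:
  "fst (prod_decode z) = (\<Sum>a<Suc z. a * of_bool (\<exists>b<Suc z. prod_encode (a, b) = z))"
  "snd (prod_decode z) = (\<Sum>b<Suc z. b * of_bool (\<exists>a<Suc z. prod_encode (a, b) = z))"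
proof -
  obtain x y where xy: "prod_decode z = (x, y)" by fastforce
  then have z: "z = prod_encode (x, y)" by (metis prod_decode_inverse)
  have xz: "x < Suc z" "y < Suc z" using z le_prod_encode_1 le_prod_encode_2 by (simp_all add: less_Suc_eq_le)
  have "(\<exists>b<Suc z. prod_encode (a, b) = z) \<longleftrightarrow> a = x" for a using z xz by auto
  then show "fst (prod_decode z) = (\<Sum>a<Suc z. a * of_bool (\<exists>b<Suc z. prod_encode (a, b) = z))"
    using xy xz by (simp add: of_bool_def if_distrib[of "(*) _"] cong: if_cong)
  have "(\<exists>a<Suc z. prod_encode (a, b) = z) \<longleftrightarrow> b = y" for b using z xz by auto
  then show "snd (prod_decode z) = (\<Sum>b<Suc z. b * of_bool (\<exists>a<Suc z. prod_encode (a, b) = z))"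
    using xy xz by (simp add: of_bool_def if_distrib[of "(*) _"] cong: if_cong)
qed

lemma computable_fst_decode: assumes "computable n a" shows "computable n (\<lambda>xs. fst (prod_decode (a xs)))"
proof (rule computable_comp1[where f = "\<lambda>x. fst (prod_decode x)", OF _ assms])
  show "computable 1 (\<lambda>xs. fst (prod_decode (xs ! 0)))" unfolding prod_decode_as_sum
    by (intro computable_sum computable_mult computable_base decidable_bex[unfolded decidable_def] decidable_eq[unfolded decidable_def] computable_prod_encode) auto
qed

lemma computable_snd_decode: assumes "computable n a" shows "computable n (\<lambda>xs. snd (prod_decode (a xs)))"
proof (rule computable_comp1[where f = "\<lambda>x. snd (prod_decode x)", OF _ assms])
  show "computable 1 (\<lambda>xs. snd (prod_decode (xs ! 0)))" unfolding prod_decode_as_sum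
    by (intro computable_sum computable_mult computable_base decidable_bex[unfolded decidable_def] decidable_eq[unfolded decidable_def] computable_prod_encode) auto
qed

lemma computable_of_bool: "decidable n P \<Longrightarrow> computable n (\<lambda>xs. of_bool (P xs))"
  by (simp add: decidable_def)

lemmas computable_intros = computable_nth computable_Suc computable_drop_nth computable_tl_nth computable_tl2_nth computable_tl3_nth computable_tl4_nth computable_const
  computable_add computable_mult computable_power computable_fact computable_diff computable_if computable_prod_encode computable_fst_decode computable_snd_decode
  computable_of_bool computable_sum decidable_le decidable_less decidable_eq decidable_not decidable_conj decidable_imp decidable_iff decidable_set_decode
  decidable_bex decidable_ball

section \<open>Decidability of the spectrum\<close>

lemma prod_encode_mono: "a \<le> a' \<Longrightarrow> b \<le> b' \<Longrightarrow> prod_encode (a, b) \<le> prod_encode (a', b')"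
proof -
  assume ab: "a \<le> a'" "b \<le> b'"
  have "triangle (a + b) \<le> triangle (a' + b')"
    unfolding triangle_def using ab by (intro div_le_mono mult_le_mono) auto
  then show ?thesis using ab by (simp add: prod_encode_def)
qed

text \<open>A number \<open>w\<close>, read as the set \<open>set_decode w\<close>, carries a structure on \<open>{..<n}\<close> (tags 0 and 1),
  a truth table (tag 2) and a set of codes closed under subformulas (tag 3) on which the table has
  to be correct.\<close>

definition in_un where "in_un w P a \<longleftrightarrow> prod_encode (0, prod_encode (P, a)) \<in> set_decode w"
definition in_bin where "in_bin w R a b \<longleftrightarrow> prod_encode (1, prod_encode (R, prod_encode (a, b))) \<in> set_decode w"
definition in_tab where "in_tab w x a b \<longleftrightarrow> prod_encode (2, prod_encode (x, prod_encode (a, b))) \<in> set_decode w"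
definition in_sub where "in_sub w x \<longleftrightarrow> prod_encode (3, x) \<in> set_decode w"

definition sel_arg :: "nat \<Rightarrow> nat \<Rightarrow> nat \<Rightarrow> nat" where
  "sel_arg u a b = (if u = 0 then a else b)"

definition dfst :: "nat \<Rightarrow> nat" where "dfst x = fst (prod_decode x)"
definition dsnd :: "nat \<Rightarrow> nat" where "dsnd x = snd (prod_decode x)"

lemma dfst_dsnd [simp]: "dfst (prod_encode (a, b)) = a" "dsnd (prod_encode (a, b)) = b"
  by (simp_all add: dfst_def dsnd_def)

definition table_ok :: "nat \<Rightarrow> nat \<Rightarrow> nat \<Rightarrow> nat \<Rightarrow> nat \<Rightarrow> bool" where
  "table_ok w n x a b \<longleftrightarrow> in_sub w x \<longrightarrow>
     (dfst x = 0 \<longrightarrow> in_tab w x a b = (sel_arg (dfst (dsnd x)) a b = sel_arg (dsnd (dsnd x)) a b)) \<and>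
     (dfst x = 1 \<longrightarrow> in_tab w x a b = in_bin w (dfst (dsnd x))
        (sel_arg (dfst (dsnd (dsnd x))) a b) (sel_arg (dsnd (dsnd (dsnd x))) a b)) \<and>
     (dfst x = 2 \<longrightarrow> in_tab w x a b = in_un w (dfst (dsnd x)) (sel_arg (dsnd (dsnd x)) a b)) \<and>
     (dfst x = 3 \<longrightarrow> in_sub w (dsnd x) \<and> in_tab w x a b = (\<not> in_tab w (dsnd x) a b)) \<and>
     (dfst x = 4 \<longrightarrow> in_sub w (dfst (dsnd x)) \<and> in_sub w (dsnd (dsnd x)) \<and>
        in_tab w x a b = (in_tab w (dfst (dsnd x)) a b \<and> in_tab w (dsnd (dsnd x)) a b)) \<and>
     (dfst x = 5 \<longrightarrow> in_sub w (dsnd (dsnd (dsnd x))) \<and>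
        in_tab w x a b = (dfst (dsnd x) \<le> (\<Sum>d<n. of_bool (in_tab w (dsnd (dsnd (dsnd x)))
          (if dfst (dsnd (dsnd x)) = 0 then d else a) (if dfst (dsnd (dsnd x)) = 0 then b else d)))))"

text \<open>Tags are at most 3 and pairing is monotone, so the relevant sets have no element above
  the pair in the exponent; this bounds \<open>w\<close>. The arguments \<open>0 0\<close> are
  arbitrary, since \<open>c\<close> is meant to code a sentence.\<close>

definition has_model :: "nat \<Rightarrow> nat \<Rightarrow> bool" where
  "has_model c n \<longleftrightarrow> 0 < n \<and> (\<exists>w<2 ^ Suc (prod_encode (3, prod_encode (c, prod_encode (n, n)))).
     (\<forall>x<Suc c. \<forall>a<n. \<forall>b<n. table_ok w n x a b) \<and> in_sub w c \<and> in_tab w c 0 0)"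

definition asg :: "nat \<Rightarrow> nat \<Rightarrow> var \<Rightarrow> nat" where
  "asg a b v = (case v of VX \<Rightarrow> a | VY \<Rightarrow> b)"

lemma asg_upd: "(asg a b)(z := d) = asg (if z = VX then d else a) (if z = VX then b else d)"
  by (rule ext, rename_tac y, case_tac y; cases z) (simp_all add: asg_def)

lemma sel_arg_asg: "sel_arg (var_code u) a b = asg a b u"
  by (cases u) (simp_all add: sel_arg_def asg_def)

lemma var_code_eq_0: "var_code z = 0 \<longleftrightarrow> z = VX"
  by (cases z) simp_all

lemma c2_code_sub_le:
  "c2_code \<psi> \<le> c2_code (CNot \<psi>)" "c2_code \<psi> \<le> c2_code (CAnd \<psi> \<chi>)" "c2_code \<chi> \<le> c2_code (CAnd \<psi> \<chi>)"
  "c2_code \<psi> \<le> c2_code (CEx k z \<psi>)" "R \<le> c2_code (CBin R u v)" "R \<le> c2_code (CUn R u)"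
  by (auto intro: order.trans[OF _ le_prod_encode_2] order.trans[OF _ le_prod_encode_1] le_prod_encode_1 le_prod_encode_2)

lemma table_correct:
  assumes ok: "\<And>x a b. x \<le> c \<Longrightarrow> a < n \<Longrightarrow> b < n \<Longrightarrow> table_ok w n x a b"
    and M: "M = \<lparr>Dom = {..<n}, Unary = in_un w, Binary = in_bin w\<rparr>"
    and "c2_code \<psi> \<le> c" "in_sub w (c2_code \<psi>)" "a < n" "b < n"
  shows "in_tab w (c2_code \<psi>) a b = c2_sat M (asg a b) \<psi>"
  using assms(3-)
proof (induction \<psi> arbitrary: a b)
  case (CEq u v)
  then show ?case using ok[of "c2_code (CEq u v)" a b] by (simp add: table_ok_def sel_arg_asg)
next
  case (CBin R u v)
  then show ?case using ok[of "c2_code (CBin R u v)" a b] by (simp add: table_ok_def sel_arg_asg M)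
next
  case (CUn P u)
  then show ?case using ok[of "c2_code (CUn P u)" a b] by (simp add: table_ok_def sel_arg_asg M)
next
  case (CNot \<psi>)
  have "in_sub w (c2_code \<psi>)" "in_tab w (c2_code (CNot \<psi>)) a b = (\<not> in_tab w (c2_code \<psi>) a b)"
    using ok[of "c2_code (CNot \<psi>)" a b] CNot.prems by (simp_all add: table_ok_def)
  moreover have "c2_code \<psi> \<le> c" using CNot.prems(1) c2_code_sub_le(1) order.trans by blast
  ultimately show ?case using CNot.IH[of a b] CNot.prems(3,4) by simp
next
  case (CAnd \<psi> \<chi>)
  have "in_sub w (c2_code \<psi>)" "in_sub w (c2_code \<chi>)"
    "in_tab w (c2_code (CAnd \<psi> \<chi>)) a b = (in_tab w (c2_code \<psi>) a b \<and> in_tab w (c2_code \<chi>) a b)"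
    using ok[of "c2_code (CAnd \<psi> \<chi>)" a b] CAnd.prems by (simp_all add: table_ok_def)
  moreover have "c2_code \<psi> \<le> c" "c2_code \<chi> \<le> c" using CAnd.prems(1) c2_code_sub_le(2,3) order.trans by blast+
  ultimately show ?case using CAnd.IH(1)[of a b] CAnd.IH(2)[of a b] CAnd.prems(3,4) by simp
next
  case (CEx k z \<psi>)
  let ?t = "\<lambda>d. in_tab w (c2_code \<psi>) (if z = VX then d else a) (if z = VX then b else d)"
  have *: "in_sub w (c2_code \<psi>)" "in_tab w (c2_code (CEx k z \<psi>)) a b \<longleftrightarrow> k \<le> (\<Sum>d<n. of_bool (?t d))"
    using ok[of "c2_code (CEx k z \<psi>)" a b] CEx.prems by (simp_all add: table_ok_def var_code_eq_0)
  have c: "c2_code \<psi> \<le> c" using CEx.prems(1) c2_code_sub_le(4) order.trans by blast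
  have td: "?t d = c2_sat M ((asg a b)(z := d)) \<psi>" if "d < n" for d
    unfolding asg_upd using CEx.IH[OF c *(1)] CEx.prems(3,4) that by simp
  have DM: "Dom M = {..<n}" by (simp add: M)
  have "{..<n} \<inter> {d. ?t d} = {d \<in> Dom M. c2_sat M ((asg a b)(z := d)) \<psi>}"
    unfolding DM using td by blast
  then have "(\<Sum>d<n. of_bool (?t d)) = card {d \<in> Dom M. c2_sat M ((asg a b)(z := d)) \<psi>}"
    by (simp add: sum_of_bool_eq)
  then show ?case unfolding *(2) by (subst c2_sat_CEx_card) (simp_all add: M)
qed

lemma has_model_imp_Spec:
  assumes "c2_sentence \<phi>" "has_model (c2_code \<phi>) n"
  shows "n \<in> Spec \<phi>"
proof -
  obtain w where w: "\<And>x a b. x < Suc (c2_code \<phi>) \<Longrightarrow> a < n \<Longrightarrow> b < n \<Longrightarrow> table_ok w n x a b"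
    "in_sub w (c2_code \<phi>)" "in_tab w (c2_code \<phi>) 0 0" and n: "0 < n"
    using assms(2) unfolding has_model_def by blast
  define M where "M = \<lparr>Dom = {..<n}, Unary = in_un w, Binary = in_bin w\<rparr>"
  have "c2_sat M (asg 0 0) \<phi>"
    using table_correct[of "c2_code \<phi>" n w M \<phi> 0 0] w n M_def by (simp add: less_Suc_eq_le)
  then have "c2_sat M \<sigma> \<phi>" for \<sigma>
    using c2_sat_cong[of \<phi> \<sigma> "asg 0 0" M] assms(1) by (simp add: c2_sentence_def)
  then have "c2_model M \<phi>" using n by (auto simp: c2_model_def M_def)
  then show ?thesis using Spec_any_type[of M \<phi>] by (simp add: M_def)
qed

lemma Spec_imp_has_model:
  assumes "c2_sentence \<phi>" "n \<in> Spec \<phi>"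
  shows "has_model (c2_code \<phi>) n"
proof -
  define c where "c = c2_code \<phi>"
  obtain M0 :: "nat struct" where M0: "finite (Dom M0)" "card (Dom M0) = n" "c2_model M0 \<phi>"
    using assms(2) unfolding Spec_def by blast
  have n: "0 < n" using M0 by (auto simp: c2_model_def card_gt_0_iff)
  obtain g where g: "bij_betw g {..<n} (Dom M0)"
    using ex_bij_betw_nat_finite[OF M0(1)] M0(2) by (auto simp: atLeast0LessThan)
  define M where "M = \<lparr>Dom = {..<n}, Unary = \<lambda>P a. Unary M0 P (g a), Binary = \<lambda>R a b. Binary M0 R (g a) (g b)\<rparr>"
  have satM: "c2_sat M (asg 0 0) \<phi>"
  proof -
    have r: "range (asg 0 0) \<subseteq> Dom M" using n by (auto simp: M_def asg_def split: var.splits)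
    have "c2_sat M0 (g \<circ> asg 0 0) \<phi> = c2_sat M (asg 0 0) \<phi>"
      by (rule c2_sat_iso[OF _ _ _ r]) (use g in \<open>simp_all add: M_def\<close>)
    moreover have "range (g \<circ> asg 0 0) \<subseteq> Dom M0" using r g by (auto simp: M_def bij_betw_def)
    ultimately show ?thesis using M0(3) by (simp add: c2_model_def)
  qed
  \<comment> \<open>Every formula of code at most \<open>c\<close> is tabulated and marked. This
    collection is closed under subformulas because their codes are no larger, and predicate indices
    up to \<open>c\<close> cover all symbols that occur in it.\<close>
  define A where "A = {prod_encode (0, prod_encode (P, a)) | P a. P \<le> c \<and> a < n \<and> Unary M P a}
    \<union> {prod_encode (1, prod_encode (R, prod_encode (a, b))) | R a b. R \<le> c \<and> a < n \<and> b < n \<and> Binary M R a b}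
    \<union> {prod_encode (2, prod_encode (c2_code \<psi>, prod_encode (a, b))) | \<psi> a b.
         c2_code \<psi> \<le> c \<and> a < n \<and> b < n \<and> c2_sat M (asg a b) \<psi>}
    \<union> {prod_encode (3, c2_code \<psi>) | \<psi>. c2_code \<psi> \<le> c}"
  define m where "m = Suc (prod_encode (3, prod_encode (c, prod_encode (n, n))))"
  have nn: "n \<le> prod_encode (n, n)" "c \<le> prod_encode (c, prod_encode (n, n))" by (rule le_prod_encode_1)+
  have Am: "A \<subseteq> {..<m}"
    unfolding A_def m_def using nn
    by (auto simp: less_Suc_eq_le intro!: prod_encode_mono)
  then have finA: "finite A" by (rule finite_subset) simp
  define w where "w = set_encode A"
  have "w \<le> set_encode {..<m}" unfolding w_def set_encode_def using Am by (auto intro: sum_mono2)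
  also have "set_encode {..<m} < 2 ^ m" unfolding set_encode_def
    by (simp add: sum_power2 lessThan_atLeast0)
  finally have wm: "w < 2 ^ m" .
  have dw: "set_decode w = A" using finA by (simp add: w_def)
  have un: "in_un w P a \<longleftrightarrow> Unary M P a" if "P \<le> c" "a < n" for P a
    unfolding in_un_def dw A_def using that by auto
  have bin: "in_bin w R a b \<longleftrightarrow> Binary M R a b" if "R \<le> c" "a < n" "b < n" for R a b
    unfolding in_bin_def dw A_def using that by auto
  have tab: "in_tab w (c2_code \<psi>) a b \<longleftrightarrow> c2_sat M (asg a b) \<psi>" if "c2_code \<psi> \<le> c" "a < n" "b < n" for \<psi> a b
    unfolding in_tab_def dw A_def using that by auto
  have sub: "in_sub w x \<longleftrightarrow> (\<exists>\<psi>. x = c2_code \<psi> \<and> c2_code \<psi> \<le> c)" for x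
    unfolding in_sub_def dw A_def by auto
  have "table_ok w n x a b" if ab: "a < n" "b < n" for x a b
  proof (cases "in_sub w x")
    case True
    then obtain \<psi> where \<psi>: "x = c2_code \<psi>" "c2_code \<psi> \<le> c" using sub by blast
    have an: "asg a b u < n" for u using ab by (cases u) (simp_all add: asg_def)
    note t = tab[OF \<psi>(2) ab]
    show ?thesis
    proof (cases \<psi>)
      case (CEq u v)
      then show ?thesis using t \<psi> by (simp add: table_ok_def sel_arg_asg)
    next
      case (CBin R u v)
      then have "R \<le> c" using \<psi>(2) c2_code_sub_le(5)[of R u v] by simp
      then show ?thesis using t \<psi> CBin bin[OF _ an an] by (simp add: table_ok_def sel_arg_asg)
    next
      case (CUn P u)
      then have "P \<le> c" using \<psi>(2) c2_code_sub_le(6)[of P u] by simp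
      then show ?thesis using t \<psi> CUn un[OF _ an] by (simp add: table_ok_def sel_arg_asg)
    next
      case (CNot \<chi>)
      then have "c2_code \<chi> \<le> c" using \<psi>(2) c2_code_sub_le(1)[of \<chi>] by simp
      then show ?thesis using t \<psi> CNot tab[OF _ ab, of \<chi>] sub[of "c2_code \<chi>"] by (auto simp: table_ok_def)
    next
      case (CAnd \<chi> \<chi>')
      then have "c2_code \<chi> \<le> c" "c2_code \<chi>' \<le> c" using \<psi>(2) c2_code_sub_le(2,3)[of \<chi> \<chi>'] c2_code_sub_le(3)[of \<chi>' \<chi>] by auto
      then show ?thesis using t \<psi> CAnd tab[OF _ ab, of \<chi>] tab[OF _ ab, of \<chi>'] sub[of "c2_code \<chi>"] sub[of "c2_code \<chi>'"]
        by (auto simp: table_ok_def)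
    next
      case (CEx k z \<chi>)
      then have c: "c2_code \<chi> \<le> c" using \<psi>(2) c2_code_sub_le(4)[of \<chi> k z] by simp
      let ?t = "\<lambda>d. in_tab w (c2_code \<chi>) (if z = VX then d else a) (if z = VX then b else d)"
      have td: "?t d = c2_sat M ((asg a b)(z := d)) \<chi>" if "d < n" for d
        unfolding asg_upd using tab[OF c] ab that by simp
      have DM: "Dom M = {..<n}" by (simp add: M_def)
      have "{..<n} \<inter> {d. ?t d} = {d \<in> Dom M. c2_sat M ((asg a b)(z := d)) \<chi>}"
        unfolding DM using td by blast
      then have "(\<Sum>d<n. of_bool (?t d)) = card {d \<in> Dom M. c2_sat M ((asg a b)(z := d)) \<chi>}"
        by (simp add: sum_of_bool_eq)
      then have "c2_sat M (asg a b) \<psi> \<longleftrightarrow> k \<le> (\<Sum>d<n. of_bool (?t d))"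
        unfolding CEx by (subst c2_sat_CEx_card) (simp_all add: M_def)
      moreover have "in_sub w (c2_code \<chi>)" using sub c by blast
      ultimately show ?thesis using t \<psi>(1) CEx by (simp add: table_ok_def var_code_eq_0)
    qed
  qed (simp add: table_ok_def)
  moreover have "in_sub w c" "in_tab w c 0 0" using sub tab[of \<phi> 0 0] n satM by (auto simp: c_def)
  ultimately show ?thesis using n wm unfolding has_model_def m_def c_def by blast
qed

lemma decidable_has_model: "computable n a \<Longrightarrow> computable n b \<Longrightarrow> decidable n (\<lambda>xs. has_model (a xs) (b xs))"
  unfolding decidable_def
proof (rule computable_comp2[where f = "\<lambda>x y. of_bool (has_model x y)"])
  have "decidable 2 (\<lambda>xs. has_model (xs ! 0) (xs ! 1))"
    unfolding has_model_def table_ok_def in_un_def in_bin_def in_tab_def in_sub_def sel_arg_def dfst_def dsnd_def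
    by (intro computable_intros) simp_all
  then show "computable 2 (\<lambda>xs. of_bool (has_model (xs ! 0) (xs ! 1)))" by (simp add: decidable_def)
qed

section \<open>Periodicity of the spectrum\<close>

text \<open>The sizes that follow are those of \<open>labelled_graph\<close> as functions of the
  code alone, for \<open>K = c\<close>, colours in \<open>Pow {..c}\<close> and labels in
  \<open>Pow {..c} \<times> Pow {..c}\<close>; \<open>n_ess\<close> is \<open>\<Delta>\<close> and
  \<open>large_type\<close> is \<open>B\<close>.\<close>

definition n_colours :: "nat \<Rightarrow> nat" where "n_colours c = 2 ^ Suc c"
definition n_labels :: "nat \<Rightarrow> nat" where "n_labels c = 2 ^ Suc c * 2 ^ Suc c"
definition n_ess :: "nat \<Rightarrow> nat" where "n_ess c = c * n_colours c * n_labels c"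
definition n_types :: "nat \<Rightarrow> nat" where
  "n_types c = n_colours c * (c + 1) ^ (n_colours c * n_labels c)"
definition n_kinds :: "nat \<Rightarrow> nat" where "n_kinds c = n_types c * (n_types c * (n_labels c * 2))"
definition block_size :: "nat \<Rightarrow> nat" where "block_size c = block_bound (n_ess c) (n_kinds c)"
definition period :: "nat \<Rightarrow> nat" where "period c = fact (block_size c)"
definition large_type :: "nat \<Rightarrow> nat" where "large_type c = period c + 4 * n_ess c + 6"
definition threshold :: "nat \<Rightarrow> nat" where
  "threshold c = Suc (block_size c * ((n_types c * large_type c + n_types c * large_type c * n_ess c)
     + n_kinds c * (4 * (n_ess c + 1) * (n_ess c + 1) + 2 * period c * n_ess c) + block_size c * period c))"

text \<open>Removing a period from a model above the threshold must leave a nonempty model.\<close>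

lemma period_less_threshold: "period c < threshold c"
proof -
  have "0 < block_size c" by (simp add: block_size_def block_bound_pos)
  then have "1 * (1 * period c) \<le> block_size c * (block_size c * period c)" by (intro mult_le_mono) auto
  also have "\<dots> < threshold c" by (simp add: threshold_def algebra_simps)
  finally show ?thesis by simp
qed

text \<open>Counting thresholds, predicate indices and codes of subformulas are all at most the code
  \<open>c\<close> of \<open>\<phi>\<close>, so \<open>c\<close> can serve as \<open>K\<close> and
  delimit colours and labels at the same time.\<close>

lemma Spec_pump:
  assumes \<phi>: "c2_sentence \<phi>" "c2_code \<phi> = c" and m: "m \<in> Spec \<phi>" "threshold c \<le> m"
    and n: "n = m + period c \<or> n + period c = m"
  shows "n \<in> Spec \<phi>"
proof -
  obtain M :: "nat struct" where M: "finite (Dom M)" "card (Dom M) = m" "c2_model M \<phi>"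
    using m(1) unfolding Spec_def by blast
  let ?C = "Pow {..c}" and ?L = "Pow {..c} \<times> Pow {..c}"
  interpret labelled_graph "Dom M" "lab c M" prod.swap "colour c M" c ?C ?L "large_type c"
    by unfold_locales (use M(1) in \<open>auto simp: colour_def lab_def\<close>)
  have C: "card ?C = n_colours c" and L: "card ?L = n_labels c"
    by (simp_all add: n_colours_def n_labels_def card_Pow card_cartesian_product)
  have 1: "\<Delta> = n_ess c" by (simp add: \<Delta>_def n_ess_def C L)
  have 2: "card Ty = n_types c" by (simp add: card_Ty n_types_def C L)
  have 3: "card kinds = n_kinds c" by (simp add: card_kinds n_kinds_def 2 L)
  have "\<exists>(V' :: nat set) f e'. finite V' \<and> card V' = n \<and> (\<forall>u\<in>V'. f u \<in> Dom M)
    \<and> (\<forall>u\<in>V'. \<forall>v\<in>V'. u \<noteq> v \<longrightarrow> e' v u = prod.swap (e' u v))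
    \<and> (\<forall>u\<in>V'. \<forall>d l. min c (card {v \<in> V'. v \<noteq> u \<and> colour c M (f v) = d \<and> e' u v = l}) = min c (card (nb (f u) d l)))"
  proof (rule exists_pumped_graph[where L = "block_size c" and p = "period c"])
    show "block_size c = block_bound \<Delta> (card kinds)" by (simp add: block_size_def 1 3)
    show "period c = fact (block_size c)" by (simp add: period_def)
    show "large_type c = period c + 4 * \<Delta> + 6" by (simp add: large_type_def 1)
    show "block_size c * ((card Ty * large_type c + card Ty * large_type c * \<Delta>)
      + card kinds * thr (period c) + block_size c * period c) \<le> card (Dom M)"
      using m(2) unfolding M(2) thr_def 1 2 3 threshold_def by linarith
    show "n = card (Dom M) + period c \<or> n + period c = card (Dom M)" using n M(2) by simp
  qed
  then obtain V' :: "nat set" and f e' where V': "finite V'" "card V' = n" "\<forall>u\<in>V'. f u \<in> Dom M"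
    "\<forall>u\<in>V'. \<forall>v\<in>V'. u \<noteq> v \<longrightarrow> e' v u = prod.swap (e' u v)"
    "\<forall>u\<in>V'. \<forall>d l. min c (card {v \<in> V'. v \<noteq> u \<and> colour c M (f v) = d \<and> e' u v = l}) = min c (card (nb (f u) d l))"
    by (elim exE conjE)
  have "0 < n" using n m(2) period_less_threshold[of c] by auto
  then have ne: "V' \<noteq> {}" using V'(2) by auto
  have "card V' \<in> Spec \<phi>"
  proof (rule relabel_model[OF M(1) V'(1) ne _ _ _ \<phi> M(3)])
    show "f u \<in> Dom M" if "u \<in> V'" for u using V'(3) that by blast
    show "e' v u = prod.swap (e' u v)" if "u \<in> V'" "v \<in> V'" "u \<noteq> v" for u v using V'(4) that by blast
    show "min c (card {v \<in> V'. v \<noteq> u \<and> colour c M (f v) = d \<and> e' u v = l})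
      = min c (card {b \<in> Dom M. b \<noteq> f u \<and> colour c M b = d \<and> lab c M (f u) b = l})" if "u \<in> V'" for u d l
      using V'(5) that unfolding nb_def by blast
  qed
  then show ?thesis using V'(2) by simp
qed

lemma Spec_periodic:
  assumes "c2_sentence \<phi>" "c2_code \<phi> = c" "threshold c \<le> n"
  shows "n + k * period c \<in> Spec \<phi> \<longleftrightarrow> n \<in> Spec \<phi>"
proof (induction k)
  case (Suc k)
  let ?m = "n + k * period c"
  have "?m + period c \<in> Spec \<phi> \<longleftrightarrow> ?m \<in> Spec \<phi>"
    using Spec_pump[OF assms(1,2), of ?m "?m + period c"] Spec_pump[OF assms(1,2), of "?m + period c" ?m]
      assms(3) by auto
  then show ?case using Suc by (simp add: algebra_simps)
qed simp

text \<open>The step 0 turns a progression into a single point, so the exceptional part below the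
  threshold has the same form as the periodic part. One window of length \<open>period c\<close>
  represents all residues.\<close>

lemma Spec_eq:
  assumes "c2_sentence \<phi>" "c2_code \<phi> = c"
  shows "n \<in> Spec \<phi> \<longleftrightarrow> (\<exists>r<threshold c + period c. r \<in> Spec \<phi>
    \<and> (\<exists>k. n = r + (if r < threshold c then 0 else period c) * k))"
    (is "_ \<longleftrightarrow> ?R")
proof
  assume n: "n \<in> Spec \<phi>"
  show ?R
  proof (cases "n < threshold c")
    case True
    then show ?thesis using n by (intro exI[of _ n]) auto
  next
    case False
    define r where "r = threshold c + (n - threshold c) mod period c"
    define k where "k = (n - threshold c) div period c"
    have nk: "n = r + k * period c" using False mod_mult_div_eq[of "n - threshold c" "period c"]
      by (simp add: r_def k_def mult.commute)
    moreover have "threshold c \<le> r" by (simp add: r_def)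
    then have "r \<in> Spec \<phi>" using Spec_periodic[OF assms, of r k] n nk by simp
    moreover have "r < threshold c + period c" by (simp add: r_def period_def)
    moreover have "\<not> r < threshold c" by (simp add: r_def)
    ultimately show ?thesis by (intro exI[of _ r] conjI exI[of _ k]) (simp_all add: mult.commute)
  qed
next
  assume ?R
  then obtain r k where r: "r \<in> Spec \<phi>" "n = r + (if r < threshold c then 0 else period c) * k" by blast
  show "n \<in> Spec \<phi>"
  proof (cases "r < threshold c")
    case True
    then show ?thesis using r by simp
  next
    case False
    then show ?thesis using r Spec_periodic[OF assms, of r k] by (simp add: mult.commute)
  qed
qed

section \<open>Presburger formulas for unions of arithmetic progressions\<close>

fun num_term :: "nat \<Rightarrow> pterm" where
  "num_term 0 = PZero"
| "num_term (Suc n) = PAdd (num_term n) POne"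

fun mult_term :: "nat \<Rightarrow> pterm" where
  "mult_term 0 = PZero"
| "mult_term (Suc n) = PAdd (mult_term n) (PVar 1)"

definition progression :: "nat \<Rightarrow> nat \<Rightarrow> presb" where
  "progression r m = PEx 1 (PEq (PVar 0) (PAdd (num_term r) (mult_term m)))"

text \<open>The empty disjunction is a contradiction that mentions variable 0, so this variable is
  free even if nothing is added.\<close>

fun union_formula :: "(nat \<Rightarrow> bool) \<Rightarrow> (nat \<Rightarrow> nat) \<Rightarrow> nat \<Rightarrow> presb" where
  "union_formula A s 0 = PNot (PEq (PVar 0) (PVar 0))"
| "union_formula A s (Suc n) = (if A n
     then PNot (PAnd (PNot (union_formula A s n)) (PNot (progression n (s n)))) else union_formula A s n)"

lemma val_num_term: "pterm_val e (num_term n) = n"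
  by (induction n) auto

lemma val_mult_term: "pterm_val e (mult_term n) = n * e 1"
  by (induction n) auto

lemma vars_num_term: "pterm_vars (num_term n) = {}"
  by (induction n) auto

lemma vars_mult_term: "pterm_vars (mult_term n) \<subseteq> {1}"
  by (induction n) auto

lemma sat_progression: "presb_sat e (progression r m) \<longleftrightarrow> (\<exists>k. e 0 = r + m * k)"
  by (simp add: progression_def val_num_term val_mult_term)

lemma fv_progression: "presb_fv (progression r m) = {0}"
  using vars_mult_term[of m] by (auto simp: progression_def vars_num_term)

lemma sat_union_formula:
  "presb_sat e (union_formula A s n) \<longleftrightarrow> (\<exists>r<n. A r \<and> (\<exists>k. e 0 = r + s r * k))"
  by (induction n) (auto simp: sat_progression less_Suc_eq)

lemma fv_union_formula: "presb_fv (union_formula A s n) = {0}"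
  by (induction n) (auto simp: fv_progression)

definition step :: "nat \<Rightarrow> nat \<Rightarrow> nat" where
  "step c r = (if r < threshold c then 0 else period c)"

text \<open>Membership is taken from the search \<open>has_model\<close>, which depends on the code
  alone, so the formula can be computed from it.\<close>

definition PREB :: "c2 \<Rightarrow> presb" where
  "PREB \<phi> = (let c = c2_code \<phi> in union_formula (has_model c) (step c) (threshold c + period c))"

lemma has_model_iff: "c2_sentence \<phi> \<Longrightarrow> has_model (c2_code \<phi>) n \<longleftrightarrow> n \<in> Spec \<phi>"
  using has_model_imp_Spec Spec_imp_has_model by blast

lemma PREB_correct:
  assumes "c2_sentence \<phi>"
  shows "presb_holds (PREB \<phi>) n \<longleftrightarrow> n \<in> Spec \<phi>"
  unfolding Spec_eq[OF assms refl, of n]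
  by (simp only: presb_holds_def PREB_def Let_def sat_union_formula has_model_iff[OF assms] step_def
      fun_upd_same)

section \<open>Computing the code of the formula\<close>

lemma computable_num_code: assumes "computable n a" shows "computable n (\<lambda>xs. pterm_code (num_term (a xs)))"
proof (rule computable_comp1[where f = "\<lambda>x. pterm_code (num_term x)", OF _ assms])
  have "rec_nat (prod_encode (1, 0)) (\<lambda>_ t. prod_encode (3, prod_encode (t, prod_encode (2, 0)))) x
    = pterm_code (num_term x)" for x by (induction x) auto
  moreover have "computable 1 (\<lambda>xs. rec_nat (prod_encode (1, 0))
      (\<lambda>_ t. prod_encode (3, prod_encode (t, prod_encode (2, 0)))) (xs ! 0))"
    by (intro computable_rec computable_intros) auto
  ultimately show "computable 1 (\<lambda>xs. pterm_code (num_term (xs ! 0)))" by simp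
qed

lemma computable_mult_code: assumes "computable n a" shows "computable n (\<lambda>xs. pterm_code (mult_term (a xs)))"
proof (rule computable_comp1[where f = "\<lambda>x. pterm_code (mult_term x)", OF _ assms])
  have "rec_nat (prod_encode (1, 0)) (\<lambda>_ t. prod_encode (3, prod_encode (t, prod_encode (0, 1)))) x
    = pterm_code (mult_term x)" for x by (induction x) auto
  moreover have "computable 1 (\<lambda>xs. rec_nat (prod_encode (1, 0))
      (\<lambda>_ t. prod_encode (3, prod_encode (t, prod_encode (0, 1)))) (xs ! 0))"
    by (intro computable_rec computable_intros) auto
  ultimately show "computable 1 (\<lambda>xs. pterm_code (mult_term (xs ! 0)))" by simp
qed

lemma computable_block_bound: assumes "computable n a" "computable n b" shows "computable n (\<lambda>xs. block_bound (a xs) (b xs))"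
proof (rule computable_comp2[where f = block_bound, OF _ assms])
  have "rec_nat 1 (\<lambda>_ r. r * (2 * (x * r) + 1)) y = block_bound x y" for x y by (induction y) auto
  moreover have "computable 2 (\<lambda>xs. rec_nat 1 (\<lambda>_ r. r * (2 * (xs ! 0 * r) + 1)) (xs ! 1))"
    by (intro computable_rec computable_intros) auto
  ultimately show "computable 2 (\<lambda>xs. block_bound (xs ! 0) (xs ! 1))" by simp
qed

lemma computable_sizes:
  assumes "computable n a"
  shows computable_period: "computable n (\<lambda>xs. period (a xs))" and computable_threshold: "computable n (\<lambda>xs. threshold (a xs))"
proof -
  have C: "computable n (\<lambda>xs. n_colours (a xs))" unfolding n_colours_def by (intro computable_intros assms)
  have L: "computable n (\<lambda>xs. n_labels (a xs))" unfolding n_labels_def by (intro computable_intros assms)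
  have E: "computable n (\<lambda>xs. n_ess (a xs))" unfolding n_ess_def by (intro computable_intros assms C L)
  have T: "computable n (\<lambda>xs. n_types (a xs))" unfolding n_types_def by (intro computable_intros assms C L)
  have K: "computable n (\<lambda>xs. n_kinds (a xs))" unfolding n_kinds_def by (intro computable_intros T L)
  have S: "computable n (\<lambda>xs. block_size (a xs))" unfolding block_size_def by (intro computable_block_bound E K)
  show P: "computable n (\<lambda>xs. period (a xs))" unfolding period_def by (intro computable_intros S)
  have B: "computable n (\<lambda>xs. large_type (a xs))" unfolding large_type_def by (intro computable_intros P E)
  show "computable n (\<lambda>xs. threshold (a xs))" unfolding threshold_def by (intro computable_intros S T B E K P)
qed

text \<open>\<open>F\<close> runs the recursion of \<open>union_formula\<close> on codes instead of
  formulas; the numerals are constructor tags and variable indices.\<close>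

lemma PREB_effective: "effective PREB"
proof -
  define F where "F c = rec_nat (presb_code (PNot (PEq (PVar 0) (PVar 0))))
    (\<lambda>r t. if has_model c r then prod_encode (2, prod_encode (3, prod_encode (prod_encode (2, t),
        prod_encode (2, prod_encode (4, prod_encode (1, prod_encode (1, prod_encode (prod_encode (0, 0),
          prod_encode (3, prod_encode (pterm_code (num_term r),
            pterm_code (mult_term (if r < threshold c then 0 else period c)))))))))))) else t)
    (threshold c + period c)" for c
  \<comment> \<open>The length is generalised for the induction, which varies it while the predicate
    and the steps stay fixed.\<close>
  have eq: "rec_nat (presb_code (PNot (PEq (PVar 0) (PVar 0))))
    (\<lambda>r t. if A r then prod_encode (2, prod_encode (3, prod_encode (prod_encode (2, t),
        prod_encode (2, prod_encode (4, prod_encode (1, prod_encode (1, prod_encode (prod_encode (0, 0),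
          prod_encode (3, prod_encode (pterm_code (num_term r), pterm_code (mult_term (s r)))))))))))) else t) n
      = presb_code (union_formula A s n)" for A s n
    by (induction n) (auto simp: progression_def)
  have "F (c2_code \<phi>) = presb_code (PREB \<phi>)" for \<phi>
    unfolding F_def PREB_def Let_def eq[symmetric] step_def ..
  moreover have "computable 1 (\<lambda>xs. F (xs ! 0))" unfolding F_def
    by (intro computable_rec computable_intros computable_num_code computable_mult_code computable_period computable_threshold decidable_has_model) auto
  then obtain f where "recursive 1 f" "\<And>xs. length xs = 1 \<Longrightarrow> f xs = F (xs ! 0)"
    unfolding computable_def by blast
  ultimately show ?thesis unfolding effective_def by (intro exI[of _ f]) simp
qed

theorem theorem1:
  shows "\<exists>PREB :: c2 \<Rightarrow> presb.
    (\<forall>\<phi>. c2_sentence \<phi> \<longrightarrow>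
       presb_fv (PREB \<phi>) = {0} \<and> {n. presb_holds (PREB \<phi>) n} = Spec \<phi>) \<and>
    effective PREB"
proof (intro exI[of _ PREB] conjI allI impI)
  fix \<phi> assume "c2_sentence \<phi>"
  then show "{n. presb_holds (PREB \<phi>) n} = Spec \<phi>" using PREB_correct by blast
  show "presb_fv (PREB \<phi>) = {0}" by (simp add: PREB_def Let_def fv_union_formula)
qed (rule PREB_effective)

end
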